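(* Let $(X,\varphi)$ be a Stone system. If $(X,\varphi)$ is topologically conjugate to a subshift over a finite alphabet, then the group $\mathsf{T}(\varphi)$ is finitely generated.
   Context: A Stone system $(X,\varphi)$ is a non-empty totally disconnected compact Hausdorff space $X$ together with a self-homeomorphism $\varphi$ of $X$. A subshift over a finite alphabet $A$ is a Stone system $(X,\varphi)$ where $X\subset A^{\mathbb Z}$ is a non-empty closed shift-invariant subset (isolated points allowed) and $\varphi$ is the restriction of the shift. Suspension: $Y^\varphi=(X\times\mathbb R)/\mathbb Z$, the quotient by the $\mathbb Z$-action $n\cdot(x,t)=(\varphi^n(x),t-n)$; $[x,t]$ is the class of $(x,t)$, and the suspension flow is $\Phi^t([x,s])=[x,s+t]$. $\mathsf{H}_0(\varphi)$ is the group of homeomorphisms of $Y^\varphi$ that are isotopic to the identity; equivalently (Boyle–Carlsen–Eilers), the homeomorphisms $g$ of $Y^\varphi$ for which there is a continuous $\tau\colon Y^\varphi\to\mathbb R$ with $g(y)=\Phi^{\tau(y)}(y)$ for all $y$. Charts: for a clopen $C\subset X$ put $\tau_C=\min\{n\ge1:\exists x\in C,\ \varphi^n(x)\in C\}\in\mathbb N\cup\{\infty\}$. For an open interval $J\subset\mathbb R$ of length $|J|<\tau_C$, the map $\pi_{C,J}\colon C\times J\to Y^\varphi$, $(x,t)\mapsto[x,t]$, is injective; it is called a chart and its image is denoted $U_{C\times J}$ (a domain). A dyadic rational is a number $p/2^q$ with $p,q\in\mathbb Z$; an interval is dyadic if it is bounded with dyadic rational endpoints; a chart $\pi_{C,J}$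 is dyadic if $J$ is. A piecewise linear (PL) homeomorphism between intervals is a homeomorphism that is piecewise affine with finitely many breakpoints; it is dyadic if both intervals are dyadic, the breakpoints are dyadic rationals, and each affine piece has the form $x\mapsto2^mx+b$ with $m\in\mathbb Z$, $b$ a dyadic rational. $\mathsf{T}(\varphi)$ is the group of all $g\in\mathsf{H}_0(\varphi)$ such that for every $y\in Y^\varphi$ there are a dyadic chart $\pi_{C,J}$ with $y\in U_{C\times J}$ and a dyadic PL homeomorphism $f\colon J\to f(J)\subset\mathbb R$ such that $g(U_{C\times J})=U_{C\times f(J)}$ and $\pi_{C,f(J)}^{-1}\circ g\circ\pi_{C,J}$ is the map $(x,t)\mapsto(x,f(t))$. *)

theory Defs
  imports "HOL-Analysis.Analysis" "HOL-Algebra.Bij" "HOL-Algebra.Generated_Groups"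
begin

section \<open>Stone systems and subshifts\<close>

definition totally_disconnected_space :: "'a topology \<Rightarrow> bool" where
  "totally_disconnected_space X \<longleftrightarrow> (\<forall>S. connectedin X S \<longrightarrow> (\<exists>a. S \<subseteq> {a}))"

definition stone_system :: "'a topology \<Rightarrow> ('a \<Rightarrow> 'a) \<Rightarrow> bool" where
  "stone_system X \<phi> \<longleftrightarrow>
     topspace X \<noteq> {} \<and> totally_disconnected_space X \<and> compact_space X \<and> Hausdorff_space X \<and>
     homeomorphic_map X X \<phi>"

definition shift :: "(int \<Rightarrow> 'b) \<Rightarrow> (int \<Rightarrow> 'b)" where
  "shift w = (\<lambda>i. w (i + 1))"

definition full_shift :: "'b set \<Rightarrow> (int \<Rightarrow> 'b) topology" where
  "full_shift A = product_topology (\<lambda>_. discrete_topology A) UNIV"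

definition subshift :: "'b set \<Rightarrow> (int \<Rightarrow> 'b) set \<Rightarrow> bool" where
  "subshift A S \<longleftrightarrow> S \<noteq> {} \<and> closedin (full_shift A) S \<and> shift ` S = S"

definition topologically_conjugate ::
  "'a topology \<Rightarrow> ('a \<Rightarrow> 'a) \<Rightarrow> 'c topology \<Rightarrow> ('c \<Rightarrow> 'c) \<Rightarrow> bool" where
  "topologically_conjugate X \<phi> Z \<psi> \<longleftrightarrow>
     (\<exists>h. homeomorphic_map X Z h \<and> (\<forall>x\<in>topspace X. h (\<phi> x) = \<psi> (h x)))"

section \<open>The suspension\<close>

definition int_iterate :: "'a topology \<Rightarrow> ('a \<Rightarrow> 'a) \<Rightarrow> int \<Rightarrow> 'a \<Rightarrow> 'a" where
  "int_iterate X \<phi> n =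
     (if n \<ge> 0 then \<phi> ^^ nat n else inv_into (topspace X) \<phi> ^^ nat (- n))"

text \<open>The class \<open>[x, t]\<close> is the orbit of \<open>(x, t)\<close> under \<open>n \<cdot> (x, t) = (\<phi>\<^sup>n x, t - n)\<close>.\<close>

definition susp_class :: "'a topology \<Rightarrow> ('a \<Rightarrow> 'a) \<Rightarrow> 'a \<times> real \<Rightarrow> ('a \<times> real) set" where
  "susp_class X \<phi> = (\<lambda>(x, t). range (\<lambda>n::int. (int_iterate X \<phi> n x, t - real_of_int n)))"

definition suspension :: "'a topology \<Rightarrow> ('a \<Rightarrow> 'a) \<Rightarrow> ('a \<times> real) set topology" where
  "suspension X \<phi> = topology (\<lambda>U.
     U \<subseteq> susp_class X \<phi> ` (topspace X \<times> UNIV) \<and>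
     openin (prod_topology X euclideanreal) {p \<in> topspace X \<times> UNIV. susp_class X \<phi> p \<in> U})"

lemma openin_suspension:
  "openin (suspension X \<phi>) U \<longleftrightarrow>
     U \<subseteq> susp_class X \<phi> ` (topspace X \<times> UNIV) \<and>
     openin (prod_topology X euclideanreal) {p \<in> topspace X \<times> UNIV. susp_class X \<phi> p \<in> U}"
proof -
  let ?q = "susp_class X \<phi>" and ?P = "topspace X \<times> (UNIV :: real set)"
  let ?O = "\<lambda>U. U \<subseteq> ?q ` ?P \<and> openin (prod_topology X euclideanreal) {p \<in> ?P. ?q p \<in> U}"
  have "istopology ?O"
    unfolding istopology_def
  proof (intro conjI allI impI)
    fix S T assume S: "?O S" and T: "?O T"
    then show "S \<inter> T \<subseteq> ?q ` ?P" by blast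
    have "{p \<in> ?P. ?q p \<in> S \<inter> T} = {p \<in> ?P. ?q p \<in> S} \<inter> {p \<in> ?P. ?q p \<in> T}" by blast
    with S T show "openin (prod_topology X euclideanreal) {p \<in> ?P. ?q p \<in> S \<inter> T}"
      by (simp only: openin_Int)
  next
    fix K assume K: "\<forall>U\<in>K. ?O U"
    then show "\<Union>K \<subseteq> ?q ` ?P" by blast
    have "{p \<in> ?P. ?q p \<in> \<Union>K} = \<Union>((\<lambda>U. {p \<in> ?P. ?q p \<in> U}) ` K)" by blast
    moreover have "openin (prod_topology X euclideanreal) \<dots>"
      using K by (intro openin_Union) blast
    ultimately show "openin (prod_topology X euclideanreal) {p \<in> ?P. ?q p \<in> \<Union>K}"
      by (simp only:)
  qed
  then show ?thesis
    by (simp only: suspension_def topology_inverse')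
qed

lemma topspace_suspension:
  "topspace (suspension X \<phi>) = susp_class X \<phi> ` (topspace X \<times> UNIV)"
proof -
  let ?Y = "susp_class X \<phi> ` (topspace X \<times> UNIV)"
  have "{p \<in> topspace X \<times> UNIV. susp_class X \<phi> p \<in> ?Y} =
          topspace (prod_topology X euclideanreal)"
    by auto
  then have "openin (suspension X \<phi>) ?Y"
    unfolding openin_suspension by (simp only: openin_topspace subset_refl simp_thms)
  then have "?Y \<subseteq> topspace (suspension X \<phi>)"
    by (rule openin_subset)
  moreover have "topspace (suspension X \<phi>) \<subseteq> ?Y"
    using openin_topspace[of "suspension X \<phi>"] unfolding openin_suspension by (rule conjunct1)
  ultimately show ?thesis by (rule subset_antisym[rotated])
qed

lemma quotient_map_susp_class:
  "quotient_map (prod_topology X euclideanreal) (suspension X \<phi>) (susp_class X \<phi>)"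
  unfolding quotient_map_def openin_suspension topspace_suspension by simp

definition isotopic_to_identity :: "'c topology \<Rightarrow> ('c \<Rightarrow> 'c) \<Rightarrow> bool" where
  "isotopic_to_identity Y g \<longleftrightarrow> homotopic_with (homeomorphic_map Y Y) Y Y id g"

text \<open>Elements are taken extensional outside the suspension, so that equality of functions
  is equality of homeomorphisms.\<close>

definition H0 :: "'a topology \<Rightarrow> ('a \<Rightarrow> 'a) \<Rightarrow> (('a \<times> real) set \<Rightarrow> ('a \<times> real) set) set" where
  "H0 X \<phi> = {g \<in> extensional (topspace (suspension X \<phi>)).
     homeomorphic_map (suspension X \<phi>) (suspension X \<phi>) g \<and>
     isotopic_to_identity (suspension X \<phi>) g}"

section \<open>Charts\<close>

text \<open>The infimum of the empty set in \<^typ>\<open>enat\<close> is \<open>\<infinity>\<close>.\<close>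

definition return_time :: "'a topology \<Rightarrow> ('a \<Rightarrow> 'a) \<Rightarrow> 'a set \<Rightarrow> enat" where
  "return_time X \<phi> C = Inf (enat ` {n. n \<ge> 1 \<and> (\<exists>x\<in>C. (\<phi> ^^ n) x \<in> C)})"

text \<open>\<open>chart X \<phi> C J\<close>: the restriction of \<open>susp_class X \<phi>\<close> to \<open>C \<times> J\<close> is a chart.\<close>

definition chart :: "'a topology \<Rightarrow> ('a \<Rightarrow> 'a) \<Rightarrow> 'a set \<Rightarrow> real set \<Rightarrow> bool" where
  "chart X \<phi> C J \<longleftrightarrow> closedin X C \<and> openin X C \<and>
     (\<exists>a b. a < b \<and> J = {a<..<b} \<and> ereal (b - a) < ereal_of_enat (return_time X \<phi> C))"

definition chart_domain :: "'a topology \<Rightarrow> ('a \<Rightarrow> 'a) \<Rightarrow> 'a set \<Rightarrow> real set \<Rightarrow> ('a \<times> real) set set" where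
  "chart_domain X \<phi> C J = susp_class X \<phi> ` (C \<times> J)"

section \<open>Dyadic piecewise linear homeomorphisms\<close>

text \<open>The library set \<open>dyadics\<close> contains only the nonnegative dyadic rationals.\<close>

definition dyadic_rationals :: "real set" where
  "dyadic_rationals = {real_of_int p / 2 powi q | p q :: int. True}"

definition dyadic_interval :: "real set \<Rightarrow> bool" where
  "dyadic_interval J \<longleftrightarrow> is_interval J \<and> J \<noteq> {} \<and> bounded J \<and>
     Inf J \<in> dyadic_rationals \<and> Sup J \<in> dyadic_rationals"

text \<open>The affine pieces are the connected components of \<open>J\<close> minus the breakpoints \<open>B\<close>.\<close>

definition dyadic_PL_homeo :: "real set \<Rightarrow> real set \<Rightarrow> (real \<Rightarrow> real) \<Rightarrow> bool" where
  "dyadic_PL_homeo J K f \<longleftrightarrow>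
     dyadic_interval J \<and> dyadic_interval K \<and>
     homeomorphic_map (top_of_set J) (top_of_set K) f \<and>
     (\<exists>B. finite B \<and> B \<subseteq> dyadic_rationals \<and>
        (\<forall>I\<in>components (J - B). \<exists>m::int. \<exists>b\<in>dyadic_rationals. \<forall>t\<in>I. f t = 2 powi m * t + b))"

section \<open>The group \<open>T(\<phi>)\<close>\<close>

definition T_set :: "'a topology \<Rightarrow> ('a \<Rightarrow> 'a) \<Rightarrow> (('a \<times> real) set \<Rightarrow> ('a \<times> real) set) set" where
  "T_set X \<phi> = {g \<in> H0 X \<phi>. \<forall>y\<in>topspace (suspension X \<phi>). \<exists>C J f.
     chart X \<phi> C J \<and> dyadic_interval J \<and> y \<in> chart_domain X \<phi> C J \<and>
     dyadic_PL_homeo J (f ` J) f \<and> chart X \<phi> C (f ` J) \<and>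
     g ` chart_domain X \<phi> C J = chart_domain X \<phi> C (f ` J) \<and>
     (\<forall>x\<in>C. \<forall>t\<in>J.
        inv_into (C \<times> f ` J) (susp_class X \<phi>) (g (susp_class X \<phi> (x, t))) = (x, f t))}"

definition T_group ::
  "'a topology \<Rightarrow> ('a \<Rightarrow> 'a) \<Rightarrow> (('a \<times> real) set \<Rightarrow> ('a \<times> real) set) monoid" where
  "T_group X \<phi> = (BijGroup (topspace (suspension X \<phi>))) \<lparr>carrier := T_set X \<phi>\<rparr>"

definition finitely_generated_group :: "('g, 'm) monoid_scheme \<Rightarrow> bool" where
  "finitely_generated_group G \<longleftrightarrow>
     group G \<and> (\<exists>S. finite S \<and> S \<subseteq> carrier G \<and> generate G S = carrier G)"

end

theory Submission
  imports Defs
begin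

text \<open>
Lift the problem to \<open>X \<times> \<real>\<close>: an element of \<open>T(\<phi>)\<close> is a homeomorphism \<open>[x, t] \<mapsto> [x, F x t]\<close>, where
each \<open>F x\<close> is a dyadic piecewise linear homeomorphism of the line, \<open>F\<close> is locally constant in \<open>x\<close>
and \<open>F (\<phi> x) t = F x (t + 1) - 1\<close>. The lift is found by following the isotopy: on short time
intervals a point stays in a flow box, hence on its flow line, because \<open>X\<close> is totally disconnected.

For clopen \<open>C\<close> and \<open>f\<close> in Thompson's group \<open>F\<close> let \<open>f\<^sub>C\<close> act by \<open>f\<close> on \<open>C \<times> [0, 1]\<close> and trivially elsewhere.
The generators are the rotation \<open>t \<mapsto> t + 1/4\<close> and the \<open>f\<^sub>C\<close> with \<open>f\<close> one of two generators of \<open>F\<close> and \<open>C\<close>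
either \<open>X\<close> or the set of points with a given letter at the origin. Powers of the rotation shift
cylinders, and \<open>[f\<^sub>C, h\<^sub>D] = [f, h]\<^bsub>C \<inter> D\<^esub>\<close>, so that the clopen sets over which all of \<open>F\<close> is generated
form a shift-invariant Boolean algebra, provided that the commutators suffice. They do: by the
pentagon relation a caret rotation in the interior of \<open>[0, 1]\<close> is a conjugate of a commutator, and
quarter rotations carry it to the boundary. Since the letters generate the algebra of clopen
sets, every \<open>F\<close> that fixes \<open>X \<times> {0}\<close> is reached; in general the curve \<open>x \<mapsto> F x 0\<close> is pushed to zero
by moving its highest part down in small steps.
\<close>

section \<open>Dyadic piecewise linear homeomorphisms of the line\<close>

text \<open>The obstacle at an intersection \<open>C \<inter> D\<close> is that commutators lie in
  the commutator subgroup of Thompson's group, which is proper: the abelianization is free of rank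
  two and records the slopes at 0 and 1. No argument confined to the unit interval can remove this
  defect. The rotation can, because the ends of the unit interval are not intrinsic to the
  suspension. A quarter is the right amount: it carries \<open>[1/4, 3/4]\<close>, where all slopes
  at the ends of the unit interval are trivial, onto either half of that interval, and the pentagon
  relation recovers the caret rotation of the whole from those of its halves. The second obstacle is
  equivariance: a push over a clopen set also acts at all times when an orbit visits that set, so it
  must be placed where none of these other visits disturbs the curve. Lifts are locally constant
  only on bounded windows of time, since over the whole line nearby points may eventually behave
  differently. All finiteness therefore comes from compactness, of windows and of
  \<open>X\<close>.\<close>

abbreviation dyad :: "real set" where "dyad \<equiv> dyadic_rationals"

lemma dyad_alt: "x \<in> dyad \<longleftrightarrow> (\<exists>p::int. \<exists>n::nat. x = of_int p / 2 ^ n)"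
proof
  assume "x \<in> dyad"
  then obtain p q :: int where x: "x = of_int p / 2 powi q"
    by (auto simp: dyadic_rationals_def)
  show "\<exists>p::int. \<exists>n::nat. x = of_int p / 2 ^ n"
  proof (cases "q \<ge> 0")
    case True
    then show ?thesis using x by (auto simp: power_int_def)
  next
    case False
    then have "x = of_int (p * 2 ^ nat (-q)) / 2 ^ 0"
      using x by (simp add: power_int_def field_simps)
    then show ?thesis by blast
  qed
next
  assume "\<exists>p::int. \<exists>n::nat. x = of_int p / 2 ^ n"
  then obtain p :: int and n :: nat where "x = of_int p / 2 powi (int n)"
    by auto
  then show "x \<in> dyad" unfolding dyadic_rationals_def by blast
qed

lemma dyad_of_int [simp, intro]: "of_int k \<in> dyad"
  unfolding dyad_alt by (rule exI[of _ k], rule exI[of _ 0]) simp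

lemma dyad_numeral [simp, intro]: "numeral k \<in> dyad" "0 \<in> dyad" "1 \<in> dyad"
  using dyad_of_int[of "numeral k"] dyad_of_int[of 0] dyad_of_int[of 1] by simp_all

lemma dyad_minus [intro]: "x \<in> dyad \<Longrightarrow> - x \<in> dyad"
  unfolding dyad_alt by (metis minus_divide_left of_int_minus)

lemma dyad_add [intro]:
  assumes "x \<in> dyad" "y \<in> dyad" shows "x + y \<in> dyad"
proof -
  obtain p q :: int and m n :: nat where "x = of_int p / 2 ^ m" "y = of_int q / 2 ^ n"
    using assms unfolding dyad_alt by blast
  then have "x + y = of_int (p * 2 ^ n + q * 2 ^ m) / 2 ^ (m + n)"
    by (simp add: add_frac_eq power_add)
  then show ?thesis unfolding dyad_alt by blast
qed

lemma dyad_diff [intro]: "x \<in> dyad \<Longrightarrow> y \<in> dyad \<Longrightarrow> x - y \<in> dyad"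
  using dyad_add[of x "-y"] dyad_minus by auto

lemma dyad_mult [intro]:
  assumes "x \<in> dyad" "y \<in> dyad" shows "x * y \<in> dyad"
proof -
  obtain p q :: int and m n :: nat where "x = of_int p / 2 ^ m" "y = of_int q / 2 ^ n"
    using assms unfolding dyad_alt by blast
  then have "x * y = of_int (p * q) / 2 ^ (m + n)"
    by (simp add: power_add)
  then show ?thesis unfolding dyad_alt by blast
qed

lemma dyad_powi [simp, intro]: "2 powi k \<in> dyad"
proof -
  have "(2::real) powi k = of_int 1 / 2 powi (- k)"
    by (simp add: power_int_minus inverse_eq_divide)
  then show ?thesis unfolding dyadic_rationals_def by blast
qed

lemma dyad_power [simp, intro]: "2 ^ k \<in> dyad" "1 / 2 ^ k \<in> dyad" "(1/2) ^ k \<in> dyad"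
  using dyad_powi[of "int k"] dyad_powi[of "- int k"]
  by (simp_all add: power_int_minus field_simps)

lemma dyad_half: "x \<in> dyad \<Longrightarrow> x / 2 \<in> dyad" "x \<in> dyad \<Longrightarrow> x / 4 \<in> dyad"
  using dyad_mult[OF _ dyad_power(2)[of 1]] dyad_mult[OF _ dyad_power(2)[of 2]] by auto

lemma dyad_fractions [simp, intro]: "1/2 \<in> dyad" "1/4 \<in> dyad" "3/4 \<in> dyad"
  using dyad_half[of 1] dyad_half[of 3] by auto

lemma dyad_add_iff: "b \<in> dyad \<Longrightarrow> t + b \<in> dyad \<longleftrightarrow> t \<in> dyad"
  using dyad_diff[of "t + b" b] by auto

lemma dyad_powi_mult_iff: "2 powi m * t \<in> dyad \<longleftrightarrow> t \<in> dyad"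
proof
  assume "2 powi m * t \<in> dyad"
  then have "2 powi (-m) * (2 powi m * t) \<in> dyad" by blast
  also have "2 powi (-m) * (2 powi m * t) = t" by (simp add: power_int_minus)
  finally show "t \<in> dyad" .
qed blast

lemma dyad_affine_iff: "b \<in> dyad \<Longrightarrow> 2 powi m * t + b \<in> dyad \<longleftrightarrow> t \<in> dyad"
  by (simp add: dyad_add_iff dyad_powi_mult_iff)

lemma dyad_dense:
  assumes "a < (b::real)" obtains d where "d \<in> dyad" "a < d" "d < b"
proof -
  obtain n where n: "1 / 2 ^ n < b - a"
    using real_arch_pow_inv[of "b - a" "1/2"] assms by (auto simp: power_divide)
  define p where "p = \<lfloor>a * 2 ^ n\<rfloor> + 1"
  have "a * 2 ^ n < of_int p" "of_int p \<le> a * 2 ^ n + 1" unfolding p_def by linarith+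
  then have "a < of_int p / 2 ^ n" "of_int p / 2 ^ n \<le> a + 1 / 2 ^ n" by (simp_all add: field_simps)
  with n show thesis by (intro that[of "of_int p / 2 ^ n"]) (auto simp: dyad_alt)
qed

section \<open>Germs of dyadic piecewise linear maps\<close>

abbreviation rinv :: "(real \<Rightarrow> real) \<Rightarrow> real \<Rightarrow> real" where
  "rinv f \<equiv> inv_into UNIV f"

text \<open>One-sided germs are kept apart because the two slopes at a breakpoint may
  differ.\<close>

definition rgerm :: "(real \<Rightarrow> real) \<Rightarrow> real \<Rightarrow> int \<Rightarrow> bool" where
  "rgerm f t m \<longleftrightarrow> (\<exists>e>0. \<forall>s. t \<le> s \<and> s < t + e \<longrightarrow> f s = f t + 2 powi m * (s - t))"

definition lgerm :: "(real \<Rightarrow> real) \<Rightarrow> real \<Rightarrow> int \<Rightarrow> bool" where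
  "lgerm f t m \<longleftrightarrow> (\<exists>e>0. \<forall>s. t - e < s \<and> s \<le> t \<longrightarrow> f s = f t + 2 powi m * (s - t))"

text \<open>The case distinction encodes that breakpoints are dyadic and that affine pieces have
  dyadic intercepts. At a dyadic \<open>t\<close> the intercept \<open>f t - 2 powi m * t\<close> is
  dyadic exactly when \<open>f t\<close> is, and the two slopes are free; at any other
  \<open>t\<close> both germs belong to one affine piece.\<close>

definition dgerm :: "(real \<Rightarrow> real) \<Rightarrow> real \<Rightarrow> bool" where
  "dgerm f t \<longleftrightarrow> (\<exists>m m'. rgerm f t m \<and> lgerm f t m' \<and>
     (if t \<in> dyad then f t \<in> dyad else m = m' \<and> f t - 2 powi m * t \<in> dyad))"

text \<open>A local condition, so breakpoints on the line need only be locally finite; a uniform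
  statement on \<open>[0, 1]\<close> is recovered by compactness in
  \<open>dpl_uniform\<close>.\<close>

definition dpl :: "(real \<Rightarrow> real) \<Rightarrow> bool" where
  "dpl f \<longleftrightarrow> strict_mono f \<and> surj f \<and> (\<forall>t. dgerm f t)"

lemma rgerm_cong:
  assumes "rgerm f t m" "e > 0" "\<And>s. t \<le> s \<Longrightarrow> s < t + e \<Longrightarrow> g (s + c) = f s + d" "u = t + c"
  shows "rgerm g u m"
proof -
  obtain e' where e': "e' > 0" "\<And>s. t \<le> s \<Longrightarrow> s < t + e' \<Longrightarrow> f s = f t + 2 powi m * (s - t)"
    using assms(1) unfolding rgerm_def by blast
  have "g s = g u + 2 powi m * (s - u)" if s: "u \<le> s" "s < u + min e e'" for s
  proof -
    define r where "r = s - c"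
    have r: "t \<le> r" "r < t + e" "r < t + e'" "s = r + c"
      using s assms(4) by (auto simp: r_def)
    have "g s = f r + d" using assms(3)[OF r(1,2)] r(4) by simp
    also have "f r = f t + 2 powi m * (r - t)" by (rule e'(2)[OF r(1,3)])
    also have "f t = g u - d" using assms(3)[of t] assms(2,4) by simp
    also have "r - t = s - u" using r(4) assms(4) by simp
    finally show ?thesis by simp
  qed
  moreover have "0 < min e e'" using assms(2) e'(1) by simp
  ultimately show ?thesis unfolding rgerm_def by blast
qed

text \<open>Conjugation by \<open>t \<mapsto> - t\<close> exchanges the two sides, so the facts
  about left germs follow from those about right germs.\<close>

lemma lgerm_rgerm: "lgerm f t m \<longleftrightarrow> rgerm (\<lambda>s. - f (- s)) (- t) m"
proof -
  have "(\<forall>s. t - e < s \<and> s \<le> t \<longrightarrow> f s = f t + 2 powi m * (s - t)) \<longleftrightarrow>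
     (\<forall>s. - t \<le> s \<and> s < - t + e \<longrightarrow> - f (- s) = - f (- (- t)) + 2 powi m * (s - - t))" for e
  proof safe
    fix s assume H: "\<forall>s. t - e < s \<and> s \<le> t \<longrightarrow> f s = f t + 2 powi m * (s - t)" "- t \<le> s" "s < - t + e"
    show "- f (- s) = - f (- (- t)) + 2 powi m * (s - - t)"
      using H(1)[rule_format, of "- s"] H(2,3) by (simp add: algebra_simps)
  next
    fix s assume H: "\<forall>s. - t \<le> s \<and> s < - t + e \<longrightarrow> - f (- s) = - f (- (- t)) + 2 powi m * (s - - t)"
      "t - e < s" "s \<le> t"
    show "f s = f t + 2 powi m * (s - t)"
      using H(1)[rule_format, of "- s"] H(2,3) by (simp add: algebra_simps)
  qed
  then show ?thesis unfolding lgerm_def rgerm_def by simp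
qed

lemma lgerm_cong:
  assumes "lgerm f t m" "e > 0" "\<And>s. t - e < s \<Longrightarrow> s \<le> t \<Longrightarrow> g (s + c) = f s + d" "u = t + c"
  shows "lgerm g u m"
  unfolding lgerm_rgerm
proof (rule rgerm_cong[where c = "- c" and d = "- d"])
  show "rgerm (\<lambda>s. - f (- s)) (- t) m" by (rule assms(1)[unfolded lgerm_rgerm])
  fix s assume "- t \<le> s" "s < - t + e"
  then show "- g (- (s + - c)) = - f (- s) + - d" using assms(3)[of "- s"] by simp
qed (use assms in auto)

lemma rgerm_comp:
  assumes "rgerm f t m" "rgerm g (f t) n"
  shows "rgerm (g \<circ> f) t (m + n)"
proof -
  obtain e where e: "e > 0" "\<And>s. t \<le> s \<Longrightarrow> s < t + e \<Longrightarrow> f s = f t + 2 powi m * (s - t)"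
    using assms(1) unfolding rgerm_def by blast
  obtain e' where e': "e' > 0" "\<And>s. f t \<le> s \<Longrightarrow> s < f t + e' \<Longrightarrow> g s = g (f t) + 2 powi n * (s - f t)"
    using assms(2) unfolding rgerm_def by blast
  let ?e = "min e (e' / 2 powi m)"
  have "g (f s) = g (f t) + 2 powi (m + n) * (s - t)" if s: "t \<le> s" "s < t + ?e" for s
  proof -
    have fs: "f s = f t + 2 powi m * (s - t)" by (rule e(2)) (use s in auto)
    have "s - t < e' / 2 powi m" using s by linarith
    then have "2 powi m * (s - t) < e'" by (simp add: field_simps)
    moreover have "0 \<le> 2 powi m * (s - t)" using s by simp
    ultimately have "g (f s) = g (f t) + 2 powi n * (f s - f t)" by (intro e'(2)) (simp_all only: fs)
    also have "f s - f t = 2 powi m * (s - t)" using fs by linarith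
    also have "2 powi n * (2 powi m * (s - t)) = 2 powi (m + n) * (s - t)" by (simp add: power_int_add)
    finally show ?thesis .
  qed
  moreover have "0 < ?e" using e(1) e'(1) by simp
  ultimately show ?thesis unfolding rgerm_def o_def by blast
qed

lemma lgerm_comp:
  assumes "lgerm f t m" "lgerm g (f t) n"
  shows "lgerm (g \<circ> f) t (m + n)"
  using rgerm_comp[OF assms(1)[unfolded lgerm_rgerm], of "\<lambda>s. - g (- s)" n]
    assms(2)[unfolded lgerm_rgerm]
  unfolding lgerm_rgerm o_def by (simp only: minus_minus)

lemma rgerm_inv:
  assumes "rgerm f t m" "bij f"
  shows "rgerm (rinv f) (f t) (- m)"
proof -
  obtain e where e: "e > 0" "\<And>s. t \<le> s \<Longrightarrow> s < t + e \<Longrightarrow> f s = f t + 2 powi m * (s - t)"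
    using assms(1) unfolding rgerm_def by blast
  have "rinv f s = rinv f (f t) + 2 powi (- m) * (s - f t)" if s: "f t \<le> s" "s < f t + 2 powi m * e" for s
  proof -
    let ?r = "t + 2 powi (- m) * (s - f t)"
    have "?r < t + e" using s by (simp add: power_int_minus field_simps)
    moreover have "t \<le> ?r" using s by simp
    ultimately have "f ?r = f t + 2 powi m * (?r - t)" by (intro e(2))
    also have "\<dots> = s" by (simp add: power_int_minus mult.assoc[symmetric])
    finally show ?thesis using assms(2) by (metis bij_inv_eq_iff)
  qed
  moreover have "0 < 2 powi m * e" using e(1) by simp
  ultimately show ?thesis unfolding rgerm_def by blast
qed

lemma lgerm_inv:
  assumes "lgerm f t m" "bij f"
  shows "lgerm (rinv f) (f t) (- m)"
proof -
  let ?g = "\<lambda>s. - f (- s)"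
  have b: "bij ?g"
    using bij_comp[OF bij_comp[OF bij_uminus assms(2)] bij_uminus] by (simp add: o_def)
  have "rinv ?g = (\<lambda>s. - rinv f (- s))"
  proof
    fix s show "rinv ?g s = - rinv f (- s)"
  proof -
    have "?g (- rinv f (- s)) = s" using assms(2) by (simp add: bij_is_surj surj_f_inv_f)
    then show ?thesis by (rule inv_f_eq[OF bij_is_inj[OF b]])
  qed
  qed
  moreover have "rgerm (rinv ?g) (?g (- t)) (- m)"
    by (rule rgerm_inv[OF assms(1)[unfolded lgerm_rgerm] b])
  ultimately show ?thesis unfolding lgerm_rgerm by (simp only: minus_minus)
qed

lemma dpl_bij: "dpl f \<Longrightarrow> bij f"
  unfolding dpl_def bij_def by (simp add: strict_mono_imp_inj_on)

text \<open>At a point that is not dyadic, the value is \<open>2 powi m * t + b\<close> with a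
  dyadic \<open>b\<close>, and such affine maps preserve and reflect dyadic rationals.\<close>

lemma dpl_dyad_iff:
  assumes "dpl f" shows "f t \<in> dyad \<longleftrightarrow> t \<in> dyad"
proof -
  obtain m m' where "if t \<in> dyad then f t \<in> dyad else m = m' \<and> f t - 2 powi m * t \<in> dyad"
    using assms unfolding dpl_def dgerm_def by meson
  then show ?thesis
    using dyad_affine_iff[of "f t - 2 powi m * t" m t] by (auto split: if_splits)
qed

lemma strict_mono_inv':
  fixes f :: "real \<Rightarrow> real"
  assumes "strict_mono f" "surj f" shows "strict_mono (rinv f)"
  using assms strict_mono_less[OF assms(1)] by (intro strict_monoI) (metis surj_f_inv_f)

lemma dpl_id: "dpl id" "dpl (\<lambda>t. t)"
proof -
  have "dgerm id t" for t
    unfolding dgerm_def rgerm_def lgerm_def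
    by (rule exI[of _ 0], rule exI[of _ 0]) (auto intro!: exI[of _ 1])
  then show "dpl id" unfolding dpl_def by (auto simp: strict_mono_def)
  then show "dpl (\<lambda>t. t)" by (simp add: id_def)
qed

lemma dpl_comp:
  assumes "dpl f" "dpl g" shows "dpl (g \<circ> f)"
proof -
  have "dgerm (g \<circ> f) t" for t
  proof -
    obtain m m' where f: "rgerm f t m" "lgerm f t m'"
       "if t \<in> dyad then f t \<in> dyad else m = m' \<and> f t - 2 powi m * t \<in> dyad"
      using assms(1) unfolding dpl_def dgerm_def by meson
    obtain n n' where g: "rgerm g (f t) n" "lgerm g (f t) n'"
       "if f t \<in> dyad then g (f t) \<in> dyad else n = n' \<and> g (f t) - 2 powi n * f t \<in> dyad"
      using assms(2) unfolding dpl_def dgerm_def by meson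
    \<comment> \<open>Writes the intercept of the composite in terms of the intercepts of the two
      factors.\<close>
    have e: "(g \<circ> f) t - 2 powi (m + n) * t =
        (g (f t) - 2 powi n * f t) + 2 powi n * (f t - 2 powi m * t)"
      by (simp add: power_int_add algebra_simps)
    have "if t \<in> dyad then (g \<circ> f) t \<in> dyad
        else m + n = m' + n' \<and> (g \<circ> f) t - 2 powi (m + n) * t \<in> dyad"
    proof (cases "t \<in> dyad")
      case True
      then show ?thesis using f(3) g(3) by simp
    next
      case False
      then have "f t \<notin> dyad" using dpl_dyad_iff[OF assms(1)] by simp
      then have "m = m'" "n = n'" "f t - 2 powi m * t \<in> dyad" "g (f t) - 2 powi n * f t \<in> dyad"
        using False f(3) g(3) by argo+
      then show ?thesis unfolding e using False by (simp add: dyad_add dyad_mult)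
    qed
    then show ?thesis
      unfolding dgerm_def using rgerm_comp[OF f(1) g(1)] lgerm_comp[OF f(2) g(2)] by blast
  qed
  moreover have "strict_mono (g \<circ> f)"
    using assms unfolding dpl_def by (auto simp: strict_mono_def)
  moreover have "surj (g \<circ> f)"
    using assms unfolding dpl_def by (intro comp_surj) auto
  ultimately show ?thesis unfolding dpl_def by blast
qed

lemma dpl_inv:
  assumes "dpl f" shows "dpl (rinv f)"
proof -
  have b: "bij f" by (rule dpl_bij[OF assms])
  have "dgerm (rinv f) u" for u
  proof -
    define t where "t = rinv f u"
    have u: "u = f t" unfolding t_def using b by (metis bij_inv_eq_iff)
    obtain m m' where f: "rgerm f t m" "lgerm f t m'"
       "if t \<in> dyad then f t \<in> dyad else m = m' \<and> f t - 2 powi m * t \<in> dyad"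
      using assms unfolding dpl_def dgerm_def by meson
    have "t - 2 powi (- m) * u = - (2 powi (- m) * (f t - 2 powi m * t))"
      unfolding u by (simp add: power_int_minus algebra_simps)
    then have "if u \<in> dyad then rinv f u \<in> dyad
        else - m = - m' \<and> rinv f u - 2 powi (- m) * u \<in> dyad"
      using f(3) dpl_dyad_iff[OF assms, of t] unfolding u[symmetric] t_def[symmetric]
      by (auto split: if_splits)
    then show ?thesis
      unfolding dgerm_def using rgerm_inv[OF f(1) b] lgerm_inv[OF f(2) b] unfolding u[symmetric] by blast
  qed
  then show ?thesis
    using assms strict_mono_inv' b unfolding dpl_def by (auto simp: bij_imp_bij_inv bij_is_surj)
qed

lemma dpl_affine:
  assumes "b \<in> dyad" shows "dpl (\<lambda>t. 2 powi m * t + b)"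
proof -
  have "dgerm (\<lambda>t. 2 powi m * t + b) t" for t
    unfolding dgerm_def rgerm_def lgerm_def
    by (rule exI[of _ m], rule exI[of _ m])
      (use assms in \<open>auto simp: algebra_simps dyad_affine_iff intro!: exI[of _ 1]\<close>)
  moreover have "surj (\<lambda>t. 2 powi m * t + b)"
    by (rule surjI[of _ "\<lambda>s. (s - b) / 2 powi m"]) simp
  ultimately show ?thesis unfolding dpl_def by (auto simp: strict_mono_def)
qed

lemma dpl_translate: "b \<in> dyad \<Longrightarrow> dpl (\<lambda>t. t + b)"
  using dpl_affine[of b 0] by simp

section \<open>Gluing at dyadic points\<close>

definition glue :: "real \<Rightarrow> (real \<Rightarrow> real) \<Rightarrow> (real \<Rightarrow> real) \<Rightarrow> real \<Rightarrow> real" where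
  "glue c f g = (\<lambda>t. if t \<le> c then f t else g t)"

text \<open>Integer translations in source and target change the intercept by a dyadic rational
  only. In this form germs are transported between unit intervals and between chart
  representatives.\<close>

lemma dgerm_cong:
  assumes "dgerm f t" "e > 0" "\<And>s. \<bar>s - t\<bar> < e \<Longrightarrow> g (s + of_int c) = f s + of_int d" "u = t + of_int c"
  shows "dgerm g u"
proof -
  obtain m m' where f: "rgerm f t m" "lgerm f t m'"
    "if t \<in> dyad then f t \<in> dyad else m = m' \<and> f t - 2 powi m * t \<in> dyad"
    using assms(1) unfolding dgerm_def by meson
  have g: "g u = f t + of_int d" using assms(2,3,4) by simp
  have "rgerm g u m"
    by (rule rgerm_cong[OF f(1) assms(2) _ assms(4)]) (rule assms(3), simp)
  moreover have "lgerm g u m'"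
    by (rule lgerm_cong[OF f(2) assms(2) _ assms(4)]) (rule assms(3), simp)
  moreover have "if u \<in> dyad then g u \<in> dyad else m = m' \<and> g u - 2 powi m * u \<in> dyad"
  proof -
    have e: "g u - 2 powi m * u = (f t - 2 powi m * t) + (of_int d - 2 powi m * of_int c)"
      using g assms(4) by (simp add: algebra_simps)
    have "of_int d - 2 powi m * of_int c \<in> dyad" by blast
    then have "g u - 2 powi m * u \<in> dyad \<longleftrightarrow> f t - 2 powi m * t \<in> dyad"
      unfolding e by (rule dyad_add_iff)
    moreover have "u \<in> dyad \<longleftrightarrow> t \<in> dyad" "g u \<in> dyad \<longleftrightarrow> f t \<in> dyad"
      using g assms(4) by (simp_all only: dyad_add_iff dyad_of_int)
    ultimately show ?thesis using f(3) by argo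
  qed
  ultimately show ?thesis unfolding dgerm_def by blast
qed

lemma dgerm_cong0:
  assumes "dgerm f t" "e > 0" "\<And>s. \<bar>s - t\<bar> < e \<Longrightarrow> g s = f s"
  shows "dgerm g t"
  using dgerm_cong[of f t e g 0 0 t] assms by simp

text \<open>At a dyadic point no relation between the slopes is demanded, so a left germ and a right
  germ of different maps join as soon as the values agree.\<close>

lemma dgerm_glue:
  assumes f: "dgerm f c" and g: "dgerm g c" and eq: "f c = g c" and c: "c \<in> dyad" and "e > 0"
    and "\<And>s. c - e < s \<Longrightarrow> s \<le> c \<Longrightarrow> h s = f s" "\<And>s. c \<le> s \<Longrightarrow> s < c + e \<Longrightarrow> h s = g s"
  shows "dgerm h c"
proof -
  obtain m where m: "lgerm f c m" "f c \<in> dyad" using f c unfolding dgerm_def by auto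
  obtain n where n: "rgerm g c n" using g unfolding dgerm_def by auto
  have "lgerm h c m" using assms(5-) by (intro lgerm_cong[OF m(1), where c = 0 and d = 0]) auto
  moreover have "rgerm h c n" using assms(5-) by (intro rgerm_cong[OF n(1), where c = 0 and d = 0]) auto
  moreover have "h c \<in> dyad" using assms(6)[of c] \<open>e > 0\<close> m(2) by simp
  ultimately show ?thesis unfolding dgerm_def using c by auto
qed

lemma dpl_glue:
  assumes f: "dpl f" and g: "dpl g" and eq: "f c = g c" and c: "c \<in> dyad"
  shows "dpl (glue c f g)"
proof -
  have mf: "strict_mono f" and mg: "strict_mono g" and sf: "surj f" and sg: "surj g"
    using f g unfolding dpl_def by auto
  have "strict_mono (glue c f g)"
  proof (rule strict_monoI)
    fix x y :: real assume "x < y"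
    moreover have "f x \<le> f c" if "x \<le> c" using that mf by (simp add: strict_mono_less_eq)
    moreover have "g c < g y" if "c < y" using that mg by (simp add: strict_mono_less)
    ultimately show "glue c f g x < glue c f g y"
      unfolding glue_def using strict_monoD[OF mf, of x y] strict_monoD[OF mg, of x y] eq
      by (smt (verit))
  qed
  moreover have "surj (glue c f g)"
  proof -
    have "\<exists>x. u = glue c f g x" for u
    proof (cases "u \<le> f c")
      case True
      obtain x where x: "u = f x" using sf by blast
      then have "x \<le> c" using True strict_mono_less_eq[OF mf, of x c] by simp
      then have "u = glue c f g x" by (simp add: x glue_def)
      then show ?thesis ..
    next
      case False
      obtain x where x: "u = g x" using sg by blast
      then have "\<not> x \<le> c" using False strict_mono_less_eq[OF mg, of x c] eq by simp
      then have "u = glue c f g x" by (simp add: x glue_def)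
      then show ?thesis ..
    qed
    then show ?thesis by blast
  qed
  moreover have "dgerm (glue c f g) t" for t
  proof -
    have df: "dgerm f s" and dg: "dgerm g s" for s using f g unfolding dpl_def by blast+
    consider "t < c" | "t = c" | "t > c" by linarith
    then show ?thesis
    proof cases
      case 1
      then show ?thesis by (intro dgerm_cong0[OF df, of "c - t"]) (auto simp: glue_def)
    next
      case 2
      show ?thesis unfolding 2
        by (rule dgerm_glue[OF df dg eq c zero_less_one]) (auto simp: glue_def eq)
    next
      case 3
      then show ?thesis by (intro dgerm_cong0[OF dg, of "t - c"]) (auto simp: glue_def)
    qed
  qed
  ultimately show ?thesis unfolding dpl_def by blast
qed

section \<open>Generators of Thompson's group F\<close>

text \<open>Up to inversion the first standard generator of Thompson's group, with slopes 2, 1 and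
  1/2 on intervals of length 1/4, 1/4 and 1/2.\<close>

definition xstep :: "real \<Rightarrow> real" where
  "xstep u = (if u \<le> 1/4 then 2 * u else if u \<le> 1/2 then u + 1/4 else (u + 1) / 2)"

text \<open>The element of \<open>F\<close> on \<open>[a, b]\<close> that rotates the caret \<open>((p, q), r)\<close> to \<open>(p, (q, r))\<close>.\<close>

definition xm :: "real \<Rightarrow> real \<Rightarrow> real \<Rightarrow> real" where
  "xm a b t = (if a < t \<and> t < b then a + (b - a) * xstep ((t - a) / (b - a)) else t)"

lemma xm_outside: "t \<le> a \<or> b \<le> t \<Longrightarrow> xm a b t = t"
  by (auto simp: xm_def)

text \<open>The pieces are closed and overlap at the breakpoints, which is the form that gluing and
  \<open>aff\<close> require.\<close>

lemma xm_pieces: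
  assumes "a < b"
  shows "a \<le> t \<Longrightarrow> t \<le> a + (b - a) / 4 \<Longrightarrow> xm a b t = 2 * t - a"
    and "a + (b - a) / 4 \<le> t \<Longrightarrow> t \<le> (a + b) / 2 \<Longrightarrow> xm a b t = t + (b - a) / 4"
    and "(a + b) / 2 \<le> t \<Longrightarrow> t \<le> b \<Longrightarrow> xm a b t = (t + b) / 2"
proof -
  have q: "(t - a) / (b - a) \<le> 1/4 \<longleftrightarrow> t \<le> a + (b - a) / 4" "(t - a) / (b - a) \<le> 1/2 \<longleftrightarrow> t \<le> (a + b) / 2"
    using assms by (auto simp: pos_divide_le_eq field_simps)
  have e: "(b - a) * ((t - a) / (b - a)) = t - a" using assms by simp
  have e2: "(b - a) * (((t - a) / (b - a) + 1) / 2) = (t - a + (b - a)) / 2"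
    using assms by (simp add: field_simps)
  have e3: "(b - a) * ((t - a) / (b - a) + 1 / 4) = (t - a + (b - a) / 4)"
    using assms by (simp add: distrib_left)
  have e4: "(b - a) * (2 * ((t - a) / (b - a))) = 2 * (t - a)"
    using assms by simp
  show "xm a b t = 2 * t - a" if "a \<le> t" "t \<le> a + (b - a) / 4"
    using that q(1) e4 assms unfolding xm_def xstep_def by auto
  show "xm a b t = t + (b - a) / 4" if "a + (b - a) / 4 \<le> t" "t \<le> (a + b) / 2"
  proof (cases "t = a + (b - a) / 4")
    case True
    then have "a < t" "t < b" using assms by argo+
    then have "xm a b t = a + 2 * (t - a)"
      using True q(1) e4 unfolding xm_def xstep_def by auto
    then show ?thesis using True by argo
  next
    case False
    then show ?thesis using that q e3 assms unfolding xm_def xstep_def by auto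
  qed
  show "xm a b t = (t + b) / 2" if "(a + b) / 2 \<le> t" "t \<le> b"
  proof (cases "t = (a + b) / 2")
    case True
    then have "a < t" "t < b" "\<not> t \<le> a + (b - a) / 4" using assms by argo+
    then have "xm a b t = a + (t - a + (b - a) / 4)"
      using True q e3 unfolding xm_def xstep_def by auto
    then show ?thesis using True by argo
  next
    case False
    then show ?thesis using that q e2 assms unfolding xm_def xstep_def by (auto simp: field_simps)
  qed
qed

lemma dpl_lines:
  assumes "a \<in> dyad" shows "dpl (\<lambda>t. 2 * t - a)" "dpl (\<lambda>t. (t + a) / 2)" "dpl (\<lambda>t. t + a)"
  using dpl_affine[of "- a" 1] dpl_affine[of "a / 2" "-1"] dpl_translate[of a] assms
  by (auto simp: dyad_minus dyad_half power_int_minus field_simps)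

lemma dpl_xm:
  assumes "a < b" "a \<in> dyad" "b \<in> dyad" shows "dpl (xm a b)"
proof -
  have "xm a b = glue a (\<lambda>t. t) (glue (a + (b - a) / 4) (\<lambda>t. 2 * t - a)
      (glue ((a + b) / 2) (\<lambda>t. t + (b - a) / 4) (glue b (\<lambda>t. (t + b) / 2) (\<lambda>t. t))))"
  proof
    fix t
    consider "t \<le> a" | "a < t" "t \<le> a + (b - a) / 4" | "a + (b - a) / 4 < t" "t \<le> (a + b) / 2"
      | "(a + b) / 2 < t" "t \<le> b" | "b < t" by linarith
    then show "xm a b t = glue a (\<lambda>t. t) (glue (a + (b - a) / 4) (\<lambda>t. 2 * t - a)
      (glue ((a + b) / 2) (\<lambda>t. t + (b - a) / 4) (glue b (\<lambda>t. (t + b) / 2) (\<lambda>t. t)))) t"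
    proof cases
      case 1 then show ?thesis by (simp add: glue_def xm_outside)
    next
      case 2 then show ?thesis using assms(1) by (simp add: glue_def xm_pieces(1))
    next
      case 3
      then have "a < t" using assms(1) by argo
      then show ?thesis using 3 assms(1) by (simp add: glue_def xm_pieces(2))
    next
      case 4
      then have "a < t" "a + (b - a) / 4 < t" using assms(1) by argo+
      then show ?thesis using 4 assms(1) by (simp add: glue_def xm_pieces(3))
    next
      case 5
      then have "a < t" "a + (b - a) / 4 < t" "(a + b) / 2 < t" using assms(1) by argo+
      then show ?thesis using 5 assms(1) by (simp add: glue_def xm_outside)
    qed
  qed
  moreover have "a + (b - a) / 4 \<in> dyad" "(a + b) / 2 \<in> dyad" "(b - a) / 4 \<in> dyad"
    using assms by (auto intro!: dyad_half)
  moreover have "dpl (glue b (\<lambda>t. (t + b) / 2) (\<lambda>t. t))" (is "dpl ?g3")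
    by (rule dpl_glue) (use assms dpl_id dpl_lines in auto)
  moreover have "dpl (glue ((a + b) / 2) (\<lambda>t. t + (b - a) / 4) ?g3)" (is "dpl ?g2")
  proof (rule dpl_glue)
    show "(a + b) / 2 + (b - a) / 4 = ?g3 ((a + b) / 2)"
      using assms(1) unfolding glue_def by (simp add: field_simps)
  qed (use calculation dpl_lines in auto)
  moreover have "dpl (glue (a + (b - a) / 4) (\<lambda>t. 2 * t - a) ?g2)" (is "dpl ?g1")
  proof (rule dpl_glue)
    show "2 * (a + (b - a) / 4) - a = ?g2 (a + (b - a) / 4)"
      using assms(1) unfolding glue_def by (simp add: field_simps)
  qed (use calculation dpl_lines assms in auto)
  moreover have "dpl (glue a (\<lambda>t. t) ?g1)"
  proof (rule dpl_glue)
    show "a = ?g1 a" using assms(1) unfolding glue_def by simp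
  qed (use calculation dpl_id assms in auto)
  ultimately show ?thesis by (simp only:)
qed

text \<open>\<open>xm a b\<close> is the identity off the open interval, so only the affine
  behaviour of \<open>h\<close> on \<open>[a, b]\<close> matters; monotonicity keeps all other
  points off the open interval from \<open>c\<close> to \<open>d\<close>.\<close>

lemma xm_conj:
  assumes "strict_mono h" "a < b" "k > 0" "d = c + k * (b - a)"
    and h: "\<And>t. a \<le> t \<Longrightarrow> t \<le> b \<Longrightarrow> h t = c + k * (t - a)"
  shows "h (xm a b t) = xm c d (h t)"
proof -
  have ends: "h a = c" "h b = d" using h[of a] h[of b] assms(2,4) by auto
  have cd: "c < d" using assms(2-4) by simp
  consider "t \<le> a \<or> b \<le> t" | "a < t" "t < b" by linarith
  then show ?thesis
  proof cases
    case 1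
    then have "h t \<le> c \<or> d \<le> h t" using ends assms(1) by (metis strict_mono_less_eq)
    then show ?thesis using 1 by (simp add: xm_outside)
  next
    case 2
    let ?u = "(t - a) / (b - a)"
    have u: "0 < ?u" "?u < 1" using 2 by auto
    have "0 \<le> xstep v \<and> xstep v \<le> 1" if "0 < v" "v < 1" for v using that by (auto simp: xstep_def)
    then have xs: "0 \<le> xstep ?u" "xstep ?u \<le> 1" using u by blast+
    have "xm a b t = a + (b - a) * xstep ?u" using 2 by (simp add: xm_def)
    moreover have "0 \<le> (b - a) * xstep ?u" "(b - a) * xstep ?u \<le> b - a"
      using xs assms(2) by (auto intro: mult_left_le)
    ultimately have "h (xm a b t) = c + k * ((b - a) * xstep ?u)" using h by simp
    moreover have "h t = c + k * (t - a)" using h 2 by simp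
    moreover have "(c + k * (t - a) - c) / (d - c) = ?u" using assms(2-4) by simp
    moreover have "c < c + k * (t - a)" "c + k * (t - a) < d" using 2 assms(3,4) by auto
    moreover have "d - c = k * (b - a)" using assms(4) by simp
    ultimately show ?thesis by (simp add: xm_def)
  qed
qed

subsection \<open>Trees and dyadic subdivisions\<close>

text \<open>A binary tree stands for a subdivision of an interval by successive halving, with the
  leaves as parts. Two trees with equally many leaves describe an element of Thompson's
  group.\<close>

datatype tree = Leaf | Node tree tree

primrec leaves :: "tree \<Rightarrow> real \<Rightarrow> real \<Rightarrow> (real \<times> real) list" where
  "leaves Leaf a b = [(a, b)]"
| "leaves (Node l r) a b = leaves l a ((a + b) / 2) @ leaves r ((a + b) / 2) b"

primrec nodes :: "tree \<Rightarrow> nat" where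
  "nodes Leaf = 0"
| "nodes (Node l r) = nodes l + nodes r + 1"

text \<open>The right comb, which serves as normal form: every tree is rotated into it.\<close>

primrec vine :: "nat \<Rightarrow> tree" where
  "vine 0 = Leaf"
| "vine (Suc n) = Node Leaf (vine n)"

primrec full_tree :: "nat \<Rightarrow> tree" where
  "full_tree 0 = Leaf"
| "full_tree (Suc n) = Node (full_tree n) (full_tree n)"

definition aff :: "(real \<Rightarrow> real) \<Rightarrow> real \<Rightarrow> real \<Rightarrow> real \<Rightarrow> real \<Rightarrow> bool" where
  "aff f a b c d \<longleftrightarrow> a < b \<and> c < d \<and> (\<forall>t. a \<le> t \<and> t \<le> b \<longrightarrow> f t = c + (d - c) * ((t - a) / (b - a)))"

text \<open>Two lists of leaves in this relation form a tree pair diagram of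
  \<open>f\<close>.\<close>

definition carries :: "(real \<Rightarrow> real) \<Rightarrow> (real \<times> real) list \<Rightarrow> (real \<times> real) list \<Rightarrow> bool" where
  "carries f = list_all2 (\<lambda>p q. aff f (fst p) (snd p) (fst q) (snd q))"

lemma aff_comp:
  assumes "aff f a b c d" "aff g c d e h" shows "aff (g \<circ> f) a b e h"
proof -
  have "g (f t) = e + (h - e) * ((t - a) / (b - a))" if t: "a \<le> t" "t \<le> b" for t
  proof -
    let ?u = "(t - a) / (b - a)"
    have u: "0 \<le> ?u" "?u \<le> 1" using t assms(1) by (auto simp: aff_def)
    have ft: "f t = c + (d - c) * ?u" using assms(1) t unfolding aff_def by blast
    have cd: "c < d" using assms(1) unfolding aff_def by blast
    have "(d - c) * ?u \<le> (d - c)" "0 \<le> (d - c) * ?u"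
      using mult_left_le[of ?u "d - c"] mult_nonneg_nonneg[of "d - c" ?u] u cd by linarith+
    then have "c \<le> f t" "f t \<le> d" unfolding ft by linarith+
    then have "g (f t) = e + (h - e) * ((f t - c) / (d - c))" using assms(2) unfolding aff_def by blast
    also have "(f t - c) / (d - c) = ?u" using ft cd by simp
    finally show ?thesis .
  qed
  then show ?thesis using assms unfolding aff_def by simp
qed

lemma affI:
  assumes "a < b" "c < d" "\<And>t. a \<le> t \<Longrightarrow> t \<le> b \<Longrightarrow> f t = c + k * (t - a)" "d - c = k * (b - a)"
  shows "aff f a b c d"
  unfolding aff_def using assms by auto

lemma aff_half:
  assumes "aff f a b c d"
  shows "aff f a ((a + b) / 2) c ((c + d) / 2)" "aff f ((a + b) / 2) b ((c + d) / 2) d"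
proof -
  have ab: "a < b" "c < d" using assms by (auto simp: aff_def)
  define k where "k = (d - c) / (b - a)"
  have k: "d - c = k * (b - a)" using ab by (simp add: k_def)
  have f: "f t = c + k * (t - a)" if "a \<le> t" "t \<le> b" for t
  proof -
    have "f t = c + (d - c) * ((t - a) / (b - a))" using assms that unfolding aff_def by blast
    then show ?thesis by (simp add: k_def)
  qed
  show "aff f a ((a + b) / 2) c ((c + d) / 2)"
    by (rule affI[where k = k]) (use ab f k in \<open>auto simp: field_simps\<close>)
  show "aff f ((a + b) / 2) b ((c + d) / 2) d"
  proof (rule affI[where k = k])
    fix t assume "(a + b) / 2 \<le> t" "t \<le> b"
    then have "f t = c + k * (t - a)" using f ab by simp
    also have "\<dots> = c + k * (b - a) / 2 + k * (t - (a + b) / 2)" by (simp add: field_simps)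
    finally show "f t = (c + d) / 2 + k * (t - (a + b) / 2)" using k by (simp add: field_simps)
  qed (use ab k in \<open>auto simp: field_simps\<close>)
qed

lemma carries_leaves: "aff f a b c d \<Longrightarrow> carries f (leaves T a b) (leaves T c d)"
proof (induction T arbitrary: a b c d)
  case Leaf
  then show ?case by (simp add: carries_def)
next
  case (Node l r)
  then show ?case using aff_half[OF Node.prems] by (auto simp: carries_def intro!: list_all2_appendI)
qed

lemma carries_comp: "carries f I J \<Longrightarrow> carries g J K \<Longrightarrow> carries (g \<circ> f) I K"
  unfolding carries_def by (rule list_all2_trans[of _ _ _ I J K]) (auto intro: aff_comp)

lemma carries_append: "carries f I J \<Longrightarrow> carries f I' J' \<Longrightarrow> carries f (I @ I') (J @ J')"
  unfolding carries_def by (rule list_all2_appendI)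

lemma leaves_cover:
  assumes "a < b" "a \<le> t" "t \<le> b"
  shows "\<exists>p \<in> set (leaves T a b). fst p \<le> t \<and> t \<le> snd p"
  using assms
proof (induction T arbitrary: a b)
  case (Node l r)
  show ?case
  proof (cases "t \<le> (a + b) / 2")
    case True
    then show ?thesis using Node.IH(1)[of a "(a + b) / 2"] Node.prems by auto
  next
    case False
    then show ?thesis using Node.IH(2)[of "(a + b) / 2" b] Node.prems by auto
  qed
qed simp

text \<open>The leaves cover \<open>[a, b]\<close>, and an increasing affine map is determined by
  its source and target intervals.\<close>

lemma carries_unique:
  assumes "carries f (leaves T a b) Js" "carries g (leaves T a b) Js" "a < b" "a \<le> t" "t \<le> b"
  shows "f t = g t"
proof -
  obtain i where i: "i < length (leaves T a b)" "fst (leaves T a b ! i) \<le> t" "t \<le> snd (leaves T a b ! i)"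
    using leaves_cover[OF assms(3-5), of T] by (auto simp: in_set_conv_nth)
  then show ?thesis
    using assms(1,2) unfolding carries_def list_all2_conv_all_nth aff_def by metis
qed

lemma length_leaves: "length (leaves T a b) = nodes T + 1"
  by (induction T arbitrary: a b) auto

text \<open>The three affine pieces of \<open>xm a b\<close> carry the intervals of
  \<open>p\<close>, \<open>q\<close> and \<open>r\<close> before the rotation to those after it.
  Affine maps commute with halving, so the subtrees may be arbitrary.\<close>

lemma xm_rotate:
  assumes "a < b"
  shows "carries (xm a b) (leaves (Node (Node p q) r) a b) (leaves (Node p (Node q r)) a b)"
proof -
  let ?m = "(a + b) / 2"
  have m: "(a + ?m) / 2 = a + (b - a) / 4" "(?m + b) / 2 = b - (b - a) / 4" by (simp_all add: field_simps)
  have "aff (xm a b) a (a + (b - a) / 4) a ?m"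
  proof (rule affI[where k = 2])
    fix t assume "a \<le> t" "t \<le> a + (b - a) / 4"
    then have "xm a b t = 2 * t - a" by (intro xm_pieces(1)[OF assms])
    then show "xm a b t = a + 2 * (t - a)" by (simp add: field_simps)
  qed (use assms in argo)+
  moreover have "aff (xm a b) (a + (b - a) / 4) ?m ?m (b - (b - a) / 4)"
  proof (rule affI[where k = 1])
    fix t assume "a + (b - a) / 4 \<le> t" "t \<le> ?m"
    then have "xm a b t = t + (b - a) / 4" by (intro xm_pieces(2)[OF assms])
    then show "xm a b t = ?m + 1 * (t - (a + (b - a) / 4))" by (simp add: field_simps)
  qed (use assms in argo)+
  moreover have "aff (xm a b) ?m b (b - (b - a) / 4) b"
  proof (rule affI[where k = "1/2"])
    fix t assume "?m \<le> t" "t \<le> b"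
    then have "xm a b t = (t + b) / 2" by (intro xm_pieces(3)[OF assms])
    then show "xm a b t = b - (b - a) / 4 + 1/2 * (t - ?m)" by (simp add: field_simps)
  qed (use assms in argo)+
  ultimately show ?thesis
    by (auto simp: m intro!: carries_append carries_leaves)
qed

text \<open>Words are built by multiplication on the left, so that induction removes one letter;
  closure under products and inverses is derived from this.\<close>

inductive_set xgen :: "(real \<Rightarrow> real) set" where
  one: "(\<lambda>t. t) \<in> xgen"
| step0: "f \<in> xgen \<Longrightarrow> xm 0 1 \<circ> f \<in> xgen"
| step1: "f \<in> xgen \<Longrightarrow> xm (1/2) 1 \<circ> f \<in> xgen"
| inv0: "f \<in> xgen \<Longrightarrow> rinv (xm 0 1) \<circ> f \<in> xgen"
| inv1: "f \<in> xgen \<Longrightarrow> rinv (xm (1/2) 1) \<circ> f \<in> xgen"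

lemma dpl_x01: "dpl (xm 0 1)" "dpl (xm (1/2) 1)"
  by (auto intro!: dpl_xm)

lemma dpl_xgen: "f \<in> xgen \<Longrightarrow> dpl f"
  by (induction rule: xgen.induct) (blast intro: dpl_comp dpl_id dpl_x01 dpl_inv)+

lemma xgen_comp: "f \<in> xgen \<Longrightarrow> g \<in> xgen \<Longrightarrow> f \<circ> g \<in> xgen"
proof (induction rule: xgen.induct)
  case one
  then show ?case by (simp add: o_def)
qed (auto simp: o_assoc[symmetric] intro: xgen.intros)

lemma xgen_base: "xm 0 1 \<in> xgen" "xm (1/2) 1 \<in> xgen" "rinv (xm 0 1) \<in> xgen" "rinv (xm (1/2) 1) \<in> xgen"
  using xgen.intros(2-5)[OF xgen.one] by (simp_all add: o_def)

lemma rinv_comp: "dpl f \<Longrightarrow> dpl g \<Longrightarrow> rinv (f \<circ> g) = rinv g \<circ> rinv f"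
  by (intro o_inv_distrib dpl_bij)

lemma rinv_cancel: 
  assumes "dpl f" shows "rinv f (f t) = t" "f (rinv f t) = t" "rinv f \<circ> f = (\<lambda>t. t)" "f \<circ> rinv f = (\<lambda>t. t)"
  using dpl_bij[OF assms] by (auto simp: bij_is_inj bij_is_surj surj_f_inv_f fun_eq_iff)

lemma rinv_rinv: "dpl f \<Longrightarrow> rinv (rinv f) = f"
  by (rule inv_inv_eq[OF dpl_bij])

lemma xgen_inv: "f \<in> xgen \<Longrightarrow> rinv f \<in> xgen"
proof (induction rule: xgen.induct)
  case one
  have "rinv (\<lambda>t. t) = (\<lambda>t. t)" using inv_id by (simp add: id_def)
  then show ?case by (simp add: xgen.one)
next
  case (step0 f)
  then show ?case unfolding rinv_comp[OF dpl_x01(1) dpl_xgen[OF step0(1)]]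
    by (intro xgen_comp xgen_base)
next
  case (step1 f)
  then show ?case unfolding rinv_comp[OF dpl_x01(2) dpl_xgen[OF step1(1)]]
    by (intro xgen_comp xgen_base)
next
  case (inv0 f)
  then show ?case unfolding rinv_comp[OF dpl_inv[OF dpl_x01(1)] dpl_xgen[OF inv0(1)]] rinv_rinv[OF dpl_x01(1)]
    by (intro xgen_comp xgen_base)
next
  case (inv1 f)
  then show ?case unfolding rinv_comp[OF dpl_inv[OF dpl_x01(2)] dpl_xgen[OF inv1(1)]] rinv_rinv[OF dpl_x01(2)]
    by (intro xgen_comp xgen_base)
qed

text \<open>These are the members of the standard infinite generating set. As \<open>xm 0 1\<close>
  has slope 1/2 on \<open>[1/2, 1]\<close> and fixes 1, conjugation by it halves an interval ending
  in 1 and raises the exponent by one; the exponents 0 and 1 are the generators themselves.\<close>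

lemma xgen_xm: "xm (1 - 1 / 2 ^ k) 1 \<in> xgen"
proof (cases k)
  case 0
  then show ?thesis using xgen_base by simp
next
  case (Suc n)
  have "xm (1 - 1 / 2 ^ Suc n) 1 \<in> xgen"
  proof (induction n)
    case 0
    then show ?case using xgen_base by simp
  next
    case (Suc n)
    let ?a = "1 - 1 / 2 ^ Suc n :: real" and ?c = "1 - 1 / 2 ^ Suc (Suc n) :: real"
    have a: "1/2 \<le> ?a" "?a < 1" by (auto simp: field_simps)
    have "xm 0 1 (xm ?a 1 t) = xm ?c 1 (xm 0 1 t)" for t
    proof (rule xm_conj[where k = "1/2"])
      fix t assume t: "?a \<le> t" "t \<le> 1"
      have "1/2 \<le> t" using t a by linarith
      then have "xm 0 1 t = (t + 1) / 2" using xm_pieces(3)[of 0 1 t] t by simp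
      moreover have "1 / 2 ^ Suc (Suc n) = 1/2 * (1 / 2 ^ Suc n :: real)" by simp
      ultimately show "xm 0 1 t = ?c + 1/2 * (t - ?a)" by argo
    next
      have "1 / 2 ^ Suc (Suc n) = 1/2 * (1 / 2 ^ Suc n :: real)" by simp
      moreover have "1 = 1 - y + 1/2 * (1 - (1 - z))" if "y = 1/2 * z" for y z :: real using that by simp
      ultimately show "1 = ?c + 1/2 * (1 - ?a)" by blast
      show "strict_mono (xm 0 1)" using dpl_x01(1) unfolding dpl_def by blast
    qed (use a in simp_all)
    note conj = this
    have "xm ?c 1 = xm 0 1 \<circ> (xm ?a 1 \<circ> rinv (xm 0 1))"
    proof
      fix t
      show "xm ?c 1 t = (xm 0 1 \<circ> (xm ?a 1 \<circ> rinv (xm 0 1))) t"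
        unfolding comp_apply using conj[of "rinv (xm 0 1) t"] rinv_cancel(2)[OF dpl_x01(1), of t] by (simp only:)
    qed
    then show ?case using xgen_comp[OF xgen_base(1) xgen_comp[OF Suc.IH xgen_base(3)]] by (simp only:)
  qed
  then show ?thesis using Suc by simp
qed

text \<open>Doubling the weight on the left makes rotation at the root a decrease: with
  \<open>p\<close>, \<open>q\<close>, \<open>r\<close> for the weights of the subtrees,
  \<open>4 p + 2 q + r + 3\<close> becomes \<open>2 p + 2 q + r + 2\<close>.\<close>

primrec tweight :: "tree \<Rightarrow> nat" where
  "tweight Leaf = 0"
| "tweight (Node l r) = 2 * tweight l + tweight r + 1"

text \<open>Rotating at the root until the left subtree is a leaf, and then treating the right
  subtree alone, uses only caret rotations on intervals \<open>[1 - 1 / 2 ^ k, 1]\<close>. The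
  clause on points left of the interval keeps the leaf that has been split off in place.\<close>

lemma flatten:
  "\<exists>g\<in>xgen. (\<forall>t \<le> 1 - 1 / 2 ^ k. g t = t) \<and>
     carries g (leaves T (1 - 1 / 2 ^ k) 1) (leaves (vine (nodes T)) (1 - 1 / 2 ^ k) 1)"
proof (induction T arbitrary: k rule: measure_induct_rule[of tweight])
  case (less T)
  let ?a = "1 - 1 / 2 ^ k :: real"
  have a: "?a < 1" by simp
  have m: "(?a + 1) / 2 = 1 - 1 / 2 ^ Suc k" by (simp add: field_simps)
  consider "T = Leaf" | r where "T = Node Leaf r" | p q r where "T = Node (Node p q) r"
    by (metis tree.exhaust)
  then show ?case
  proof cases
    case 1
    have "carries (\<lambda>t. t) [(?a, 1)] [(?a, 1)]"
      by (auto simp: carries_def intro!: affI[where k = 1])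
    then show ?thesis using 1 xgen.one by (intro bexI[of _ "\<lambda>t. t"]) auto
  next
    case 2
    obtain g where g: "g \<in> xgen" "\<forall>t \<le> 1 - 1 / 2 ^ Suc k. g t = t"
      "carries g (leaves r (1 - 1 / 2 ^ Suc k) 1) (leaves (vine (nodes r)) (1 - 1 / 2 ^ Suc k) 1)"
      using less.IH[of r "Suc k"] 2 by auto
    have le: "?a < 1 - 1 / 2 ^ Suc k" by (simp add: field_simps)
    have "aff g ?a ((?a + 1) / 2) ?a ((?a + 1) / 2)"
      unfolding m using g(2) le by (intro affI[where k = 1]) auto
    then have "carries g (leaves T ?a 1) (leaves (vine (nodes T)) ?a 1)"
      unfolding 2 using g(3) unfolding m[symmetric] by (simp add: carries_def)
    then show ?thesis using g(1,2) le by (intro bexI[of _ g]) auto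
  next
    case 3
    obtain g where g: "g \<in> xgen" "\<forall>t \<le> ?a. g t = t"
      "carries g (leaves (Node p (Node q r)) ?a 1) (leaves (vine (nodes (Node p (Node q r)))) ?a 1)"
      using less.IH[of "Node p (Node q r)" k] 3 by auto
    have "carries (g \<circ> xm ?a 1) (leaves T ?a 1) (leaves (vine (nodes (Node p (Node q r)))) ?a 1)"
      unfolding 3 by (rule carries_comp[OF xm_rotate[OF a] g(3)])
    moreover have "nodes (Node p (Node q r)) = nodes T" using 3 by simp
    moreover have "\<forall>t \<le> ?a. (g \<circ> xm ?a 1) t = t" using g(2) by (auto simp: xm_outside)
    ultimately show ?thesis using xgen_comp[OF g(1) xgen_xm[of k]] by metis
  qed
qed

section \<open>Subdivisions into standard dyadic intervals\<close>

text \<open>The outermost halving is the last rule applied, so case analysis tells in which half of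
  \<open>[a, b]\<close> a proper descendant lies.\<close>

inductive desc :: "real \<Rightarrow> real \<Rightarrow> real \<Rightarrow> real \<Rightarrow> bool" where
  refl: "desc a b a b"
| left: "desc a ((a + b) / 2) u v \<Longrightarrow> desc a b u v"
| right: "desc ((a + b) / 2) b u v \<Longrightarrow> desc a b u v"

lemma desc_bounds: "desc a b u v \<Longrightarrow> a < b \<Longrightarrow> a \<le> u \<and> u < v \<and> v \<le> b"
  by (induction rule: desc.induct) auto

lemma desc_halves: "desc a b u v \<Longrightarrow> desc a b u ((u + v) / 2) \<and> desc a b ((u + v) / 2) v"
  by (induction rule: desc.induct) (auto intro: desc.intros)

lemma desc_dyadic: "j < 2 ^ n \<Longrightarrow> desc 0 1 (real j / 2 ^ n) ((real j + 1) / 2 ^ n)"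
proof (induction n arbitrary: j)
  case 0
  then show ?case by (simp add: desc.refl)
next
  case (Suc n)
  define i where "i = j div 2"
  have i: "i < 2 ^ n" using Suc.prems unfolding i_def by auto
  define M where "M = (real i / 2 ^ n + (real i + 1) / 2 ^ n) / 2"
  have d: "desc 0 1 (real i / 2 ^ n) M" "desc 0 1 M ((real i + 1) / 2 ^ n)"
    using desc_halves[OF Suc.IH[OF i]] unfolding M_def by blast+
  consider "j = 2 * i" | "j = 2 * i + 1" unfolding i_def by linarith
  then show ?case
  proof cases
    case 1
    then have "real i / 2 ^ n = real j / 2 ^ Suc n" "M = (real j + 1) / 2 ^ Suc n"
      unfolding M_def by (simp_all add: field_simps)
    then show ?thesis using d(1) by (simp only:)
  next
    case 2
    then have "M = real j / 2 ^ Suc n" "(real i + 1) / 2 ^ n = (real j + 1) / 2 ^ Suc n"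
      unfolding M_def by (simp_all add: field_simps)
    then show ?thesis using d(2) by (simp only:)
  qed
qed

fun chain :: "real \<Rightarrow> (real \<times> real) list \<Rightarrow> real \<Rightarrow> bool" where
  "chain a [] b \<longleftrightarrow> a = b"
| "chain a (p # ps) b \<longleftrightarrow> fst p = a \<and> fst p < snd p \<and> chain (snd p) ps b"

lemma chain_bounds:
  "chain a Js b \<Longrightarrow> a \<le> b \<and> (\<forall>p\<in>set Js. a \<le> fst p \<and> fst p < snd p \<and> snd p \<le> b)"
  by (induction Js arbitrary: a) force+

lemma chain_append: "chain a I m \<Longrightarrow> chain m J b \<Longrightarrow> chain a (I @ J) b"
  by (induction I arbitrary: a) auto

lemma chain_leaves: "a < b \<Longrightarrow> chain a (leaves T a b) b"
proof (induction T arbitrary: a b)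
  case (Node l r)
  have "chain a (leaves l a ((a + b) / 2)) ((a + b) / 2)" "chain ((a + b) / 2) (leaves r ((a + b) / 2) b) b"
    using Node by auto
  then show ?case by (auto intro: chain_append)
qed simp

lemma chain_map:
  "strict_mono f \<Longrightarrow> chain a Js b \<Longrightarrow> chain (f a) (map (\<lambda>p. (f (fst p), f (snd p))) Js) (f b)"
  by (induction Js arbitrary: a) (auto simp: strict_mono_less)

lemma chain_split:
  assumes "chain a Js b" "a \<le> m" "m \<le> b" "\<forall>p\<in>set Js. snd p \<le> m \<or> m \<le> fst p"
  shows "\<exists>As Bs. Js = As @ Bs \<and> chain a As m \<and> chain m Bs b"
  using assms
proof (induction Js arbitrary: a)
  case Nil
  then show ?case by auto
next
  case (Cons p Js)
  show ?case
  proof (cases "snd p \<le> m")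
    case True
    then obtain As Bs where "Js = As @ Bs" "chain (snd p) As m" "chain m Bs b"
      using Cons.IH[of "snd p"] Cons.prems by auto
    then show ?thesis using Cons.prems by (intro exI[of _ "p # As"] exI[of _ Bs]) auto
  next
    case False
    then have "a = m" using Cons.prems by auto
    then show ?thesis using Cons.prems by (intro exI[of _ "[]"] exI[of _ "p # Js"]) auto
  qed
qed

lemma chain_singleton:
  assumes "chain a Js b" "(a, b) \<in> set Js" "a < b" shows "Js = [(a, b)]"
proof -
  obtain p ps where Js: "Js = p # ps" using assms(2) by (cases Js) auto
  have "(a, b) \<notin> set ps" using assms(1) chain_bounds[of "snd p" ps b] unfolding Js by auto
  then have p: "p = (a, b)" using assms(2) Js by auto
  then have "chain b ps b" using assms(1) Js by simp
  then have "ps = []" using chain_bounds[of "snd (hd ps)" "tl ps" b] by (cases ps) auto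
  then show ?thesis using Js p by simp
qed

text \<open>Unless \<open>[a, b]\<close> is itself a part, every part lies in one of the two halves;
  hence the midpoint is a division point and the chain splits there.\<close>

lemma tree_of_chain:
  assumes "a < b" "chain a Js b" "\<forall>p\<in>set Js. desc a b (fst p) (snd p)"
  shows "\<exists>T. Js = leaves T a b"
  using assms
proof (induction "length Js" arbitrary: Js a b rule: less_induct)
  case less
  show ?case
  proof (cases "(a, b) \<in> set Js")
    case True
    then show ?thesis using chain_singleton[OF less.prems(2)] less.prems(1) by (intro exI[of _ Leaf]) auto
  next
    case False
    let ?m = "(a + b) / 2"
    have d: "desc a ?m (fst p) (snd p) \<or> desc ?m b (fst p) (snd p)" if "p \<in> set Js" for p
    proof -
      have "desc a b (fst p) (snd p)" "p \<noteq> (a, b)" using that less.prems(3) False by auto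
      then show ?thesis by (cases rule: desc.cases) auto
    qed
    have b: "snd p \<le> ?m \<or> ?m \<le> fst p" if "p \<in> set Js" for p
      using d[OF that] desc_bounds[of a ?m "fst p" "snd p"] desc_bounds[of ?m b "fst p" "snd p"] less.prems(1)
      by auto
    have "a \<le> ?m" "?m \<le> b" using less.prems(1) by auto
    then obtain As Bs where AB: "Js = As @ Bs" "chain a As ?m" "chain ?m Bs b"
      using chain_split[OF less.prems(2)] b by meson
    have ne: "As \<noteq> []" "Bs \<noteq> []" using AB(2,3) less.prems(1) by auto
    have "\<exists>T. As = leaves T a ?m"
    proof (rule less.hyps)
      show "\<forall>p\<in>set As. desc a ?m (fst p) (snd p)"
      proof
        fix p assume p: "p \<in> set As"
        then have "fst p < ?m" using chain_bounds[OF AB(2)] by force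
        then show "desc a ?m (fst p) (snd p)"
          using d[of p] p AB(1) desc_bounds[of ?m b "fst p" "snd p"] less.prems(1) by auto
      qed
    qed (use AB ne less.prems(1) in auto)
    moreover have "\<exists>T. Bs = leaves T ?m b"
    proof (rule less.hyps)
      show "\<forall>p\<in>set Bs. desc ?m b (fst p) (snd p)"
      proof
        fix p assume p: "p \<in> set Bs"
        then have "?m < snd p" using chain_bounds[OF AB(3)] by force
        then show "desc ?m b (fst p) (snd p)"
          using d[of p] p AB(1) desc_bounds[of a ?m "fst p" "snd p"] less.prems(1) by auto
      qed
    qed (use AB ne less.prems(1) in auto)
    ultimately obtain S T where "Js = leaves (Node S T) a b" using AB(1) by auto
    then show ?thesis ..
  qed
qed

lemma leaves_full:
  "p \<in> set (leaves (full_tree n) (real j / 2 ^ k) ((real j + 1) / 2 ^ k)) \<Longrightarrow>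
     \<exists>i::nat. p = (real i / 2 ^ (n + k), (real i + 1) / 2 ^ (n + k))"
proof (induction n arbitrary: j k)
  case 0
  then show ?case by auto
next
  case (Suc n)
  define A B where "A = real j / 2 ^ k" and "B = (real j + 1) / 2 ^ k"
  have M: "(A + B) / 2 = (real (2 * j) + 1) / 2 ^ Suc k" "(A + B) / 2 = real (2 * j + 1) / 2 ^ Suc k"
    unfolding A_def B_def by (simp_all add: field_simps)
  have AB: "A = real (2 * j) / 2 ^ Suc k" "B = (real (2 * j + 1) + 1) / 2 ^ Suc k"
    unfolding A_def B_def by (simp_all add: field_simps)
  have "p \<in> set (leaves (full_tree n) A ((A + B) / 2)) \<or> p \<in> set (leaves (full_tree n) ((A + B) / 2) B)"
    using Suc.prems unfolding A_def[symmetric] B_def[symmetric] by simp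
  then show ?case
  proof
    assume "p \<in> set (leaves (full_tree n) A ((A + B) / 2))"
    from Suc.IH[OF this[unfolded M(1), unfolded AB(1)]] show ?thesis by simp
  next
    assume "p \<in> set (leaves (full_tree n) ((A + B) / 2) B)"
    from Suc.IH[OF this[unfolded M(2), unfolded AB(2)]] show ?thesis by simp
  qed
qed

section \<open>Uniform linearity on fine dyadic grids\<close>

text \<open>Besides linearity, the left end of the image must be a multiple of
  \<open>2 powi (m - int n)\<close>, the length of the image. This is what makes an image inside
  \<open>[0, 1]\<close> a standard dyadic interval.\<close>

definition good_at :: "(real \<Rightarrow> real) \<Rightarrow> nat \<Rightarrow> nat \<Rightarrow> bool" where
  "good_at f n j \<longleftrightarrow> (\<exists>m i :: int. m \<le> int n \<and> f (real j / 2 ^ n) = of_int i * 2 powi (m - int n) \<and>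
     (\<forall>t. real j / 2 ^ n \<le> t \<and> t \<le> (real j + 1) / 2 ^ n \<longrightarrow>
        f t = f (real j / 2 ^ n) + 2 powi m * (t - real j / 2 ^ n)))"

text \<open>The bound on \<open>n\<close> makes the grid so fine that the intercept
  \<open>p / 2 ^ q\<close> is a multiple of the image length.\<close>

lemma good_atI:
  assumes f: "\<And>t. real j / 2 ^ n \<le> t \<Longrightarrow> t \<le> (real j + 1) / 2 ^ n \<Longrightarrow> f t = 2 powi m * t + c"
    and c: "c = of_int p / 2 ^ q" and n: "int q + \<bar>m\<bar> \<le> int n"
  shows "good_at f n j"
proof -
  let ?u = "real j / 2 ^ n"
  have u: "f ?u = 2 powi m * ?u + c" by (rule f) (auto simp: divide_right_mono)
  have mu: "2 powi m * ?u = real j * 2 powi (m - int n)" by (simp add: power_int_diff)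
  have c': "c = of_int p * 2 ^ nat (int n - int q - m) * 2 powi (m - int n)"
  proof -
    have "(2::real) ^ nat (int n - int q - m) = 2 powi (int n - int q - m)"
      using n by (simp add: power_int_def)
    then have "(2::real) ^ nat (int n - int q - m) * 2 powi (m - int n) = 2 powi (- int q)"
      by (simp add: power_int_add[symmetric])
    then have "of_int p * 2 ^ nat (int n - int q - m) * 2 powi (m - int n) = of_int p * (2::real) powi (- int q)"
      by (simp only: mult.assoc)
    moreover have "c = of_int p * (2::real) powi (- int q)"
      by (simp add: c power_int_minus divide_inverse)
    ultimately show ?thesis by (simp only:)
  qed
  define i where "i = int j + p * 2 ^ nat (int n - int q - m)"
  have "real_of_int i = real j + of_int p * 2 ^ nat (int n - int q - m)" by (simp add: i_def)
  then have "f ?u = of_int i * 2 powi (m - int n)"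
    unfolding u mu by (subst c') (simp only: distrib_right)
  moreover have "f t = f ?u + 2 powi m * (t - ?u)" if "?u \<le> t" "t \<le> (real j + 1) / 2 ^ n" for t
    using f[OF that] u by (simp add: algebra_simps)
  ultimately show ?thesis unfolding good_at_def using n by (intro exI[of _ m] exI[of _ i] conjI) auto
qed

lemma dpl_local:
  assumes "dpl f"
  obtains e m m' c c' where "e > 0" "c \<in> dyad" "c' \<in> dyad"
    "\<And>s. x \<le> s \<Longrightarrow> s < x + e \<Longrightarrow> f s = 2 powi m * s + c"
    "\<And>s. x - e < s \<Longrightarrow> s \<le> x \<Longrightarrow> f s = 2 powi m' * s + c'"
    "x \<in> dyad \<or> (m = m' \<and> c = c')"
proof -
  obtain m m' where m: "rgerm f x m" "lgerm f x m'"
     "if x \<in> dyad then f x \<in> dyad else m = m' \<and> f x - 2 powi m * x \<in> dyad"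
    using assms unfolding dpl_def dgerm_def by meson
  obtain e where e: "e > 0" "\<And>s. x \<le> s \<and> s < x + e \<Longrightarrow> f s = f x + 2 powi m * (s - x)"
    using m(1) unfolding rgerm_def by blast
  obtain e' where e': "e' > 0" "\<And>s. x - e' < s \<and> s \<le> x \<Longrightarrow> f s = f x + 2 powi m' * (s - x)"
    using m(2) unfolding lgerm_def by blast
  show thesis
  proof (rule that[of "min e e'" "f x - 2 powi m * x" "f x - 2 powi m' * x" m m'])
    show "f x - 2 powi m * x \<in> dyad" "f x - 2 powi m' * x \<in> dyad"
      using m(3) by (auto split: if_splits intro!: dyad_diff dyad_mult)
    show "f s = 2 powi m * s + (f x - 2 powi m * x)" if "x \<le> s" "s < x + min e e'" for s
      using e(2)[of s] that by (simp add: algebra_simps)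
    show "f s = 2 powi m' * s + (f x - 2 powi m' * x)" if "x - min e e' < s" "s \<le> x" for s
      using e'(2)[of s] that by (simp add: algebra_simps)
  qed (use e(1) e'(1) m(3) in auto)
qed

text \<open>Compactness of \<open>[0, 1]\<close> by bisection. Near a dyadic \<open>x\<close> a fine
  grid interval lies on one side of \<open>x\<close>, because \<open>x\<close> is a grid point; near
  any other \<open>x\<close> the two germs are one affine map.\<close>

lemma dpl_uniform:
  assumes "dpl f"
  shows "\<exists>N. \<forall>n\<ge>N. \<forall>j. real j / 2 ^ n \<le> 1 \<and> 0 \<le> (real j + 1) / 2 ^ n \<longrightarrow> good_at f n j"
proof -
  define P where "P a b \<longleftrightarrow> (\<exists>N. \<forall>n\<ge>N. \<forall>j. real j / 2 ^ n \<le> b \<and> a \<le> (real j + 1) / 2 ^ n \<longrightarrow> good_at f n j)" for a b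
  have "P 0 1"
  proof (rule Bolzano[of 0 1 P])
    fix a b c assume "P a b" "P b c"
    then obtain M N where
      "\<forall>n\<ge>M. \<forall>j. real j / 2 ^ n \<le> b \<and> a \<le> (real j + 1) / 2 ^ n \<longrightarrow> good_at f n j"
      "\<forall>n\<ge>N. \<forall>j. real j / 2 ^ n \<le> c \<and> b \<le> (real j + 1) / 2 ^ n \<longrightarrow> good_at f n j"
      unfolding P_def by blast
    moreover have "real j / 2 ^ n \<le> b \<or> b \<le> (real j + 1) / 2 ^ n" for j n
    proof -
      have "real j / 2 ^ n \<le> (real j + 1) / 2 ^ n" by (simp add: divide_right_mono)
      then show ?thesis by linarith
    qed
    ultimately show "P a c" unfolding P_def by (intro exI[of _ "max M N"]) (metis max.bounded_iff)
  next
    fix x :: real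
    obtain e m m' c c' where e: "e > 0" "c \<in> dyad" "c' \<in> dyad"
      "\<And>s. x \<le> s \<Longrightarrow> s < x + e \<Longrightarrow> f s = 2 powi m * s + c"
      "\<And>s. x - e < s \<Longrightarrow> s \<le> x \<Longrightarrow> f s = 2 powi m' * s + c'"
      "x \<in> dyad \<or> (m = m' \<and> c = c')"
      using dpl_local[OF assms] by metis
    obtain p p' :: int and q q' :: nat where pq: "c = of_int p / 2 ^ q" "c' = of_int p' / 2 ^ q'"
      using e(2,3) unfolding dyad_alt by blast
    obtain r :: int and k :: nat where rk: "x \<in> dyad \<Longrightarrow> x = of_int r / 2 ^ k"
      unfolding dyad_alt by blast
    obtain l where l: "(1/2) ^ l < e / 3" using real_arch_pow_inv[of "e/3" "1/2"] e(1) by auto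
    define N where "N = l + k + q + q' + nat \<bar>m\<bar> + nat \<bar>m'\<bar>"
    have "P a b" if ab: "a \<le> x" "x \<le> b" "b - a < e / 3" for a b
      unfolding P_def
    proof (intro exI[of _ N] allI impI)
      fix n j assume n: "N \<le> n" and j: "real j / 2 ^ n \<le> b \<and> a \<le> (real j + 1) / 2 ^ n"
      let ?u = "real j / 2 ^ n" and ?v = "(real j + 1) / 2 ^ n"
      have "(1/2 :: real) ^ n \<le> (1/2) ^ l" using n by (intro power_decreasing) (auto simp: N_def)
      then have "?v - ?u < e / 3" using l by (simp add: power_divide diff_divide_distrib[symmetric])
      then have uv: "x - e < ?u" "?v < x + e" using j ab e(1) by linarith+
      have nq: "int q + \<bar>m\<bar> \<le> int n" "int q' + \<bar>m'\<bar> \<le> int n" "k \<le> n" using n unfolding N_def by auto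
      consider "x \<le> ?u" | "?v \<le> x" | "m = m'" "c = c'"
      proof (cases "x \<in> dyad")
        case True
        have "(2::real) ^ n = 2 ^ k * 2 ^ (n - k)" using nq(3) by (simp add: power_add[symmetric])
        then have "x = of_int (r * 2 ^ (n - k)) / 2 ^ n"
          by (simp add: rk[OF True])
        moreover have "r * 2 ^ (n - k) \<le> int j \<or> int j + 1 \<le> r * 2 ^ (n - k)" by linarith
        then have "real_of_int (r * 2 ^ (n - k)) \<le> real j \<or> real j + 1 \<le> real_of_int (r * 2 ^ (n - k))"
          by (metis of_int_le_iff of_int_of_nat_eq of_int_add of_int_1)
        ultimately have "x \<le> ?u \<or> ?v \<le> x"
          using divide_right_mono[of _ _ "2 ^ n :: real"] by (metis zero_le_numeral zero_le_power)
        then show thesis using that by blast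
      next
        case False
        then show thesis using e(6) that by blast
      qed
      then show "good_at f n j"
      proof cases
        case 1
        show ?thesis by (rule good_atI[OF _ pq(1) nq(1)], rule e(4)) (use 1 uv in auto)
      next
        case 2
        show ?thesis by (rule good_atI[OF _ pq(2) nq(2)], rule e(5)) (use 2 uv in auto)
      next
        case 3
        have "f t = 2 powi m * t + c" if "?u \<le> t" "t \<le> ?v" for t
          using e(4)[of t] e(5)[of t] uv that 3 by (cases "x \<le> t") auto
        then show ?thesis by (rule good_atI[OF _ pq(1) nq(1)])
      qed
    qed
    then show "\<exists>d>0. \<forall>a b. a \<le> x \<and> x \<le> b \<and> b - a < d \<longrightarrow> P a b"
      using e(1) by (intro exI[of _ "e / 3"]) auto
  qed simp
  then show ?thesis unfolding P_def .
qed

section \<open>Thompson's group and its two generators\<close>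

text \<open>An element of Thompson's group is represented by a map of the whole line, whose
  behaviour off \<open>[0, 1]\<close> is irrelevant. Equalities are therefore asserted on the unit
  interval only.\<close>

definition F1 :: "(real \<Rightarrow> real) set" where
  "F1 = {f. dpl f \<and> f 0 = 0 \<and> f 1 = 1}"

text \<open>A fine uniform tree is taken by \<open>f\<close> to a tree \<open>S\<close> with equally
  many leaves. Both flatten to the same right comb, by \<open>g\<close> and \<open>h\<close>, so
  \<open>f\<close> is \<open>rinv h \<circ> g\<close> on the unit interval.\<close>

theorem F1_generated:
  assumes "f \<in> F1"
  shows "\<exists>g\<in>xgen. \<forall>t. 0 \<le> t \<and> t \<le> 1 \<longrightarrow> f t = g t"
proof -
  have f: "dpl f" "f 0 = 0" "f 1 = 1" "strict_mono f" using assms by (auto simp: F1_def dpl_def)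
  obtain N where N: "\<And>n j. n \<ge> N \<Longrightarrow> real j / 2 ^ n \<le> 1 \<Longrightarrow> good_at f n j"
  proof -
    obtain N where "\<And>n j. n \<ge> N \<Longrightarrow> real j / 2 ^ n \<le> 1 \<and> 0 \<le> (real j + 1) / 2 ^ n \<Longrightarrow> good_at f n j"
      using dpl_uniform[OF f(1)] by blast
    then show thesis by (intro that[of N]) simp_all
  qed
  let ?L = "leaves (full_tree N) 0 1"
  define Js where "Js = map (\<lambda>p. (f (fst p), f (snd p))) ?L"
  have ch: "chain 0 ?L 1" by (rule chain_leaves) simp
  have chJ: "chain 0 Js 1" using chain_map[OF f(4) ch] f(2,3) by (simp add: Js_def)
  have leaf: "aff f (fst p) (snd p) (f (fst p)) (f (snd p)) \<and> desc 0 1 (f (fst p)) (f (snd p))"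
    if p: "p \<in> set ?L" for p
  proof -
    obtain j where j: "p = (real j / 2 ^ N, (real j + 1) / 2 ^ N)"
      using leaves_full[of p N 0 0] p by auto
    let ?u = "real j / 2 ^ N" and ?v = "(real j + 1) / 2 ^ N"
    have pb: "0 \<le> ?u" "?u < ?v" "?v \<le> 1" using chain_bounds[OF ch] p j by auto
    obtain m i where mi: "m \<le> int N" "f ?u = of_int i * 2 powi (m - int N)"
      "\<And>t. ?u \<le> t \<Longrightarrow> t \<le> ?v \<Longrightarrow> f t = f ?u + 2 powi m * (t - ?u)"
    proof -
      have "?u \<le> 1" using pb by linarith
      then have "good_at f N j" by (rule N[OF order_refl])
      then show thesis using that unfolding good_at_def by blast
    qed
    have fuv: "0 \<le> f ?u" "f ?u < f ?v" "f ?v \<le> 1"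
      using pb f(2,3) strict_mono_less_eq[OF f(4), of 0 ?u] strict_mono_less[OF f(4), of ?u ?v]
        strict_mono_less_eq[OF f(4), of ?v 1] by simp_all
    have "f ?v = f ?u + 2 powi m * (?v - ?u)" by (rule mi(3)) (use pb in auto)
    then have "f ?v - f ?u = 2 powi m * (?v - ?u)" by linarith
    note fdiff = this
    have "aff f ?u ?v (f ?u) (f ?v)"
      by (rule affI[where k = "2 powi m", OF pb(2) fuv(2) mi(3) fdiff])
    moreover have "desc 0 1 (f ?u) (f ?v)"
    proof -
      \<comment> \<open>With this exponent the image has length \<open>1 / 2 ^ k\<close> and begins
        at \<open>i / 2 ^ k\<close>.\<close>
      define k where "k = nat (int N - m)"
      have k: "(2::real) powi (m - int N) = 1 / 2 ^ k"
        using mi(1) by (simp add: k_def power_int_def power_divide)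
      have "?v - ?u = 1 / 2 ^ N" by (simp only: diff_divide_distrib[symmetric]) simp
      then have "2 powi m * (?v - ?u) = 1 / 2 ^ k" unfolding k[symmetric] by (simp add: power_int_diff)
      then have "f ?v = of_int i * (1 / 2 ^ k) + 1 / 2 ^ k" using fdiff mi(2) unfolding k by linarith
      then have fv: "f ?v = (of_int i + 1) / 2 ^ k" by (simp only: add_divide_distrib) simp
      have fu: "f ?u = of_int i / 2 ^ k" unfolding mi(2) k by simp
      have i: "0 \<le> i"
      proof (rule ccontr)
        assume "\<not> 0 \<le> i"
        then have "real_of_int i / 2 ^ k < 0" by (simp add: divide_neg_pos)
        then show False using fuv(1) unfolding fu by simp
      qed
      have "of_int i + 1 \<le> (2::real) ^ k" using fuv(3) unfolding fv by (simp add: divide_le_eq)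
      then have "real_of_int (i + 1) \<le> real_of_int (2 ^ k)" by simp
      then have "i + 1 \<le> 2 ^ k" by (simp only: of_int_le_iff)
      then have "int (nat i) < int (2 ^ k)" using i by simp
      then have "nat i < 2 ^ k" by (simp only: of_nat_less_iff)
      from desc_dyadic[OF this] show ?thesis unfolding fu fv using i by simp
    qed
    ultimately show ?thesis unfolding j by simp
  qed
  obtain S where S: "Js = leaves S 0 1"
  proof -
    have "\<forall>p\<in>set Js. desc 0 1 (fst p) (snd p)" unfolding Js_def using leaf by force
    from tree_of_chain[OF zero_less_one chJ this] show thesis using that by blast
  qed
  have car: "carries f ?L (leaves S 0 1)"
    unfolding S[symmetric] Js_def carries_def
    unfolding list_all2_conv_all_nth length_map
  proof (intro conjI allI impI)
    show "length ?L = length ?L" by (rule HOL.refl)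
  next
    fix i assume i: "i < length ?L"
    have "aff f (fst (?L ! i)) (snd (?L ! i)) (f (fst (?L ! i))) (f (snd (?L ! i)))"
      using leaf[OF nth_mem[OF i]] by (rule conjunct1)
    then show "aff f (fst (?L ! i)) (snd (?L ! i))
        (fst (map (\<lambda>p. (f (fst p), f (snd p))) ?L ! i)) (snd (map (\<lambda>p. (f (fst p), f (snd p))) ?L ! i))"
      unfolding nth_map[OF i] fst_conv snd_conv .
  qed
  obtain g where g: "g \<in> xgen" "carries g ?L (leaves (vine (nodes (full_tree N))) 0 1)"
    using flatten[of 0 "full_tree N"] by auto
  obtain h where h: "h \<in> xgen" "carries h (leaves S 0 1) (leaves (vine (nodes S)) 0 1)"
    using flatten[of 0 S] by auto
  have "length ?L = length (leaves S 0 1)" using S unfolding Js_def by (metis length_map)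
  then have "nodes S = nodes (full_tree N)" by (simp add: length_leaves)
  then have "carries (h \<circ> f) ?L (leaves (vine (nodes (full_tree N))) 0 1)"
    using carries_comp[OF car h(2)] by simp
  from carries_unique[OF this g(2) zero_less_one] have hf: "h (f t) = g t" if "0 \<le> t" "t \<le> 1" for t
    using that by simp
  have "f t = (rinv h \<circ> g) t" if "0 \<le> t" "t \<le> 1" for t
    using rinv_cancel(1)[OF dpl_xgen[OF h(1)], of "f t"] hf[OF that] by simp
  then show ?thesis using xgen_comp[OF xgen_inv[OF h(1)] g(1)] by blast
qed

lemma F1_comp: "f \<in> F1 \<Longrightarrow> g \<in> F1 \<Longrightarrow> f \<circ> g \<in> F1"
  by (simp add: F1_def dpl_comp)

lemma F1_id: "(\<lambda>t. t) \<in> F1"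
  by (simp add: F1_def dpl_id)

lemma F1_inv: "f \<in> F1 \<Longrightarrow> rinv f \<in> F1"
  unfolding F1_def using rinv_cancel(1) dpl_inv by (metis (mono_tags, lifting) mem_Collect_eq)

lemma F1_dpl: "f \<in> F1 \<Longrightarrow> dpl f" by (simp add: F1_def)

lemma F1_bounds:
  assumes "f \<in> F1"
  shows "0 \<le> u \<Longrightarrow> 0 \<le> f u" "u \<le> 1 \<Longrightarrow> f u \<le> 1" "u < 1 \<Longrightarrow> f u < 1"
proof -
  have f: "strict_mono f" "f 0 = 0" "f 1 = 1" using assms by (auto simp: F1_def dpl_def)
  show "0 \<le> u \<Longrightarrow> 0 \<le> f u" "u \<le> 1 \<Longrightarrow> f u \<le> 1" "u < 1 \<Longrightarrow> f u < 1"
    using strict_mono_less_eq[OF f(1), of 0 u] strict_mono_less_eq[OF f(1), of u 1]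
      strict_mono_less[OF f(1), of u 1] f(2,3) by simp_all
qed

lemma F1_xm: "0 \<le> a \<Longrightarrow> a < b \<Longrightarrow> b \<le> 1 \<Longrightarrow> a \<in> dyad \<Longrightarrow> b \<in> dyad \<Longrightarrow> xm a b \<in> F1"
  by (simp add: F1_def dpl_xm xm_outside)

section \<open>Pentagon relation and bumps\<close>

text \<open>Both sides carry the left comb with four leaves to the right comb: they are the two ways
  round the pentagon formed by the five binary trees with four leaves.\<close>

lemma xm_pentagon:
  assumes "a < b"
  shows "xm a b \<circ> xm a b = xm ((a + b) / 2) b \<circ> xm a b \<circ> xm a ((a + b) / 2)"
proof
  fix t
  let ?m = "(a + b) / 2"
  have m: "a < ?m" "?m < b" using assms by auto
  have id: "carries (xm c d) (leaves T u v) (leaves T u v)" if "u < v" "v \<le> c \<or> d \<le> u" for c d u v T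
    by (rule carries_leaves, rule affI[where k = 1]) (use that in \<open>auto simp: xm_outside\<close>)
  let ?V = "Node Leaf (Node Leaf (Node Leaf Leaf))" and ?T = "Node (Node (Node Leaf Leaf) Leaf) Leaf"
  have 1: "carries (xm a b \<circ> xm a b) (leaves ?T a b) (leaves ?V a b)"
    by (rule carries_comp[OF xm_rotate[OF assms] xm_rotate[OF assms]])
  have 2: "carries (xm a ?m) (leaves ?T a b) (leaves (Node (Node Leaf (Node Leaf Leaf)) Leaf) a b)"
    unfolding leaves.simps(2)[of "Node (Node Leaf Leaf) Leaf"] leaves.simps(2)[of "Node Leaf (Node Leaf Leaf)" Leaf]
    by (rule carries_append[OF xm_rotate[OF m(1)] id[OF m(2)]]) simp
  have 3: "carries (xm ?m b) (leaves (Node Leaf (Node (Node Leaf Leaf) Leaf)) a b) (leaves ?V a b)"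
    unfolding leaves.simps(2)[of Leaf "Node (Node Leaf Leaf) Leaf"] leaves.simps(2)[of Leaf "Node Leaf (Node Leaf Leaf)"]
    by (rule carries_append[OF id[OF m(1)] xm_rotate[OF m(2)]]) simp
  have 4: "carries (xm ?m b \<circ> xm a b \<circ> xm a ?m) (leaves ?T a b) (leaves ?V a b)"
    by (rule carries_comp[OF 2 carries_comp[OF xm_rotate[OF assms] 3]])
  show "(xm a b \<circ> xm a b) t = (xm ?m b \<circ> xm a b \<circ> xm a ?m) t"
  proof (cases "a \<le> t \<and> t \<le> b")
    case True
    then show ?thesis using carries_unique[OF 1 4 assms] by blast
  next
    case False
    then have "t \<le> a \<or> b \<le> t" "t \<le> a \<or> ?m \<le> t" "t \<le> ?m \<or> b \<le> t" using m by auto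
    then show ?thesis by (simp add: xm_outside)
  qed
qed

lemma xm_shift: "xm (a + c) (b + c) (t + c) = xm a b t + c"
  by (simp add: xm_def)

text \<open>Slope 1/2 up to \<open>c + 2 * d\<close>, which moves down to \<open>c + d\<close>, and
  slope 2 beyond. The slopes serve to conjugate an interval to one of its halves; the displacement
  \<open>d\<close> is one step of the descent in \<open>G_descent\<close>.\<close>

definition bump :: "real \<Rightarrow> real \<Rightarrow> real \<Rightarrow> real" where
  "bump c d = glue c (\<lambda>t. t) (glue (c + 2 * d) (\<lambda>t. (t + c) / 2) (glue (c + 3 * d) (\<lambda>t. 2 * t - (c + 3 * d)) (\<lambda>t. t)))"

lemma bump_outside: "d > 0 \<Longrightarrow> t \<le> c \<or> c + 3 * d \<le> t \<Longrightarrow> bump c d t = t"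
  by (auto simp: bump_def glue_def)

lemma bump_pieces:
  "d > 0 \<Longrightarrow> c \<le> t \<Longrightarrow> t \<le> c + 2 * d \<Longrightarrow> bump c d t = (t + c) / 2"
  "d > 0 \<Longrightarrow> c + 2 * d \<le> t \<Longrightarrow> t \<le> c + 3 * d \<Longrightarrow> bump c d t = 2 * t - (c + 3 * d)"
  by (auto simp: bump_def glue_def)

lemma dpl_bump:
  assumes "d > 0" "c \<in> dyad" "d \<in> dyad" shows "dpl (bump c d)"
proof -
  have cd: "c + 2 * d \<in> dyad" "c + 3 * d \<in> dyad" using assms by (auto intro!: dyad_add dyad_mult)
  have 3: "dpl (glue (c + 3 * d) (\<lambda>t. 2 * t - (c + 3 * d)) (\<lambda>t. t))"
    by (rule dpl_glue) (use cd dpl_id dpl_lines in auto)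
  have 2: "dpl (glue (c + 2 * d) (\<lambda>t. (t + c) / 2) (glue (c + 3 * d) (\<lambda>t. 2 * t - (c + 3 * d)) (\<lambda>t. t)))"
    by (rule dpl_glue[OF dpl_lines(2)[OF assms(2)] 3 _ cd(1)]) (use assms(1) in \<open>auto simp: glue_def field_simps\<close>)
  show ?thesis unfolding bump_def
    by (rule dpl_glue[OF dpl_id(2) 2 _ assms(2)]) (use assms(1) in \<open>auto simp: glue_def\<close>)
qed

lemma F1_bump: "d > 0 \<Longrightarrow> c \<in> dyad \<Longrightarrow> d \<in> dyad \<Longrightarrow> 0 \<le> c \<Longrightarrow> c + 3 * d \<le> 1 \<Longrightarrow> bump c d \<in> F1"
  by (simp add: F1_def dpl_bump bump_outside)

section \<open>The lifted group\<close>

locale z_system =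
  fixes X :: "'a topology" and \<phi> :: "'a \<Rightarrow> 'a"
  assumes hom: "homeomorphic_map X X \<phi>" and compact: "compact_space X"
begin

abbreviation it :: "int \<Rightarrow> 'a \<Rightarrow> 'a" where "it \<equiv> int_iterate X \<phi>"
abbreviation S :: "'a set" where "S \<equiv> topspace X"

lemma bij_phi: "bij_betw \<phi> S S"
  using hom by (simp add: homeomorphic_imp_injective_map homeomorphic_imp_surjective_map bij_betw_def)

lemma phi_in: "x \<in> S \<Longrightarrow> \<phi> x \<in> S"
  using bij_phi by (auto simp: bij_betw_def)

lemma phi_inj: "x \<in> S \<Longrightarrow> y \<in> S \<Longrightarrow> \<phi> x = \<phi> y \<longleftrightarrow> x = y"
  using bij_phi by (auto simp: bij_betw_def inj_on_def)

lemma it_0 [simp]: "it 0 x = x" by (simp add: int_iterate_def)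

lemma it_in [simp]: assumes "x \<in> S" shows "it n x \<in> S"
proof -
  have "(\<phi> ^^ k) x \<in> S" for k by (induction k) (auto simp: assms phi_in)
  moreover have "(inv_into S \<phi> ^^ k) x \<in> S" for k
  proof (induction k)
    case (Suc k)
    then show ?case using bij_phi inv_into_into[of _ \<phi> S] by (auto simp: bij_betw_def)
  qed (simp add: assms)
  ultimately show ?thesis by (simp add: int_iterate_def)
qed

lemma it_step: assumes "x \<in> S" shows "\<phi> (it n x) = it (n + 1) x"
proof (cases "n \<ge> 0")
  case True
  then have "nat (n + 1) = Suc (nat n)" by simp
  then show ?thesis using True by (simp add: int_iterate_def)
next
  case False
  define k where "k = nat (- n - 1)"
  have k: "nat (- n) = Suc k" "n + 1 = - int k" using False unfolding k_def by auto
  have "it (n + 1) x = (inv_into S \<phi> ^^ k) x"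
    unfolding k(2) by (cases k) (simp_all add: int_iterate_def nat_add_distrib)
  moreover have "it n x = inv_into S \<phi> ((inv_into S \<phi> ^^ k) x)" using False k(1) by (simp add: int_iterate_def)
  moreover have "(inv_into S \<phi> ^^ k) x \<in> S" using it_in[OF assms, of "n + 1"] calculation(1) by simp
  ultimately show ?thesis using bij_phi by (simp add: bij_betw_def f_inv_into_f)
qed

lemma it_add: assumes "x \<in> S" shows "it (m + n) x = it m (it n x)"
proof (induction m rule: int_induct[where k = 0])
  case base
  then show ?case by simp
next
  case (step1 i)
  have "it (i + n + 1) x = \<phi> (it (i + n) x)" using it_step[OF assms] by simp
  also have "\<dots> = it (i + 1) (it n x)" using step1 it_step[of "it n x" i] assms by simp
  finally show ?case by (simp add: algebra_simps)
next
  case (step2 i)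
  have "\<phi> (it (i - 1 + n) x) = it (i + n) x" using it_step[OF assms, of "i - 1 + n"] by (simp add: algebra_simps)
  also have "\<dots> = \<phi> (it (i - 1) (it n x))" using step2 it_step[of "it n x" "i - 1"] assms by simp
  finally show ?case using phi_inj assms by simp
qed

lemma it_phi: "x \<in> S \<Longrightarrow> it n (\<phi> x) = it (n + 1) x"
  using it_add[of x n 1] it_step[of x 0] by simp

lemma it_cont: "continuous_map X X (it n)"
proof -
  obtain g where g: "continuous_map X X \<phi>" "continuous_map X X g" "\<And>x. x \<in> S \<Longrightarrow> g (\<phi> x) = x"
    using hom unfolding homeomorphic_map_maps homeomorphic_maps_def by blast
  show ?thesis
  proof (induction n rule: int_induct[where k = 0])
    case base
    then show ?case by (simp add: continuous_map_eq[OF continuous_map_id])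
  next
    case (step1 i)
    show ?case by (rule continuous_map_eq[OF continuous_map_compose[OF step1(2) g(1)]]) (simp add: it_step)
  next
    case (step2 i)
    have "g (it i x) = it (i - 1) x" if "x \<in> S" for x
      using it_step[OF that, of "i - 1"] g(3)[of "it (i - 1) x"] that by simp
    then show ?case by (intro continuous_map_eq[OF continuous_map_compose[OF step2(2) g(2)]]) simp
  qed
qed

definition clop :: "'a set \<Rightarrow> bool" where "clop C \<longleftrightarrow> openin X C \<and> closedin X C"

lemma clop_sub: "clop C \<Longrightarrow> C \<subseteq> S" by (simp add: clop_def openin_subset)

lemma clop_ops: "clop C \<Longrightarrow> clop D \<Longrightarrow> clop (C \<inter> D)" "clop C \<Longrightarrow> clop D \<Longrightarrow> clop (C \<union> D)"
  "clop C \<Longrightarrow> clop D \<Longrightarrow> clop (C - D)" "clop S" "clop {}"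
  by (auto simp: clop_def intro: openin_Int closedin_Int openin_Un closedin_Un openin_diff closedin_diff)

lemma clop_it: "clop C \<Longrightarrow> clop {x \<in> S. it n x \<in> C}"
  unfolding clop_def using it_cont openin_continuous_map_preimage closedin_continuous_map_preimage by blast

lemma compact_points:
  assumes "\<And>x. x \<in> S \<Longrightarrow> openin X (U x) \<and> x \<in> U x"
  obtains P where "finite P" "P \<subseteq> S" "S \<subseteq> (\<Union>x\<in>P. U x)"
proof -
  have "\<exists>\<F>. finite \<F> \<and> \<F> \<subseteq> U ` S \<and> S \<subseteq> \<Union>\<F>"
    using compact assms unfolding compact_space_def compactin_def by (auto dest!: spec[of _ "U ` S"])
  then show thesis using that by (metis (no_types, lifting) finite_subset_image)
qed

definition loc_const :: "('a \<Rightarrow> 'c) \<Rightarrow> bool" where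
  "loc_const v \<longleftrightarrow> (\<forall>x\<in>S. \<exists>U. openin X U \<and> x \<in> U \<and> (\<forall>y\<in>U. v y = v x))"

lemma clop_level: assumes "loc_const v" shows "clop {x \<in> S. P (v x)}"
proof -
  have "openin X {x \<in> S. Q (v x)}" for Q
  proof (subst openin_subopen, safe)
    fix x assume "x \<in> S" "Q (v x)"
    then obtain U where "openin X U" "x \<in> U" "\<forall>y\<in>U. v y = v x" using assms unfolding loc_const_def by blast
    moreover have "U \<subseteq> S" using \<open>openin X U\<close> by (rule openin_subset)
    moreover have "Q (v y)" if "y \<in> U" for y using calculation(3) that \<open>Q (v x)\<close> by metis
    ultimately show "\<exists>T. openin X T \<and> x \<in> T \<and> T \<subseteq> {x \<in> S. Q (v x)}" by blast
  qed
  note op = this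
  have "S - {x \<in> S. P (v x)} = {x \<in> S. \<not> P (v x)}" by blast
  then show ?thesis
    unfolding clop_def closedin_def using op[of P] op[of "\<lambda>v. \<not> P v"] by simp
qed

text \<open>Since \<open>F x\<close> is allowed to vary with \<open>x\<close> only in a locally constant way, these are the lifts
  to \<open>X \<times> \<real>\<close> of homeomorphisms of the suspension preserving the flow lines.\<close>

definition flow_lift :: "('a \<Rightarrow> real \<Rightarrow> real) \<Rightarrow> bool" where
  "flow_lift F \<longleftrightarrow> (\<forall>x\<in>S. strict_mono (F x) \<and> surj (F x)) \<and>
     (\<forall>x\<in>S. \<forall>t. F (\<phi> x) t = F x (t + 1) - 1) \<and>
     (\<forall>K. loc_const (\<lambda>x. \<lambda>t\<in>{-K..K}. F x t))"

definition PL_lift :: "('a \<Rightarrow> real \<Rightarrow> real) \<Rightarrow> bool" where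
  "PL_lift F \<longleftrightarrow> flow_lift F \<and> (\<forall>x\<in>S. dpl (F x))"

lemma flow_lift_local:
  assumes "flow_lift F" "x \<in> S"
  obtains U where "openin X U" "x \<in> U" "\<And>y t. y \<in> U \<Longrightarrow> \<bar>t\<bar> \<le> K \<Longrightarrow> F y t = F x t"
proof -
  obtain U where U: "openin X U" "x \<in> U" "\<And>y. y \<in> U \<Longrightarrow> (\<lambda>t\<in>{-K..K}. F y t) = (\<lambda>t\<in>{-K..K}. F x t)"
    using assms unfolding flow_lift_def loc_const_def by meson
  have "F y t = F x t" if "y \<in> U" "\<bar>t\<bar> \<le> K" for y t
  proof -
    have "t \<in> {-K..K}" using that by auto
    then show ?thesis using fun_cong[OF U(3)[OF that(1)], of t] by simp
  qed
  then show thesis using that U by blast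
qed

lemma flow_lift_mono: "flow_lift F \<Longrightarrow> x \<in> S \<Longrightarrow> strict_mono (F x)" "flow_lift F \<Longrightarrow> x \<in> S \<Longrightarrow> surj (F x)"
  by (auto simp: flow_lift_def)

lemma flow_lift_bij: "flow_lift F \<Longrightarrow> x \<in> S \<Longrightarrow> bij (F x)"
  using flow_lift_mono by (simp add: bij_def strict_mono_imp_inj_on)

lemma flow_lift_rinv: "flow_lift F \<Longrightarrow> x \<in> S \<Longrightarrow> rinv (F x) (F x t) = t" "flow_lift F \<Longrightarrow> x \<in> S \<Longrightarrow> F x (rinv (F x) t) = t"
  using flow_lift_bij by (auto simp: bij_is_inj bij_is_surj surj_f_inv_f)

lemma flow_lift_phi: "flow_lift F \<Longrightarrow> x \<in> S \<Longrightarrow> F (\<phi> x) t = F x (t + 1) - 1"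
  by (auto simp: flow_lift_def)

lemma flow_lift_it: assumes "flow_lift F" "x \<in> S" shows "F (it n x) t = F x (t + of_int n) - of_int n"
proof (induction n arbitrary: t rule: int_induct[where k = 0])
  case base
  then show ?case by simp
next
  case (step1 i)
  have "F (it (i + 1) x) t = F (it i x) (t + 1) - 1"
    using flow_lift_phi[OF assms(1), of "it i x"] assms(2) it_step by simp
  then show ?case unfolding step1(2) by (simp add: algebra_simps)
next
  case (step2 i)
  have "F (it i x) (t - 1) = F (it (i - 1) x) t - 1"
    using flow_lift_phi[OF assms(1), of "it (i - 1) x" "t - 1"] assms(2) it_step[OF assms(2), of "i - 1"] by simp
  then show ?case unfolding step2(2) by (simp add: algebra_simps)
qed

lemma flow_liftI:
  assumes "\<And>x. x \<in> S \<Longrightarrow> strict_mono (F x)" "\<And>x. x \<in> S \<Longrightarrow> surj (F x)"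
    "\<And>x t. x \<in> S \<Longrightarrow> F (\<phi> x) t = F x (t + 1) - 1"
    "\<And>x K. x \<in> S \<Longrightarrow> \<exists>U. openin X U \<and> x \<in> U \<and> (\<forall>y\<in>U. \<forall>t. \<bar>t\<bar> \<le> K \<longrightarrow> F y t = F x t)"
  shows "flow_lift F"
proof -
  have "loc_const (\<lambda>x. \<lambda>t\<in>{-K..K}. F x t)" for K
    unfolding loc_const_def
  proof
    fix x assume "x \<in> S"
    then obtain U where U: "openin X U" "x \<in> U" "\<forall>y\<in>U. \<forall>t. \<bar>t\<bar> \<le> K \<longrightarrow> F y t = F x t"
      using assms(4) by meson
    have "(\<lambda>t\<in>{-K..K}. F y t) = (\<lambda>t\<in>{-K..K}. F x t)" if "y \<in> U" for y
      by (rule restrict_ext) (use U(3) that in auto)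
    then show "\<exists>U. openin X U \<and> x \<in> U \<and> (\<forall>y\<in>U. (\<lambda>t\<in>{-K..K}. F y t) = (\<lambda>t\<in>{-K..K}. F x t))"
      using U by blast
  qed
  then show ?thesis unfolding flow_lift_def using assms(1-3) by blast
qed

lemma flow_lift_comp:
  assumes "flow_lift F" "flow_lift G" shows "flow_lift (\<lambda>x t. F x (G x t))"
proof (rule flow_liftI)
  fix x assume x: "x \<in> S"
  note mF = flow_lift_mono[OF assms(1) x] and mG = flow_lift_mono[OF assms(2) x]
  show "strict_mono (\<lambda>t. F x (G x t))"
    by (rule strict_monoI) (simp add: strict_mono_less[OF mF(1)] strict_mono_less[OF mG(1)])
  show "surj (\<lambda>t. F x (G x t))" using comp_surj[OF mG(2) mF(2)] by (simp add: o_def)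
  show "F (\<phi> x) (G (\<phi> x) t) = F x (G x (t + 1)) - 1" for t
    by (simp add: flow_lift_phi[OF assms(1) x] flow_lift_phi[OF assms(2) x])
  show "\<exists>U. openin X U \<and> x \<in> U \<and> (\<forall>y\<in>U. \<forall>t. \<bar>t\<bar> \<le> K \<longrightarrow> F y (G y t) = F x (G x t))" for K
  proof -
    \<comment> \<open>Monotonicity keeps \<open>G x t\<close> in this window for all
      \<open>\<bar>t\<bar> \<le> K\<close>, so local constancy of \<open>F\<close> applies at
      \<open>G x t\<close>.\<close>
    define K' where "K' = max \<bar>G x (-K)\<bar> \<bar>G x K\<bar>"
    obtain U where U: "openin X U" "x \<in> U" "\<And>y t. y \<in> U \<Longrightarrow> \<bar>t\<bar> \<le> K' \<Longrightarrow> F y t = F x t"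
      by (rule flow_lift_local[OF assms(1) x, where K = K']) blast
    obtain V where V: "openin X V" "x \<in> V" "\<And>y t. y \<in> V \<Longrightarrow> \<bar>t\<bar> \<le> K \<Longrightarrow> G y t = G x t"
      by (rule flow_lift_local[OF assms(2) x, where K = K]) blast
    have "F y (G y t) = F x (G x t)" if y: "y \<in> U \<inter> V" and t: "\<bar>t\<bar> \<le> K" for y t
    proof -
      have "G x (-K) \<le> G x t" "G x t \<le> G x K" using t by (auto simp: strict_mono_less_eq[OF mG(1)])
      then have "\<bar>G x t\<bar> \<le> K'" unfolding K'_def by linarith
      then show ?thesis using U(3)[of y "G x t"] V(3)[of y t] y t by simp
    qed
    then show ?thesis using openin_Int[OF U(1) V(1)] U(2) V(2) by blast
  qed
qed

lemma flow_lift_inv: assumes "flow_lift F" shows "flow_lift (\<lambda>x. rinv (F x))"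
proof (rule flow_liftI)
  fix x assume x: "x \<in> S"
  note mF = flow_lift_mono[OF assms(1) x]
  show sm: "strict_mono (rinv (F x))" by (rule strict_mono_inv'[OF mF])
  show "surj (rinv (F x))" using flow_lift_rinv(1)[OF assms x] by (metis surjI)
  show "rinv (F (\<phi> x)) t = rinv (F x) (t + 1) - 1" for t
  proof -
    have "F (\<phi> x) (rinv (F x) (t + 1) - 1) = t"
      using flow_lift_phi[OF assms x, of "rinv (F x) (t + 1) - 1"] flow_lift_rinv(2)[OF assms x] by simp
    then show ?thesis using flow_lift_rinv(1)[OF assms phi_in[OF x]] by metis
  qed
  show "\<exists>U. openin X U \<and> x \<in> U \<and> (\<forall>y\<in>U. \<forall>t. \<bar>t\<bar> \<le> K \<longrightarrow> rinv (F y) t = rinv (F x) t)" for K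
  proof -
    define K' where "K' = max \<bar>rinv (F x) (-K)\<bar> \<bar>rinv (F x) K\<bar>"
    obtain U where U: "openin X U" "x \<in> U" "\<And>y t. y \<in> U \<Longrightarrow> \<bar>t\<bar> \<le> K' \<Longrightarrow> F y t = F x t"
      by (rule flow_lift_local[OF assms(1) x, where K = K']) blast
    have "rinv (F y) t = rinv (F x) t" if y: "y \<in> U" and t: "\<bar>t\<bar> \<le> K" for y t
    proof -
      have yS: "y \<in> S" using y U(1) openin_subset by blast
      have "rinv (F x) (-K) \<le> rinv (F x) t" "rinv (F x) t \<le> rinv (F x) K"
        using t by (auto simp: strict_mono_less_eq[OF sm])
      then have "\<bar>rinv (F x) t\<bar> \<le> K'" unfolding K'_def by linarith
      \<comment> \<open>\<open>F x\<close> and \<open>F y\<close> agree at the preimage under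
        \<open>F x\<close>, which is therefore the preimage under \<open>F y\<close> too.\<close>
      then have "F y (rinv (F x) t) = t" using U(3)[OF y] flow_lift_rinv(2)[OF assms x] by simp
      then show ?thesis using flow_lift_rinv(1)[OF assms yS] by metis
    qed
    then show ?thesis using U by blast
  qed
qed

lemma flow_lift_cong: assumes "flow_lift F" "\<And>x. x \<in> S \<Longrightarrow> F x = G x" shows "flow_lift G"
proof (rule flow_liftI)
  fix x assume x: "x \<in> S"
  show "strict_mono (G x)" "surj (G x)" "G (\<phi> x) t = G x (t + 1) - 1" for t
    using flow_lift_mono[OF assms(1) x] flow_lift_phi[OF assms(1) x] assms(2)[OF x] assms(2)[OF phi_in[OF x]] by auto
  fix K
  obtain U where U: "openin X U" "x \<in> U" "\<And>y t. y \<in> U \<Longrightarrow> \<bar>t\<bar> \<le> K \<Longrightarrow> F y t = F x t"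
      by (rule flow_lift_local[OF assms(1) x, where K = K]) blast
  have "G y t = G x t" if "y \<in> U" "\<bar>t\<bar> \<le> K" for y t
  proof -
    have "y \<in> S" using that U(1) openin_subset by blast
    then show ?thesis using U(3)[OF that] assms(2)[OF x] assms(2)[of y] by simp
  qed
  then show "\<exists>U. openin X U \<and> x \<in> U \<and> (\<forall>y\<in>U. \<forall>t. \<bar>t\<bar> \<le> K \<longrightarrow> G y t = G x t)" using U by blast
qed

lemma PL_lift_comp: "PL_lift F \<Longrightarrow> PL_lift G \<Longrightarrow> PL_lift (\<lambda>x t. F x (G x t))"
  unfolding PL_lift_def using flow_lift_comp dpl_comp[unfolded o_def] by blast

lemma PL_lift_inv: "PL_lift F \<Longrightarrow> PL_lift (\<lambda>x. rinv (F x))"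
  unfolding PL_lift_def using flow_lift_inv dpl_inv by blast

lemma PL_lift_translate: assumes "c \<in> dyad" shows "PL_lift (\<lambda>x t. t + c)"
proof -
  have "flow_lift (\<lambda>x t. t + c)"
  proof (rule flow_liftI)
    show "surj (\<lambda>t. t + c)" by (rule surjI[of _ "\<lambda>t. t - c"]) simp
  qed (auto simp: strict_mono_def)
  then show ?thesis unfolding PL_lift_def using dpl_translate[OF assms] by blast
qed

subsection \<open>Fragments\<close>

text \<open>The point \<open>[x, t]\<close> equals \<open>[it n x, t - n]\<close> with
  \<open>n = \<lfloor>t\<rfloor>\<close>. The family acts on the unit interval over
  \<open>it n x\<close>, and the result is carried back. For \<open>p = over C f\<close> this is the
  lift of \<open>f\<^sub>C\<close>.\<close>

definition fragment :: "('a \<Rightarrow> real \<Rightarrow> real) \<Rightarrow> 'a \<Rightarrow> real \<Rightarrow> real" where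
  "fragment p x t = of_int \<lfloor>t\<rfloor> + p (it \<lfloor>t\<rfloor> x) (t - of_int \<lfloor>t\<rfloor>)"

definition fam :: "('a \<Rightarrow> real \<Rightarrow> real) \<Rightarrow> bool" where
  "fam p \<longleftrightarrow> (\<forall>x\<in>S. p x \<in> F1) \<and> loc_const (\<lambda>x. \<lambda>t\<in>{0..1}. p x t)"

lemma famI:
  assumes "\<And>x. x \<in> S \<Longrightarrow> p x \<in> F1"
    "\<And>x. x \<in> S \<Longrightarrow> \<exists>U. openin X U \<and> x \<in> U \<and> (\<forall>y\<in>U. \<forall>t. 0 \<le> t \<and> t \<le> 1 \<longrightarrow> p y t = p x t)"
  shows "fam p"
  unfolding fam_def loc_const_def
proof (intro conjI ballI)
  fix x assume "x \<in> S"
  then obtain U where U: "openin X U" "x \<in> U" "\<forall>y\<in>U. \<forall>t. 0 \<le> t \<and> t \<le> 1 \<longrightarrow> p y t = p x t"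
    using assms(2) by meson
  have "(\<lambda>t\<in>{0..1}. p y t) = (\<lambda>t\<in>{0..1}. p x t)" if "y \<in> U" for y
    by (rule restrict_ext) (use U(3) that in auto)
  then show "\<exists>U. openin X U \<and> x \<in> U \<and> (\<forall>y\<in>U. (\<lambda>t\<in>{0..1}. p y t) = (\<lambda>t\<in>{0..1}. p x t))" using U by blast
qed (use assms(1) in auto)

lemma fam_local:
  assumes "fam p" "x \<in> S"
  obtains U where "openin X U" "x \<in> U" "\<And>y t. y \<in> U \<Longrightarrow> 0 \<le> t \<Longrightarrow> t \<le> 1 \<Longrightarrow> p y t = p x t"
proof -
  obtain U where U: "openin X U" "x \<in> U" "\<And>y. y \<in> U \<Longrightarrow> (\<lambda>t\<in>{0..1}. p y t) = (\<lambda>t\<in>{0..1}. p x t)"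
    using assms unfolding fam_def loc_const_def by meson
  have "p y t = p x t" if "y \<in> U" "0 \<le> t" "t \<le> 1" for y t
    using fun_cong[OF U(3)[OF that(1)], of t] that by simp
  then show thesis using that U by blast
qed

lemma famD: "fam p \<Longrightarrow> x \<in> S \<Longrightarrow> p x \<in> F1" by (simp add: fam_def)

text \<open>The end \<open>u = 1\<close> is included: the formulas for \<open>n\<close> and
  \<open>n + 1\<close> agree there because every member of the family fixes 0 and 1.\<close>

lemma fragment_eq:
  assumes "fam p" "x \<in> S" "0 \<le> u" "u \<le> 1"
  shows "fragment p x (of_int n + u) = of_int n + p (it n x) u"
proof (cases "u = 1")
  case True
  have "p (it (n + 1) x) 0 = 0" "p (it n x) 1 = 1"
    using famD[OF assms(1) it_in[OF assms(2)]] by (auto simp: F1_def)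
  then show ?thesis unfolding True fragment_def by simp
next
  case False
  then have "\<lfloor>of_int n + u\<rfloor> = n" using assms by linarith
  then show ?thesis unfolding fragment_def by simp
qed

lemma fragment_cong:
  assumes "\<And>z u. z \<in> S \<Longrightarrow> 0 \<le> u \<Longrightarrow> u < 1 \<Longrightarrow> p z u = q z u" "x \<in> S"
  shows "fragment p x = fragment q x"
proof
  fix t :: real
  have "0 \<le> t - of_int \<lfloor>t\<rfloor>" "t - of_int \<lfloor>t\<rfloor> < 1" by linarith+
  then show "fragment p x t = fragment q x t" unfolding fragment_def using assms by simp
qed

lemma unit_decomp: obtains n :: int and u :: real where "t = of_int n + u" "0 \<le> u" "u < 1"
proof
  show "t = of_int \<lfloor>t\<rfloor> + (t - of_int \<lfloor>t\<rfloor>)" by simp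
  show "0 \<le> t - of_int \<lfloor>t\<rfloor>" "t - of_int \<lfloor>t\<rfloor> < 1" by linarith+
qed

lemma fragment_comp:
  assumes "fam p" "fam q" "x \<in> S"
  shows "fragment p x (fragment q x t) = fragment (\<lambda>z u. p z (q z u)) x t"
proof -
  obtain n u where t: "t = of_int n + u" "0 \<le> u" "u < 1" by (rule unit_decomp) blast
  have fl: "\<lfloor>of_int n + u\<rfloor> = n" using t by linarith
  have q: "q (it n x) \<in> F1" using famD[OF assms(2) it_in[OF assms(3)]] .
  have "fragment q x t = of_int n + q (it n x) u" unfolding t(1) by (rule fragment_eq) (use assms t in auto)
  then have "fragment p x (fragment q x t) = of_int n + p (it n x) (q (it n x) u)"
    using fragment_eq[OF assms(1,3), of "q (it n x) u" n] F1_bounds[OF q, of u] t by simp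
  then show ?thesis unfolding fragment_def t(1) fl by simp
qed

lemma fam_comp: assumes "fam p" "fam q" shows "fam (\<lambda>z u. p z (q z u))"
proof (rule famI)
  fix x assume x: "x \<in> S"
  show "(\<lambda>u. p x (q x u)) \<in> F1" using F1_comp[OF famD[OF assms(1) x] famD[OF assms(2) x]] by (simp add: o_def)
  obtain U where U: "openin X U" "x \<in> U" "\<And>y t. y \<in> U \<Longrightarrow> 0 \<le> t \<Longrightarrow> t \<le> 1 \<Longrightarrow> p y t = p x t"
    by (rule fam_local[OF assms(1) x]) blast
  obtain V where V: "openin X V" "x \<in> V" "\<And>y t. y \<in> V \<Longrightarrow> 0 \<le> t \<Longrightarrow> t \<le> 1 \<Longrightarrow> q y t = q x t"
    by (rule fam_local[OF assms(2) x]) blast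
  have "p y (q y t) = p x (q x t)" if "y \<in> U \<inter> V" "0 \<le> t" "t \<le> 1" for y t
    using U(3)[of y "q x t"] V(3)[of y t] that F1_bounds[OF famD[OF assms(2) x], of t] by simp
  then show "\<exists>U. openin X U \<and> x \<in> U \<and> (\<forall>y\<in>U. \<forall>t. 0 \<le> t \<and> t \<le> 1 \<longrightarrow> p y (q y t) = p x (q x t))"
    using openin_Int[OF U(1) V(1)] U(2) V(2) by blast
qed

lemma fam_inv: assumes "fam p" shows "fam (\<lambda>z. rinv (p z))"
proof (rule famI)
  fix x assume x: "x \<in> S"
  show i: "rinv (p x) \<in> F1" by (rule F1_inv[OF famD[OF assms x]])
  obtain U where U: "openin X U" "x \<in> U" "\<And>y t. y \<in> U \<Longrightarrow> 0 \<le> t \<Longrightarrow> t \<le> 1 \<Longrightarrow> p y t = p x t"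
    by (rule fam_local[OF assms(1) x]) blast
  have "rinv (p y) t = rinv (p x) t" if "y \<in> U" "0 \<le> t" "t \<le> 1" for y t
  proof -
    have yS: "y \<in> S" using that U(1) openin_subset by blast
    have "p y (rinv (p x) t) = t"
      using U(3)[of y "rinv (p x) t"] that F1_bounds[OF i, of t] rinv_cancel(2)[OF F1_dpl[OF famD[OF assms x]]] by simp
    then show ?thesis using rinv_cancel(1)[OF F1_dpl[OF famD[OF assms yS]]] by metis
  qed
  then show "\<exists>U. openin X U \<and> x \<in> U \<and> (\<forall>y\<in>U. \<forall>t. 0 \<le> t \<and> t \<le> 1 \<longrightarrow> rinv (p y) t = rinv (p x) t)"
    using U by blast
qed

lemma fragment_id: "fragment (\<lambda>z u. u) x t = t" by (simp add: fragment_def)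

lemma fragment_mono: assumes "fam p" "x \<in> S" shows "strict_mono (fragment p x)"
proof (rule strict_monoI)
  fix s t :: real assume st: "s < t"
  obtain n u where s: "s = of_int n + u" "0 \<le> u" "u < 1" by (rule unit_decomp) blast
  obtain m v where t: "t = of_int m + v" "0 \<le> v" "v < 1" by (rule unit_decomp) blast
  have p: "p (it k x) \<in> F1" for k using famD[OF assms(1) it_in[OF assms(2)]] .
  have fs: "fragment p x s = of_int n + p (it n x) u" and ft: "fragment p x t = of_int m + p (it m x) v"
    unfolding s(1) t(1) by (rule fragment_eq; use assms s t in simp)+
  have "n \<le> m" using st s t by linarith
  then consider "n = m" | "of_int n + 1 \<le> (of_int m :: real)" by linarith
  then show "fragment p x s < fragment p x t"
  proof cases
    case 1
    moreover have "strict_mono (p (it m x))" using p[of m] by (simp add: F1_def dpl_def)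
    ultimately show ?thesis unfolding fs ft using st s t by (simp add: strict_mono_less)
  next
    case 2
    then show ?thesis unfolding fs ft using F1_bounds(3)[OF p s(3), of n] F1_bounds(1)[OF p t(2), of m] by linarith
  qed
qed

lemma fragment_surj: assumes "fam p" "x \<in> S" shows "surj (fragment p x)"
proof -
  have "fragment p x (fragment (\<lambda>z. rinv (p z)) x t) = t" for t
  proof -
    have "fragment p x (fragment (\<lambda>z. rinv (p z)) x t) = fragment (\<lambda>z u. p z (rinv (p z) u)) x t"
      by (rule fragment_comp[OF assms(1) fam_inv[OF assms(1)] assms(2)])
    also have "fragment (\<lambda>z u. p z (rinv (p z) u)) x = fragment (\<lambda>z u. u) x"
      by (rule fragment_cong[OF _ assms(2)]) (simp add: rinv_cancel(2) F1_dpl famD[OF assms(1)])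
    finally show ?thesis by (simp add: fragment_id)
  qed
  then show ?thesis by (metis surjI)
qed

lemma fragment_inv: assumes "fam p" "x \<in> S" shows "rinv (fragment p x) = fragment (\<lambda>z. rinv (p z)) x"
proof
  fix t
  have "fragment p x (fragment (\<lambda>z. rinv (p z)) x t) = fragment (\<lambda>z u. p z (rinv (p z) u)) x t"
    by (rule fragment_comp[OF assms(1) fam_inv[OF assms(1)] assms(2)])
  also have "fragment (\<lambda>z u. p z (rinv (p z) u)) x = fragment (\<lambda>z u. u) x"
    by (rule fragment_cong[OF _ assms(2)]) (simp add: rinv_cancel(2) F1_dpl famD[OF assms(1)])
  finally have "fragment p x (fragment (\<lambda>z. rinv (p z)) x t) = t" by (simp add: fragment_id)
  then show "rinv (fragment p x) t = fragment (\<lambda>z. rinv (p z)) x t"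
    by (rule inv_f_eq[OF strict_mono_imp_inj_on[OF fragment_mono[OF assms]]])
qed

text \<open>Inside a unit interval the germ is that of a single member of the family. At an integer
  two different members meet, which is allowed because integers are dyadic.\<close>

lemma fragment_dpl: assumes "fam p" "x \<in> S" shows "dpl (fragment p x)"
proof -
  have p: "dgerm (p (it k x)) u" for k u using famD[OF assms(1) it_in[OF assms(2)]] by (simp add: F1_def dpl_def)
  have "dgerm (fragment p x) t" for t
  proof -
    obtain n u where t: "t = of_int n + u" "0 \<le> u" "u < 1" by (rule unit_decomp) blast
    have e: "fragment p x (s + of_int k) = p (it k x) s + of_int k" if "0 \<le> s" "s \<le> 1" for s k
      using fragment_eq[OF assms that, of k] by (simp add: add.commute)
    show ?thesis
    proof (cases "u = 0")
      case False
      show ?thesis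
      proof (rule dgerm_cong[OF p[of n u]])
        show "0 < min u (1 - u)" using False t(2,3) by simp
        show "fragment p x (s + of_int n) = p (it n x) s + of_int n" if "\<bar>s - u\<bar> < min u (1 - u)" for s
          by (rule e) (use that in linarith)+
        show "t = u + of_int n" using t(1) by simp
      qed
    next
      case True
      define f where "f = (\<lambda>s. p (it (n - 1) x) (s - of_int (n - 1)) + of_int (n - 1))"
      define g where "g = (\<lambda>s. p (it n x) (s - of_int n) + of_int n)"
      have tn: "t = of_int n" using True t by simp
      have ft: "dgerm f t" by (rule dgerm_cong[OF p[of "n - 1" 1] zero_less_one, where c = "n - 1" and d = "n - 1"])
          (simp_all add: f_def tn)
      have gt: "dgerm g t" by (rule dgerm_cong[OF p[of n 0] zero_less_one, where c = n and d = n])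
          (simp_all add: g_def tn)
      have "p (it n x) 0 = 0" "p (it (n - 1) x) 1 = 1"
        using famD[OF assms(1) it_in[OF assms(2)], of n] famD[OF assms(1) it_in[OF assms(2)], of "n - 1"]
        by (simp_all add: F1_def)
      then have fg: "f t = g t" unfolding f_def g_def tn by simp
      have f: "fragment p x s = f s" if "t - 1 < s" "s \<le> t" for s
        using e[of "s - of_int (n - 1)" "n - 1"] that unfolding f_def tn by simp
      have g: "fragment p x s = g s" if "t \<le> s" "s < t + 1" for s
        using e[of "s - of_int n" n] that unfolding g_def tn by simp
      have "t \<in> dyad" unfolding tn by (rule dyad_of_int)
      from dgerm_glue[OF ft gt fg this zero_less_one f g] show ?thesis .
    qed
  qed
  then show ?thesis unfolding dpl_def using fragment_mono[OF assms] fragment_surj[OF assms] by blast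
qed

lemma fragment_lift: assumes "fam p" shows "PL_lift (fragment p)"
proof -
  have "flow_lift (fragment p)"
  proof (rule flow_liftI)
    fix x assume x: "x \<in> S"
    show "strict_mono (fragment p x)" "surj (fragment p x)" using fragment_mono[OF assms x] fragment_surj[OF assms x] by auto
    show "fragment p (\<phi> x) t = fragment p x (t + 1) - 1" for t
      unfolding fragment_def by (simp add: it_phi[OF x])
    fix K :: real
    \<comment> \<open>The window meets finitely many unit intervals, all with index between
      \<open>-N\<close> and \<open>N\<close>, so a finite intersection of preimages of
      neighbourhoods suffices.\<close>
    define N where "N = \<lceil>K\<rceil> + 1"
    have "\<forall>z\<in>S. \<exists>U. openin X U \<and> z \<in> U \<and> (\<forall>y\<in>U. \<forall>t. 0 \<le> t \<and> t \<le> 1 \<longrightarrow> p y t = p z t)"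
      using fam_local[OF assms] by metis
    then obtain U where U: "\<And>z. z \<in> S \<Longrightarrow> openin X (U z)" "\<And>z. z \<in> S \<Longrightarrow> z \<in> U z"
      "\<And>z y t. z \<in> S \<Longrightarrow> y \<in> U z \<Longrightarrow> 0 \<le> t \<Longrightarrow> t \<le> 1 \<Longrightarrow> p y t = p z t" by metis
    define W where "W = (\<Inter>n\<in>{-N..N}. {y \<in> S. it n y \<in> U (it n x)}) \<inter> S"
    have "openin X W"
    proof -
      have "openin X {y \<in> S. it n y \<in> U (it n x)}" for n
        using openin_continuous_map_preimage[OF it_cont] U(1) x by simp
      then show ?thesis unfolding W_def by (cases "{-N..N} = {}") (auto intro!: openin_INT)
    qed
    moreover have "x \<in> W" unfolding W_def using x U(2) by simp
    moreover have "fragment p y t = fragment p x t" if "y \<in> W" "\<bar>t\<bar> \<le> K" for y t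
    proof -
      have "\<lfloor>t\<rfloor> \<in> {-N..N}" using that(2) unfolding N_def by simp linarith
      then have "it \<lfloor>t\<rfloor> y \<in> U (it \<lfloor>t\<rfloor> x)" using that(1) unfolding W_def by blast
      moreover have "0 \<le> t - of_int \<lfloor>t\<rfloor>" "t - of_int \<lfloor>t\<rfloor> \<le> 1" by linarith+
      ultimately show ?thesis unfolding fragment_def using U(3) x by simp
    qed
    ultimately show "\<exists>U. openin X U \<and> x \<in> U \<and> (\<forall>y\<in>U. \<forall>t. \<bar>t\<bar> \<le> K \<longrightarrow> fragment p y t = fragment p x t)" by blast
  qed
  then show ?thesis unfolding PL_lift_def using fragment_dpl[OF assms] by blast
qed

definition over :: "'a set \<Rightarrow> (real \<Rightarrow> real) \<Rightarrow> 'a \<Rightarrow> real \<Rightarrow> real" where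
  "over C f = (\<lambda>z. if z \<in> C then f else (\<lambda>u. u))"

lemma fam_patch:
  assumes "fam p" "fam q" "clop C" shows "fam (\<lambda>z. if z \<in> C then p z else q z)"
proof (rule famI)
  fix x assume x: "x \<in> S"
  show "(if x \<in> C then p x else q x) \<in> F1" using famD x assms by auto
  obtain U where U: "openin X U" "x \<in> U" "\<And>y t. y \<in> U \<Longrightarrow> 0 \<le> t \<Longrightarrow> t \<le> 1 \<Longrightarrow> p y t = p x t"
    by (rule fam_local[OF assms(1) x]) blast
  obtain V where V: "openin X V" "x \<in> V" "\<And>y t. y \<in> V \<Longrightarrow> 0 \<le> t \<Longrightarrow> t \<le> 1 \<Longrightarrow> q y t = q x t"
    by (rule fam_local[OF assms(2) x]) blast
  let ?W = "if x \<in> C then U \<inter> C else V \<inter> (S - C)"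
  have "openin X ?W" using U(1) V(1) assms(3) clop_ops(3)[OF clop_ops(4) assms(3)] by (auto simp: clop_def)
  moreover have "x \<in> ?W" using U(2) V(2) x by auto
  moreover have "(if y \<in> C then p y else q y) t = (if x \<in> C then p x else q x) t" if "y \<in> ?W" "0 \<le> t \<and> t \<le> 1" for y t
    using that U(3)[of y t] V(3)[of y t] by (auto split: if_splits)
  ultimately show "\<exists>U. openin X U \<and> x \<in> U \<and> (\<forall>y\<in>U. \<forall>t. 0 \<le> t \<and> t \<le> 1 \<longrightarrow>
      (if y \<in> C then p y else q y) t = (if x \<in> C then p x else q x) t)" by blast
qed

lemma fam_const: "f \<in> F1 \<Longrightarrow> fam (\<lambda>z. f)"
  by (rule famI) (auto intro: exI[of _ S])

lemma fam_over: "clop C \<Longrightarrow> f \<in> F1 \<Longrightarrow> fam (over C f)"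
  unfolding over_def by (rule fam_patch[OF fam_const fam_const]) (auto simp: F1_id)

end

section \<open>Lifts generated by the rotation and the caret rotations\<close>

context z_system
begin

text \<open>There is no rule for the whole space: it is the complement of
  \<open>C \<inter> (S - C)\<close> for any member \<open>C\<close>, hence present as soon as
  \<open>\<A>\<close> is nonempty.\<close>

inductive_set balg :: "'a set set \<Rightarrow> 'a set set" for \<A> where
  base: "C \<in> \<A> \<Longrightarrow> C \<in> balg \<A>"
| compl: "C \<in> balg \<A> \<Longrightarrow> S - C \<in> balg \<A>"
| inter: "C \<in> balg \<A> \<Longrightarrow> D \<in> balg \<A> \<Longrightarrow> C \<inter> D \<in> balg \<A>"
| shift: "C \<in> balg \<A> \<Longrightarrow> {x \<in> S. it n x \<in> C} \<in> balg \<A>"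

end

text \<open>\<open>G\<close> stands for the lifts of the generated subgroup. Through the listed
  properties the argument takes place on \<open>X \<times> \<real>\<close> without passing to the
  quotient. \<open>G_cong\<close> is there because the values of a lift off
  \<open>topspace X\<close> are arbitrary.\<close>

locale generated_lifts = z_system +
  fixes G :: "('a \<Rightarrow> real \<Rightarrow> real) set" and \<A> :: "'a set set"
  assumes G_comp: "F \<in> G \<Longrightarrow> H \<in> G \<Longrightarrow> (\<lambda>x t. F x (H x t)) \<in> G"
    and G_inv: "F \<in> G \<Longrightarrow> (\<lambda>x. rinv (F x)) \<in> G"
    and G_lift: "F \<in> G \<Longrightarrow> PL_lift F"
    and G_cong: "F \<in> G \<Longrightarrow> (\<And>x. x \<in> S \<Longrightarrow> F x = H x) \<Longrightarrow> H \<in> G"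
    and G_rotation: "(\<lambda>x t. t + 1/4) \<in> G"
    and G_base: "C = S \<or> C \<in> \<A> \<Longrightarrow> fragment (over C (xm 0 1)) \<in> G"
      "C = S \<or> C \<in> \<A> \<Longrightarrow> fragment (over C (xm (1/2) 1)) \<in> G"
    and \<A>_clop: "C \<in> \<A> \<Longrightarrow> clop C"
    and clop_balg: "clop C \<Longrightarrow> C \<in> balg \<A>"
begin

lemma G_id: "(\<lambda>x t. t) \<in> G"
proof (rule G_cong[OF G_comp[OF G_rotation G_inv[OF G_rotation]]])
  fix x assume "x \<in> S"
  have "dpl (\<lambda>t. t + 1/4)" by (rule dpl_translate) simp
  then show "(\<lambda>t. rinv (\<lambda>t. t + 1/4) t + 1/4) = (\<lambda>t. t)" using rinv_cancel(2) by blast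
qed

lemma rinv_translate: "rinv (\<lambda>t. t + c) = (\<lambda>t. t - c)"
proof
  fix t show "rinv (\<lambda>t. t + c) t = t - c" by (rule inv_f_eq) (auto simp: inj_def)
qed

lemma G_rot_nat: "(\<lambda>x t. t + real n / 4) \<in> G"
proof (induction n)
  case 0
  then show ?case using G_id by simp
next
  case (Suc n)
  have "(\<lambda>x t. t + real n / 4 + 1/4) \<in> G" using G_comp[OF G_rotation Suc.IH] .
  moreover have "t + real n / 4 + 1/4 = t + real (Suc n) / 4" for t by simp
  ultimately show ?case by (simp only:)
qed

lemma G_rot: "(\<lambda>x t. t + of_int k / 4) \<in> G"
proof (cases "k \<ge> 0")
  case True
  then have "real_of_int k = real (nat k)" by simp
  then show ?thesis using G_rot_nat[of "nat k"] by (simp only:)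
next
  case False
  have "(\<lambda>x t. t - real (nat (-k)) / 4) \<in> G"
    using G_inv[OF G_rot_nat[of "nat (-k)"]] by (simp only: rinv_translate)
  moreover have "t - real (nat (-k)) / 4 = t + of_int k / 4" for t using False by simp
  ultimately show ?thesis by (simp only:)
qed

definition GF :: "('a \<Rightarrow> real \<Rightarrow> real) set" where
  "GF = {p. fam p \<and> fragment p \<in> G}"

lemma GF_comp: "p \<in> GF \<Longrightarrow> q \<in> GF \<Longrightarrow> (\<lambda>z u. p z (q z u)) \<in> GF"
  unfolding GF_def using fam_comp by (auto intro: G_cong[OF G_comp] simp: fragment_comp)

lemma GF_inv: "p \<in> GF \<Longrightarrow> (\<lambda>z. rinv (p z)) \<in> GF"
  unfolding GF_def using fam_inv by (auto intro: G_cong[OF G_inv] simp: fragment_inv)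

lemma GF_cong:
  assumes "p \<in> GF" "fam q" "\<And>z u. z \<in> S \<Longrightarrow> 0 \<le> u \<Longrightarrow> u < 1 \<Longrightarrow> p z u = q z u" shows "q \<in> GF"
proof -
  have "fragment q \<in> G"
    by (rule G_cong[of "fragment p"]) (use assms(1) in \<open>auto simp: GF_def intro!: fragment_cong assms(3)\<close>)
  then show ?thesis using assms(2) by (simp add: GF_def)
qed

lemma GF_id: "(\<lambda>z u. u) \<in> GF"
proof -
  have "fragment (\<lambda>z u. u) = (\<lambda>x t. t)" by (simp add: fragment_id fun_eq_iff)
  then show ?thesis unfolding GF_def using fam_const[OF F1_id] G_id by simp
qed

text \<open>The part of Thompson's group that is available over \<open>C\<close>: a subgroup, and by
  \<open>Q_conj\<close> a normal one. The aim is that it be all of \<open>F1\<close> for every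
  clopen \<open>C\<close>.\<close>

definition Q :: "'a set \<Rightarrow> (real \<Rightarrow> real) set" where
  "Q C = {f \<in> F1. over C f \<in> GF}"

lemma QI: assumes "clop C" "f \<in> F1" "p \<in> GF" "\<And>z u. z \<in> S \<Longrightarrow> 0 \<le> u \<Longrightarrow> u < 1 \<Longrightarrow> p z u = over C f z u"
  shows "f \<in> Q C"
  unfolding Q_def using GF_cong[OF assms(3) fam_over[OF assms(1,2)]] assms(2,4) by simp

lemma Q_F1: "f \<in> Q C \<Longrightarrow> f \<in> F1" by (simp add: Q_def)
lemma Q_GF: "f \<in> Q C \<Longrightarrow> over C f \<in> GF" by (simp add: Q_def)
lemma Q_dpl: "f \<in> Q C \<Longrightarrow> dpl f" by (simp add: Q_def F1_def)

lemma Q_id: "clop C \<Longrightarrow> (\<lambda>t. t) \<in> Q C"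
  by (rule QI[OF _ F1_id GF_id]) (auto simp: over_def)

lemma Q_comp: assumes "clop C" "f \<in> Q C" "g \<in> Q C" shows "f \<circ> g \<in> Q C"
  by (rule QI[OF assms(1) F1_comp[OF Q_F1[OF assms(2)] Q_F1[OF assms(3)]]
        GF_comp[OF Q_GF[OF assms(2)] Q_GF[OF assms(3)]]]) (simp add: over_def)

lemma Q_inv: assumes "clop C" "f \<in> Q C" shows "rinv f \<in> Q C"
  by (rule QI[OF assms(1) F1_inv[OF Q_F1[OF assms(2)]] GF_inv[OF Q_GF[OF assms(2)]]])
    (simp add: over_def)

lemma Q_cong:
  assumes "clop C" "f \<in> Q C" "g \<in> F1" "\<And>u. 0 \<le> u \<Longrightarrow> u < 1 \<Longrightarrow> f u = g u" shows "g \<in> Q C"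
  by (rule QI[OF assms(1,3) Q_GF[OF assms(2)]]) (use assms(4) in \<open>simp add: over_def\<close>)

definition saturated :: "'a set \<Rightarrow> bool" where "saturated C \<longleftrightarrow> clop C \<and> Q C = F1"

text \<open>\<open>F1_generated\<close> leaves only the two caret rotations to be found, since
  membership in \<open>Q C\<close> depends on a map of \<open>F1\<close> only through the unit
  interval.\<close>

lemma saturatedI:
  assumes "clop C" "xm 0 1 \<in> Q C" "xm (1/2) 1 \<in> Q C" shows "saturated C"
proof -
  have x: "f \<in> Q C" if "f \<in> xgen" for f using that
    by (induction rule: xgen.induct) (blast intro: Q_id Q_comp Q_inv assms)+
  have "f \<in> Q C" if f: "f \<in> F1" for f
  proof -
    obtain g where "g \<in> xgen" "\<forall>t. 0 \<le> t \<and> t \<le> 1 \<longrightarrow> f t = g t" using F1_generated[OF f] by blast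
    then show ?thesis by (intro Q_cong[OF assms(1) x[of g] f]) auto
  qed
  then show ?thesis unfolding saturated_def using assms(1) Q_F1 by blast
qed

lemma saturatedD: "saturated C \<Longrightarrow> f \<in> F1 \<Longrightarrow> f \<in> Q C" "saturated C \<Longrightarrow> clop C" "saturated C \<Longrightarrow> f \<in> F1 \<Longrightarrow> over C f \<in> GF"
  by (auto simp: saturated_def Q_def)

lemma xm_F1: "xm 0 1 \<in> F1" "xm (1/2) 1 \<in> F1"
  by (auto intro!: F1_xm)

lemma saturated_base: assumes "C = S \<or> C \<in> \<A>" shows "saturated C"
proof -
  have c: "clop C" using assms \<A>_clop clop_ops(4) by blast
  show ?thesis
    by (rule saturatedI[OF c]; unfold Q_def GF_def) (use G_base[OF assms] xm_F1 fam_over[OF c] in auto)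
qed

text \<open>The conjugating element is \<open>h\<close> over the whole space, which is among the
  generated lifts; off \<open>C\<close> its two copies cancel.\<close>

lemma Q_conj:
  assumes "clop C" "f \<in> Q C" "h \<in> F1" shows "h \<circ> f \<circ> rinv h \<in> Q C"
proof (rule QI[OF assms(1)])
  show "h \<circ> f \<circ> rinv h \<in> F1" by (intro F1_comp F1_inv assms(3) Q_F1[OF assms(2)])
  have h: "over S h \<in> GF" by (rule saturatedD(3)[OF saturated_base[of S] assms(3)]) simp
  show "(\<lambda>z u. over S h z (over C f z (rinv (over S h z) u))) \<in> GF"
    by (rule GF_comp[OF h GF_comp[OF Q_GF[OF assms(2)] GF_inv[OF h]]])
  show "over S h z (over C f z (rinv (over S h z) u)) = over C (h \<circ> f \<circ> rinv h) z u" if "z \<in> S" for z u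
    using that rinv_cancel(2)[OF F1_dpl[OF assms(3)]] by (simp add: over_def)
qed

text \<open>Over the complement, \<open>f\<close> is the product of \<open>f\<close> over the whole
  space and the inverse of \<open>f\<close> over \<open>C\<close>.\<close>

lemma saturated_compl: assumes "saturated C" shows "saturated (S - C)"
proof -
  have c: "clop (S - C)" by (rule clop_ops(3)[OF clop_ops(4) saturatedD(2)[OF assms]])
  have "f \<in> Q (S - C)" if f: "f \<in> F1" for f
  proof (rule QI[OF c f])
    have "over S f \<in> GF" by (rule saturatedD(3)[OF saturated_base[of S] f]) simp
    then show "(\<lambda>z u. over S f z (rinv (over C f z) u)) \<in> GF" by (rule GF_comp[OF _ GF_inv[OF saturatedD(3)[OF assms f]]])
    show "over S f z (rinv (over C f z) u) = over (S - C) f z u" if "z \<in> S" for z u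
      using that rinv_cancel(2)[OF F1_dpl[OF f]] by (simp add: over_def)
  qed
  then show ?thesis using saturatedI[OF c] xm_F1 by blast
qed

lemma fragment_unit: assumes "0 \<le> u" "u < 1" shows "fragment p x (of_int n + u) = of_int n + p (it n x) u"
proof -
  have "\<lfloor>of_int n + u\<rfloor> = n" using assms by linarith
  then show ?thesis unfolding fragment_def by simp
qed

text \<open>Conjugation by the flow through time \<open>n\<close>, that is by \<open>4 * n\<close>
  quarter rotations, replaces \<open>C\<close> by its preimage under \<open>it n\<close>.\<close>

lemma saturated_shift: assumes "saturated C" shows "saturated {x \<in> S. it n x \<in> C}"
proof -
  let ?D = "{x \<in> S. it n x \<in> C}"
  have c: "clop ?D" by (rule clop_it[OF saturatedD(2)[OF assms]])
  have "f \<in> Q ?D" if f: "f \<in> F1" for f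
  proof -
    have "fragment (over C f) \<in> G" using saturatedD(3)[OF assms f] by (simp add: GF_def)
    from G_comp[OF G_comp[OF G_rot[of "- 4 * n"] this] G_rot[of "4 * n"]]
    have "(\<lambda>x t. fragment (over C f) x (t + of_int n) - of_int n) \<in> G" by simp
    then have "fragment (over ?D f) \<in> G"
    proof (rule G_cong)
      fix x assume x: "x \<in> S"
      show "(\<lambda>t. fragment (over C f) x (t + of_int n) - of_int n) = fragment (over ?D f) x"
      proof
        fix t :: real
        have "it n (it \<lfloor>t\<rfloor> x) = it (\<lfloor>t\<rfloor> + n) x" using it_add[OF x, of n "\<lfloor>t\<rfloor>"] by (simp add: add.commute)
        then show "fragment (over C f) x (t + of_int n) - of_int n = fragment (over ?D f) x t"
          unfolding fragment_def over_def using x by simp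
      qed
    qed
    then show ?thesis unfolding Q_def GF_def using f fam_over[OF c f] by simp
  qed
  then show ?thesis using saturatedI[OF c] xm_F1 by blast
qed

text \<open>Reduces carets that touch the boundary of \<open>[0, 1]\<close> to carets in the interior.\<close>

lemma Q_quarter:
  assumes c: "clop C" and ab: "0 \<le> a" "a < b" "b \<le> 3/4" "a \<in> dyad" "b \<in> dyad"
  shows "xm a b \<in> Q C \<longleftrightarrow> xm (a + 1/4) (b + 1/4) \<in> Q C"
proof -
  let ?f = "xm a b" and ?g = "xm (a + 1/4) (b + 1/4)"
  have F: "?f \<in> F1" "?g \<in> F1" using ab by (auto intro!: F1_xm dyad_add)
  have g: "?g u = ?f (u - 1/4) + 1/4" for u
    using xm_shift[of a "1/4" b "u - 1/4"] by simp
  have k: "fragment (over C ?g) x (t + 1/4) = fragment (over C ?f) x t + 1/4" for x t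
  proof -
    obtain n u where t: "t = of_int n + u" "0 \<le> u" "u < 1" by (rule unit_decomp) blast
    show ?thesis
    proof (cases "u < 3/4")
      case True
      have "fragment (over C ?g) x (of_int n + (u + 1/4)) = of_int n + over C ?g (it n x) (u + 1/4)"
        by (rule fragment_unit) (use t True in auto)
      then show ?thesis using fragment_unit[OF t(2,3), of "over C ?f" x n] unfolding t(1)
        by (simp add: over_def g add.assoc)
    next
      \<comment> \<open>Adding a quarter crosses into the next unit interval. There
        \<open>?g\<close> fixes \<open>u - 3/4\<close>, which is below \<open>a + 1/4\<close>, and
        \<open>?f\<close> fixes \<open>u\<close>, which is at least \<open>b\<close>; both sides are
        \<open>t + 1/4\<close>.\<close>
      case False
      have "fragment (over C ?g) x (of_int (n + 1) + (u - 3/4)) = of_int (n + 1) + over C ?g (it (n + 1) x) (u - 3/4)"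
        by (rule fragment_unit) (use t False in auto)
      moreover have "?g (u - 3/4) = u - 3/4" "?f u = u" using ab t False by (auto intro!: xm_outside)
      moreover have "of_int (n + 1) + (u - 3/4) = t + 1/4" using t(1) by simp
      moreover have "over C ?g (it (n + 1) x) (u - 3/4) = u - 3/4" using calculation(2) by (simp add: over_def)
      ultimately have "fragment (over C ?g) x (t + 1/4) = t + 1/4" by (simp only:)
      moreover have "fragment (over C ?f) x t = t"
        using fragment_unit[OF t(2,3), of "over C ?f" x n] t(1) \<open>?f u = u\<close> by (simp add: over_def)
      ultimately show ?thesis by simp
    qed
  qed
  have m: "(\<lambda>x t. t + of_int (-1) / 4) \<in> G" by (rule G_rot)
  have "fragment (over C ?g) \<in> G" if "fragment (over C ?f) \<in> G"
  proof (rule G_cong[OF G_comp[OF G_rotation G_comp[OF that m]]])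
    fix x show "(\<lambda>t. fragment (over C ?f) x (t + of_int (-1) / 4) + 1/4) = fragment (over C ?g) x"
      using k[of x "t - 1/4" for t] by (auto simp: fun_eq_iff)
  qed
  moreover have "fragment (over C ?f) \<in> G" if "fragment (over C ?g) \<in> G"
  proof (rule G_cong[OF G_comp[OF m G_comp[OF that G_rotation]]])
    fix x show "(\<lambda>t. fragment (over C ?g) x (t + 1/4) + of_int (-1) / 4) = fragment (over C ?f) x"
      using k by (auto simp: fun_eq_iff)
  qed
  ultimately show ?thesis unfolding Q_def GF_def using F fam_over[OF c] by auto
qed

text \<open>Over a point of just one of the two sets, one factor is the identity and the other
  cancels against its inverse.\<close>

lemma Q_commutator:
  assumes "saturated C" "saturated D" "f \<in> F1" "h \<in> F1"
  shows "f \<circ> h \<circ> rinv f \<circ> rinv h \<in> Q (C \<inter> D)"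
proof (rule QI)
  show "clop (C \<inter> D)" by (rule clop_ops(1)[OF saturatedD(2)[OF assms(1)] saturatedD(2)[OF assms(2)]])
  show "f \<circ> h \<circ> rinv f \<circ> rinv h \<in> F1" by (intro F1_comp F1_inv assms)
  note p = saturatedD(3)[OF assms(1,3)] and q = saturatedD(3)[OF assms(2,4)]
  show "(\<lambda>z u. over C f z (over D h z (rinv (over C f z) (rinv (over D h z) u)))) \<in> GF"
    by (rule GF_comp[OF p GF_comp[OF q GF_comp[OF GF_inv[OF p] GF_inv[OF q]]]])
  show "over C f z (over D h z (rinv (over C f z) (rinv (over D h z) u))) = over (C \<inter> D) (f \<circ> h \<circ> rinv f \<circ> rinv h) z u"
    for z u
    using rinv_cancel(2)[OF F1_dpl[OF assms(3)]] rinv_cancel(2)[OF F1_dpl[OF assms(4)]]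
    by (cases "z \<in> C"; cases "z \<in> D") (simp_all add: over_def)
qed

text \<open>As \<open>Q (C \<inter> D)\<close> is normal and contains all commutators, the quotient
  of \<open>F1\<close> by it is abelian and conjugate elements coincide there. This kills the
  interior rotation \<open>y\<close>. Quarter rotations then yield both halves of the unit interval,
  and the pentagon relation on \<open>[0, 1]\<close> yields the whole.\<close>

lemma saturated_inter: assumes "saturated C" "saturated D" shows "saturated (C \<inter> D)"
proof -
  let ?E = "C \<inter> D"
  have c: "clop ?E" by (rule clop_ops(1)[OF saturatedD(2)[OF assms(1)] saturatedD(2)[OF assms(2)]])
  define y where "y = xm (1/4) (3/4)"
  define yL where "yL = xm (1/4) (1/2)"
  define yR where "yR = xm (1/2) (3/4)"
  \<comment> \<open>\<open>a\<close> maps \<open>[1/4, 3/4]\<close> affinely onto its left half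
    \<open>[1/4, 1/2]\<close>, and \<open>d\<close> maps the right half \<open>[1/2, 3/4]\<close>
    affinely onto \<open>[1/4, 3/4]\<close>.\<close>
  define a where "a = bump (1/4) (1/4)"
  define d where "d = bump 0 (1/4)"
  have F: "y \<in> F1" "a \<in> F1" "d \<in> F1" unfolding y_def a_def d_def by (auto intro!: F1_xm F1_bump)
  note D = F1_dpl[OF F(1)] F1_dpl[OF F(2)] F1_dpl[OF F(3)]
  \<comment> \<open>\<open>yL\<close> and \<open>yR\<close> are conjugate to \<open>y\<close>, so the pentagon relation \<open>y y = yR y yL\<close> reads \<open>y = 2 y\<close> modulo
    commutators.\<close>
  have pent: "y (y t) = yR (y (yL t))" for t
    using fun_cong[OF xm_pentagon[of "1/4" "3/4"], of t] unfolding y_def yL_def yR_def by simp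
  have sm: "strict_mono a" "strict_mono d" using D(2,3) unfolding dpl_def by blast+
  have aL: "a (y t) = yL (a t)" for t
    unfolding y_def yL_def
  proof (rule xm_conj[OF sm(1), where k = "1/2"])
    fix t :: real assume "1/4 \<le> t" "t \<le> 3/4"
    then have "a t = (t + 1/4) / 2" unfolding a_def by (intro bump_pieces(1)) auto
    then show "a t = 1/4 + 1/2 * (t - 1/4)" by (simp add: field_simps)
  qed simp_all
  have dR: "d (yR t) = y (d t)" for t
    unfolding y_def yR_def
  proof (rule xm_conj[OF sm(2), where k = 2])
    fix t :: real assume "1/2 \<le> t" "t \<le> 3/4"
    then have "d t = 2 * t - (0 + 3 * (1/4))" unfolding d_def by (intro bump_pieces(2)) auto
    then show "d t = 1/4 + 2 * (t - 1/2)" by simp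
  qed simp_all
  define b where "b = rinv d"
  have Fb: "b \<in> F1" unfolding b_def by (rule F1_inv[OF F(3)])
  \<comment> \<open>\<open>b\<close> conjugates \<open>y\<close> to \<open>yR\<close>, so this
    commutator equals \<open>rinv y \<circ> yR\<close>.\<close>
  define k where "k = rinv y \<circ> b \<circ> rinv (rinv y) \<circ> rinv b"
  have k: "k \<in> Q ?E" unfolding k_def by (rule Q_commutator[OF assms F1_inv[OF F(1)] Fb])
  have kt: "k t = rinv y (yR t)" for t
  proof -
    have "b (y (rinv b t)) = yR t"
      unfolding b_def rinv_rinv[OF D(3)] dR[symmetric] by (rule rinv_cancel(1)[OF D(3)])
    then show ?thesis unfolding k_def rinv_rinv[OF D(1)] by simp
  qed
  \<comment> \<open>The pentagon relation solved for \<open>yL\<close>, which turns out to be a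
    conjugate of \<open>rinv k\<close>.\<close>
  have e: "yL t = (rinv y \<circ> rinv k \<circ> rinv (rinv y)) t" for t
  proof -
    have "k (y (yL t)) = y t"
      unfolding kt pent[symmetric] by (rule rinv_cancel(1)[OF D(1)])
    then have "rinv k (y t) = y (yL t)" using rinv_cancel(1)[OF Q_dpl[OF k], of "y (yL t)"] by (simp only:)
    then show ?thesis unfolding rinv_rinv[OF D(1)] comp_apply by (simp only: rinv_cancel(1)[OF D(1)])
  qed
  have "rinv y \<circ> rinv k \<circ> rinv (rinv y) \<in> Q ?E" by (rule Q_conj[OF c Q_inv[OF c k] F1_inv[OF F(1)]])
  moreover have "yL = rinv y \<circ> rinv k \<circ> rinv (rinv y)" by (rule ext) (rule e)
  ultimately have yL: "yL \<in> Q ?E" by (simp only:)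
  have "rinv a \<circ> yL \<circ> rinv (rinv a) \<in> Q ?E" by (rule Q_conj[OF c yL F1_inv[OF F(2)]])
  moreover have "rinv a \<circ> yL \<circ> rinv (rinv a) = y"
    unfolding rinv_rinv[OF D(2)]
    by (rule ext) (simp only: comp_apply aL[symmetric] rinv_cancel(1)[OF D(2)])
  ultimately have y: "y \<in> Q ?E" by (simp only:)
  have xR: "xm (1/2) 1 \<in> Q ?E"
    using y Q_quarter[OF c, of "1/4" "3/4"] unfolding y_def by auto
  have xL: "xm 0 (1/2) \<in> Q ?E"
    using y Q_quarter[OF c, of 0 "1/2"] unfolding y_def by auto
  define x where "x = xm 0 1"
  have Fx: "x \<in> F1" unfolding x_def by (rule xm_F1)
  \<comment> \<open>The pentagon relation on \<open>[0, 1]\<close>, solved for one of the two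
    factors \<open>x\<close> on its left side.\<close>
  have "rinv x \<circ> xm (1/2) 1 \<circ> rinv (rinv x) \<in> Q ?E" by (rule Q_conj[OF c xR F1_inv[OF Fx]])
  then have "rinv x \<circ> xm (1/2) 1 \<circ> rinv (rinv x) \<circ> xm 0 (1/2) \<in> Q ?E" by (rule Q_comp[OF c _ xL])
  moreover have "rinv x \<circ> xm (1/2) 1 \<circ> rinv (rinv x) \<circ> xm 0 (1/2) = x"
  proof
    fix t
    have "x (x t) = xm (1/2) 1 (x (xm 0 (1/2) t))"
      using fun_cong[OF xm_pentagon[of 0 1], of t] unfolding x_def by simp
    then show "(rinv x \<circ> xm (1/2) 1 \<circ> rinv (rinv x) \<circ> xm 0 (1/2)) t = x t"
      unfolding rinv_rinv[OF F1_dpl[OF Fx]] using rinv_cancel(1)[OF F1_dpl[OF Fx], of "x t"]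
      by (simp only: comp_apply)
  qed
  ultimately have "x \<in> Q ?E" by (simp only:)
  then have "xm 0 1 \<in> Q ?E" unfolding x_def .
  then show ?thesis by (rule saturatedI[OF c _ xR])
qed

lemma saturated_all: assumes "clop C" shows "saturated C"
  using clop_balg[OF assms]
  by (induction rule: balg.induct) (auto intro: saturated_base saturated_compl saturated_inter saturated_shift)

text \<open>By local constancy and compactness the family takes finitely many values on clopen sets.
  Each new set is freed from the union already treated, so its factor acts only where the product so
  far is trivial.\<close>

lemma fam_GF: assumes "fam p" shows "p \<in> GF"
proof -
  define v where "v = (\<lambda>x. \<lambda>t\<in>{0..1}. p x t)"
  have v: "loc_const v" using assms unfolding fam_def v_def by blast
  define U where "U x = {y \<in> S. v y = v x}" for x
  have cU: "clop (U x)" for x unfolding U_def by (rule clop_level[OF v])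
  have pU: "p y t = p x t" if "y \<in> U x" "0 \<le> t" "t \<le> 1" for x y t
  proof -
    have "v y = v x" using that unfolding U_def by blast
    from fun_cong[OF this, of t] show ?thesis using that unfolding v_def by simp
  qed
  obtain P where P: "finite P" "P \<subseteq> S" "S \<subseteq> (\<Union>x\<in>P. U x)"
  proof (rule compact_points[of U])
    fix x assume "x \<in> S"
    then show "openin X (U x) \<and> x \<in> U x" using cU unfolding clop_def by (auto simp: U_def)
  qed blast
  have "clop (\<Union>x\<in>P'. U x) \<and> (\<lambda>z. if z \<in> (\<Union>x\<in>P'. U x) then p z else (\<lambda>u. u)) \<in> GF" if "finite P'" "P' \<subseteq> S" for P'
    using that
  proof (induction P' rule: finite_induct)
    case empty
    then show ?case using GF_id clop_ops(5) by simp
  next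
    case (insert x P')
    let ?E = "\<Union>x\<in>P'. U x"
    have IH: "clop ?E" "(\<lambda>z. if z \<in> ?E then p z else (\<lambda>u. u)) \<in> GF" using insert by auto
    have c: "clop (U x \<union> ?E)" by (rule clop_ops(2)[OF cU IH(1)])
    have cd: "clop (U x - ?E)" by (rule clop_ops(3)[OF cU IH(1)])
    have "over (U x - ?E) (p x) \<in> GF"
      by (rule saturatedD(3)[OF saturated_all[OF cd] famD[OF assms]]) (use insert in auto)
    from GF_comp[OF this IH(2)]
    have "(\<lambda>z. if z \<in> U x \<union> ?E then p z else (\<lambda>u. u)) \<in> GF"
    proof (rule GF_cong)
      show "fam (\<lambda>z. if z \<in> U x \<union> ?E then p z else (\<lambda>u. u))"
        by (rule fam_patch[OF assms fam_const[OF F1_id] c])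
      fix z and u :: real assume "z \<in> S" "0 \<le> u" "u < 1"
      then show "over (U x - ?E) (p x) z ((if z \<in> ?E then p z else (\<lambda>u. u)) u) =
          (if z \<in> U x \<union> ?E then p z else (\<lambda>u. u)) u"
        using pU[of z x u] by (auto simp: over_def)
    qed
    then show ?case using c by simp
  qed
  from this[OF P(1,2)] have "(\<lambda>z. if z \<in> (\<Union>x\<in>P. U x) then p z else (\<lambda>u. u)) \<in> GF" by blast
  then show ?thesis by (rule GF_cong[OF _ assms]) (use P(3) in auto)
qed

section \<open>Reduction to lifts that fix zero\<close>

text \<open>Equivariance turns the common fixed point 0 into fixed integers; hence \<open>F\<close>
  preserves unit intervals, is a family there, and equals its own fragment.\<close>

lemma G_fixing_zero:
  assumes "PL_lift F" "\<And>x. x \<in> S \<Longrightarrow> F x 0 = 0" shows "F \<in> G"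
proof -
  have sl: "flow_lift F" using assms(1) by (simp add: PL_lift_def)
  have "fam F"
  proof (rule famI)
    fix x assume x: "x \<in> S"
    have "F x 1 = 1" using flow_lift_phi[OF sl x, of 0] assms(2)[OF phi_in[OF x]] by simp
    then show "F x \<in> F1" using assms x by (simp add: F1_def PL_lift_def)
    obtain U where U: "openin X U" "x \<in> U" "\<And>y t. y \<in> U \<Longrightarrow> \<bar>t\<bar> \<le> 1 \<Longrightarrow> F y t = F x t"
      by (rule flow_lift_local[OF sl x, where K = 1]) blast
    then show "\<exists>U. openin X U \<and> x \<in> U \<and> (\<forall>y\<in>U. \<forall>t. 0 \<le> t \<and> t \<le> 1 \<longrightarrow> F y t = F x t)"
      by (intro exI[of _ U] conjI ballI allI impI U(3)) auto
  qed
  then have "fragment F \<in> G" using fam_GF by (simp add: GF_def)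
  then show ?thesis
  proof (rule G_cong)
    fix x assume x: "x \<in> S"
    show "fragment F x = F x" unfolding fragment_def using flow_lift_it[OF sl x] by (simp add: fun_eq_iff)
  qed
qed

lemma PL_lift_zero_dyad: "PL_lift F \<Longrightarrow> x \<in> S \<Longrightarrow> F x 0 \<in> dyad"
  unfolding PL_lift_def using dpl_dyad_iff by auto

lemma loc_const_zero: assumes "flow_lift F" shows "loc_const (\<lambda>x. F x 0)"
  unfolding loc_const_def
proof
  fix x assume x: "x \<in> S"
  obtain U where U: "openin X U" "x \<in> U" "\<And>y t. y \<in> U \<Longrightarrow> \<bar>t\<bar> \<le> 0 \<Longrightarrow> F y t = F x t"
    by (rule flow_lift_local[OF assms x, where K = 0]) blast
  then show "\<exists>U. openin X U \<and> x \<in> U \<and> (\<forall>y\<in>U. F y 0 = F x 0)"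
    by (intro exI[of _ U] conjI ballI U(3)) auto
qed

text \<open>The curve \<open>x \<mapsto> F x 0\<close> is pushed down to zero, one step of size \<open>1 / 2 ^ q\<close> at a time, at the
  places where it is maximal: there its translates by the flow leave enough room below it.\<close>

lemma G_descent:
  assumes q: "2 \<le> q"
  shows "PL_lift F \<Longrightarrow> (\<And>x. x \<in> S \<Longrightarrow> \<exists>j\<le>n. F x 0 = real j / 2 ^ q) \<Longrightarrow> F \<in> G"
proof (induction n arbitrary: F)
  case 0
  then show ?case by (intro G_fixing_zero) auto
next
  case (Suc n)
  have sl: "flow_lift F" using Suc.prems(1) by (simp add: PL_lift_def)
  define \<delta> where "\<delta> = 1 / (2::real) ^ q"
  have "(2::real) ^ 2 \<le> 2 ^ q" using q by (intro power_increasing) auto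
  then have \<delta>: "0 < \<delta>" "\<delta> \<le> 1/4" "\<delta> \<in> dyad" unfolding \<delta>_def by (auto simp: field_simps)
  define M where "M = real (Suc n) * \<delta>"
  define k where "k = \<lfloor>4 * (M - 2 * \<delta>)\<rfloor>"
  define c where "c = M - 2 * \<delta> - of_int k / 4"
  have "of_int k \<le> 4 * (M - 2 * \<delta>)" "4 * (M - 2 * \<delta>) < of_int k + 1" unfolding k_def by simp_all
  then have c: "0 \<le> c" "c < 1/4" unfolding c_def by simp_all
  have cd: "c \<in> dyad" unfolding c_def M_def using \<delta>(3) dyad_of_int[of "int (Suc n)"] dyad_half(2)[OF dyad_of_int[of k]]
    by (auto intro!: dyad_diff dyad_mult simp del: of_nat_Suc)
  have bF: "bump c \<delta> \<in> F1" by (rule F1_bump) (use c \<delta> cd in auto)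
  define D where "D = {x \<in> S. F x 0 = M}"
  have D: "clop D" unfolding D_def by (rule clop_level[OF loc_const_zero[OF sl]])
  \<comment> \<open>Over \<open>D\<close> the bump sends \<open>c + 2 * \<delta>\<close> to
    \<open>c + \<delta>\<close>, so \<open>H\<close> lowers the value \<open>M\<close> by exactly
    \<open>\<delta>\<close>.\<close>
  define H where "H = (\<lambda>x t. fragment (over D (bump c \<delta>)) x (t + of_int (- k) / 4) + of_int k / 4)"
  have "fragment (over D (bump c \<delta>)) \<in> G" using saturatedD(3)[OF saturated_all[OF D] bF] by (simp add: GF_def)
  then have HG: "H \<in> G" unfolding H_def by (rule G_comp[OF G_rot G_comp[OF _ G_rot]])
  have HF: "PL_lift (\<lambda>x t. H x (F x t))" by (rule PL_lift_comp[OF G_lift[OF HG] Suc.prems(1)])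
  have val: "\<exists>j\<le>Suc n. F x 0 = real j * \<delta>" if "x \<in> S" for x
    using Suc.prems(2)[OF that] unfolding \<delta>_def by simp
  have "(\<lambda>x t. H x (F x t)) \<in> G"
  proof (rule Suc.IH[OF HF])
    fix x assume x: "x \<in> S"
    obtain j where j: "j \<le> Suc n" "F x 0 = real j * \<delta>" using val[OF x] by blast
    have jM: "F x 0 \<le> M" unfolding j(2) M_def using j(1) \<delta>(1) by (intro mult_right_mono) auto
    define w where "w = F x 0 - of_int k / 4"
    \<comment> \<open>In the rotated picture the curve passes at height \<open>u\<close> over
      \<open>it m x\<close>. This point may lie in \<open>D\<close> even if \<open>x\<close> does
      not, and then the bump must be shown to fix \<open>u\<close>.\<close>
    obtain m u where w: "w = of_int m + u" "0 \<le> u" "u < 1" by (rule unit_decomp) blast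
    have "H x (F x 0) = fragment (over D (bump c \<delta>)) x (of_int m + u) + of_int k / 4"
      unfolding H_def w(1)[symmetric] w_def by simp
    then have Hx: "H x (F x 0) = of_int m + over D (bump c \<delta>) (it m x) u + of_int k / 4"
      using fragment_unit[OF w(2,3)] by simp
    have uM: "u = F x 0 - of_int m - M + (c + 2 * \<delta>)" using w(1) unfolding w_def c_def by simp
    have m0: "m = 0" if "F x 0 = M"
    proof -
      have "w = c + 2 * \<delta>" using that unfolding w_def c_def by simp
      then have "0 \<le> w" "w < 1" using c \<delta> by linarith+
      then show ?thesis using w by linarith
    qed
    show "\<exists>j\<le>n. H x (F x 0) = real j / 2 ^ q"
    proof (cases "F x 0 = M")
      case True
      then have "x \<in> D" using x by (simp add: D_def)
      moreover have "u = c + 2 * \<delta>" using uM m0[OF True] True by simp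
      moreover have "bump c \<delta> (c + 2 * \<delta>) = c + \<delta>" using bump_pieces(1)[OF \<delta>(1), of c "c + 2 * \<delta>"] \<delta>(1) by simp
      ultimately have "H x (F x 0) = c + \<delta> + of_int k / 4" using Hx m0[OF True] by (simp add: over_def)
      also have "\<dots> = real n * \<delta>" unfolding c_def M_def by (simp add: algebra_simps)
      finally show ?thesis unfolding \<delta>_def by auto
    next
      case False
      have "over D (bump c \<delta>) (it m x) u = u"
      proof (cases "it m x \<in> D")
        case True
        then have Fm: "F x (of_int m) = M + of_int m" using flow_lift_it[OF sl x, of m 0] by (simp add: D_def)
        have "m \<noteq> 0" using True False by (auto simp: D_def)
        then consider "m \<ge> 1" | "m \<le> -1" by linarith
        \<comment> \<open>For \<open>m \<ge> 1\<close> the curve passes below the bump. For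
          \<open>m \<le> -1\<close>, monotonicity puts \<open>F x 0\<close> strictly above
          \<open>F x m = M + m\<close>; both are multiples of \<open>\<delta>\<close>, so the gap is
          at least \<open>\<delta>\<close> and the curve passes above the support.\<close>
        then have "u \<le> c \<or> c + 3 * \<delta> \<le> u"
        proof cases
          case 1
          then have "(1::real) \<le> of_int m" by linarith
          then show ?thesis using uM jM \<delta> by linarith
        next
          case 2
          have "F x (of_int m) < F x 0" using strict_monoD[OF flow_lift_mono(1)[OF sl x], of "of_int m" 0] 2 by simp
          then have lt: "real (Suc n) * \<delta> + of_int m < real j * \<delta>" using Fm j(2) unfolding M_def by simp
          have md: "of_int m = of_int (m * 2 ^ q) * \<delta>" unfolding \<delta>_def by simp
          have "of_int (int (Suc n) + m * 2 ^ q) * \<delta> < of_int (int j) * \<delta>"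
            using lt unfolding of_int_add distrib_right md[symmetric] of_int_of_nat_eq .
          then have "real_of_int (int (Suc n) + m * 2 ^ q) < of_int (int j)" using \<delta>(1) by simp
          then have "int (Suc n) + m * 2 ^ q + 1 \<le> int j" by linarith
          then have "real_of_int (int (Suc n) + m * 2 ^ q + 1) \<le> real_of_int (int j)" by (simp only: of_int_le_iff)
          then have "real_of_int (int (Suc n) + m * 2 ^ q + 1) * \<delta> \<le> real_of_int (int j) * \<delta>"
            using \<delta>(1) by (intro mult_right_mono) auto
          then have "M + of_int m + \<delta> \<le> F x 0"
            unfolding M_def j(2) of_int_add distrib_right md[symmetric] of_int_of_nat_eq of_int_1 mult_1 .
          then show ?thesis using uM by linarith
        qed
        then show ?thesis using bump_outside[OF \<delta>(1)] by (simp add: over_def)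
      qed (simp add: over_def)
      then have "H x (F x 0) = F x 0" using Hx w(1) unfolding w_def by simp
      moreover have "j \<noteq> Suc n" using False j(2) unfolding M_def by auto
      ultimately show ?thesis using j unfolding \<delta>_def by (intro exI[of _ j]) auto
    qed
  qed
  from G_comp[OF G_inv[OF HG] this] show ?case
  proof (rule G_cong)
    fix x assume x: "x \<in> S"
    have "flow_lift H" using G_lift[OF HG] by (simp add: PL_lift_def)
    then show "(\<lambda>t. rinv (H x) (H x (F x t))) = F x" using flow_lift_rinv(1)[OF _ x] by blast
  qed
qed

lemma dyad_common_denominator:
  assumes "finite V" "V \<subseteq> dyad"
  shows "\<exists>q\<ge>2. \<forall>v\<in>V. \<exists>i::int. v = of_int i / 2 ^ q"
  using assms
proof (induction V rule: finite_induct)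
  case empty
  then show ?case by auto
next
  case (insert v V)
  then obtain q where q: "q \<ge> 2" "\<forall>v\<in>V. \<exists>i::int. v = of_int i / 2 ^ q" by auto
  obtain p :: int and n :: nat where v: "v = of_int p / 2 ^ n" using insert.prems dyad_alt by auto
  have sc: "of_int i / 2 ^ m = of_int (i * 2 ^ l) / (2::real) ^ (m + l)" for i m l
    by (simp add: power_add)
  have "\<exists>i::int. w = of_int i / 2 ^ (n + q)" if w: "w \<in> insert v V" for w
  proof (cases "w = v")
    case True
    then show ?thesis using v sc[of p n q] by blast
  next
    case False
    then have "w \<in> V" using w by simp
    then obtain i :: int where "w = of_int i / 2 ^ q" using q(2) by blast
    then show ?thesis using sc[of i q n] by (metis add.commute)
  qed
  then show ?case using q(1) by (intro exI[of _ "n + q"]) auto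
qed

text \<open>Compactness leaves finitely many values \<open>F x 0\<close>, all dyadic. They have a
  common denominator, and the flow through a large integer time makes them nonnegative, as
  \<open>G_descent\<close> requires.\<close>

theorem G_all: assumes "PL_lift F" shows "F \<in> G"
proof -
  have sl: "flow_lift F" using assms by (simp add: PL_lift_def)
  define U where "U x = {y \<in> S. F y 0 = F x 0}" for x
  obtain P where P: "finite P" "P \<subseteq> S" "S \<subseteq> (\<Union>x\<in>P. U x)"
  proof (rule compact_points[of U])
    fix x assume "x \<in> S"
    then show "openin X (U x) \<and> x \<in> U x"
      using clop_level[OF loc_const_zero[OF sl], of "\<lambda>v. v = F x 0"] unfolding U_def clop_def by simp
  qed blast
  define V where "V = (\<lambda>x. F x 0) ` P"
  have V: "finite V" "V \<subseteq> dyad" unfolding V_def using P PL_lift_zero_dyad[OF assms] by auto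
  have FV: "F x 0 \<in> V" if "x \<in> S" for x
  proof -
    obtain z where "z \<in> P" "x \<in> U z" using P(3) \<open>x \<in> S\<close> by blast
    then show ?thesis unfolding V_def U_def by auto
  qed
  obtain q where q: "q \<ge> 2" "\<And>v. v \<in> V \<Longrightarrow> \<exists>i::int. v = of_int i / 2 ^ q"
    using dyad_common_denominator[OF V] by blast
  obtain B where B: "\<And>v. v \<in> V \<Longrightarrow> \<bar>v\<bar> \<le> B"
    using finite_imp_bounded[OF V(1)] unfolding bounded_iff by auto
  define N where "N = nat \<lceil>B\<rceil>"
  have N: "\<bar>v\<bar> \<le> real N" if "v \<in> V" for v using B[OF that] unfolding N_def by linarith
  define F' where "F' = (\<lambda>x t. F x t + of_int (4 * int N) / 4)"
  have F': "PL_lift F'" unfolding F'_def by (rule PL_lift_comp[OF G_lift[OF G_rot] assms])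
  have "F' \<in> G"
  proof (rule G_descent[OF q(1) F'])
    fix x assume x: "x \<in> S"
    obtain i :: int where i: "F x 0 = of_int i / 2 ^ q" using q(2)[OF FV[OF x]] by blast
    define l where "l = i + int N * 2 ^ q"
    have l: "F' x 0 = of_int l / 2 ^ q" unfolding F'_def l_def i by (simp add: field_simps)
    have "0 \<le> F' x 0" "F' x 0 \<le> 2 * real N" using N[OF FV[OF x]] unfolding F'_def by auto
    then have "0 \<le> real_of_int l" "real_of_int l \<le> real_of_int (2 * int N * 2 ^ q)"
      unfolding l by (simp_all add: field_simps)
    then have "0 \<le> l" "l \<le> 2 * int N * 2 ^ q" by (simp_all only: of_int_0_le_iff of_int_le_iff)
    then have "nat l \<le> 2 * N * 2 ^ q" by (simp add: nat_le_iff)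
    then show "\<exists>j\<le>2 * N * 2 ^ q. F' x 0 = real j / 2 ^ q" using l \<open>0 \<le> l\<close> by (intro exI[of _ "nat l"]) simp
  qed
  from G_comp[OF G_rot[of "- 4 * int N"] this] show ?thesis
    by (rule G_cong) (simp add: F'_def)
qed

end

section \<open>From lifts to the group of the suspension\<close>

lemma strict_mono_surj_continuous:
  fixes f :: "real \<Rightarrow> real"
  assumes "strict_mono f" "surj f" shows "continuous_on UNIV f"
  by (rule continuous_onI_mono) (use assms in \<open>auto simp: strict_mono_less_eq\<close>)

context z_system
begin

abbreviation PX :: "('a \<times> real) topology" where "PX \<equiv> prod_topology X euclideanreal"
abbreviation Y :: "('a \<times> real) set topology" where "Y \<equiv> suspension X \<phi>"
abbreviation q :: "'a \<times> real \<Rightarrow> ('a \<times> real) set" where "q \<equiv> susp_class X \<phi>"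

lemma q_def: "q (x, t) = range (\<lambda>n. (it n x, t - of_int n))"
  by (simp add: susp_class_def)

lemma q_self: "(x, t) \<in> q (x, t)"
  unfolding q_def by (rule image_eqI[of _ _ 0]) auto

lemma q_shift: assumes "x \<in> S" shows "q (it n x, t - of_int n) = q (x, t)"
proof -
  have "range (\<lambda>m. (it m (it n x), t - of_int n - of_int m)) = (\<lambda>k. (it k x, t - of_int k)) ` range (\<lambda>m. m + n)"
    unfolding image_image by (simp add: it_add[OF assms] algebra_simps)
  also have "range (\<lambda>m::int. m + n) = UNIV" by (rule surjI[of _ "\<lambda>m. m - n"]) simp
  finally show ?thesis unfolding q_def .
qed

lemma q_eq: assumes "x \<in> S" "y \<in> S" shows "q (x, t) = q (y, s) \<longleftrightarrow> (\<exists>n. y = it n x \<and> s = t - of_int n)"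
proof
  assume "q (x, t) = q (y, s)"
  then have "(y, s) \<in> q (x, t)" using q_self by simp
  then show "\<exists>n. y = it n x \<and> s = t - of_int n" unfolding q_def by auto
next
  assume "\<exists>n. y = it n x \<and> s = t - of_int n"
  then show "q (x, t) = q (y, s)" using q_shift[OF assms(1)] by auto
qed

lemma topY: "topspace Y = q ` (S \<times> UNIV)" by (rule topspace_suspension)

lemma q_in: "x \<in> S \<Longrightarrow> q (x, t) \<in> topspace Y" by (auto simp: topY)

lemma Y_cases: assumes "y \<in> topspace Y" obtains x t where "x \<in> S" "y = q (x, t)"
  using assms by (auto simp: topY)

lemma q_cont: "continuous_map PX Y q"
  using quotient_map_susp_class by (rule quotient_imp_continuous_map)

lemma q_close_inj:
  assumes "x \<in> S" "y \<in> S" "q (x, t) = q (y, s)" "\<bar>t - s\<bar> < 1" shows "x = y \<and> t = s"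
proof -
  obtain n where n: "y = it n x" "s = t - of_int n" using q_eq[OF assms(1,2)] assms(3) by blast
  then have "\<bar>real_of_int n\<bar> < 1" using assms(4) by simp
  then have "n = 0" by linarith
  then show ?thesis using n by simp
qed

definition lev :: "('a \<Rightarrow> real \<Rightarrow> real) \<Rightarrow> real \<Rightarrow> 'a \<Rightarrow> 'a set" where
  "lev F K x = {y \<in> S. (\<lambda>t\<in>{-K..K}. F y t) = (\<lambda>t\<in>{-K..K}. F x t)}"

lemma lev: assumes "flow_lift F" shows "clop (lev F K x)" "x \<in> S \<Longrightarrow> x \<in> lev F K x"
    "y \<in> lev F K x \<Longrightarrow> \<bar>t\<bar> \<le> K \<Longrightarrow> F y t = F x t"
proof -
  have "loc_const (\<lambda>y. \<lambda>t\<in>{-K..K}. F y t)" using assms by (simp add: flow_lift_def)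
  from clop_level[OF this] show "clop (lev F K x)" unfolding lev_def .
  show "x \<in> S \<Longrightarrow> x \<in> lev F K x" by (simp add: lev_def)
  assume y: "y \<in> lev F K x" and t: "\<bar>t\<bar> \<le> K"
  have e: "(\<lambda>t\<in>{-K..K}. F y t) = (\<lambda>t\<in>{-K..K}. F x t)" using y unfolding lev_def by blast
  have "- K \<le> t \<and> t \<le> K" using t by linarith
  then show "F y t = F x t" using fun_cong[OF e, of t] by simp
qed

text \<open>On \<open>lev F K x \<times> {-K<..<K}\<close> the value depends on time alone and is
  given by the continuous \<open>F x\<close>; these open sets cover the product, so the pieces
  paste.\<close>

lemma flow_lift_cont:
  assumes "flow_lift F" shows "continuous_map PX euclideanreal (\<lambda>p. F (fst p) (snd p))"
proof (rule pasting_lemma[where I = "S \<times> UNIV" and T = "\<lambda>(x, K). lev F K x \<times> {-K<..<K}"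
      and f = "\<lambda>(x, K) p. F x (snd p)"])
  fix i assume "i \<in> S \<times> (UNIV :: real set)"
  then obtain x K where i: "i = (x, K)" "x \<in> S" by auto
  show "openin PX (case i of (x, K) \<Rightarrow> lev F K x \<times> {-K<..<K})"
    using lev(1)[OF assms, of K x] unfolding i by (simp add: openin_prod_Times_iff clop_def)
  have "continuous_on UNIV (F x)"
    using strict_mono_surj_continuous flow_lift_mono[OF assms i(2)] by blast
  then have "continuous_map euclideanreal euclideanreal (F x)" by simp
  then have "continuous_map PX euclideanreal (F x \<circ> snd)"
    by (rule continuous_map_compose[OF continuous_map_snd])
  then show "continuous_map (subtopology PX (case i of (x, K) \<Rightarrow> lev F K x \<times> {-K<..<K})) euclideanreal
      (case i of (x, K) \<Rightarrow> \<lambda>p. F x (snd p))"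
    unfolding i by (simp add: continuous_map_from_subtopology o_def)
next
  fix i j p assume "i \<in> S \<times> (UNIV :: real set)" "j \<in> S \<times> (UNIV :: real set)"
    "p \<in> topspace PX \<inter> (case i of (x, K) \<Rightarrow> lev F K x \<times> {-K<..<K}) \<inter> (case j of (x, K) \<Rightarrow> lev F K x \<times> {-K<..<K})"
  then obtain x K y L where i: "i = (x, K)" "j = (y, L)" "fst p \<in> lev F K x" "fst p \<in> lev F L y"
    "\<bar>snd p\<bar> \<le> K" "\<bar>snd p\<bar> \<le> L"
    by auto
  show "(case i of (x, K) \<Rightarrow> \<lambda>p. F x (snd p)) p = (case j of (x, K) \<Rightarrow> \<lambda>p. F x (snd p)) p"
    using lev(3)[OF assms i(3,5)] lev(3)[OF assms i(4,6)] unfolding i(1,2) by simp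
next
  fix p assume p: "p \<in> topspace PX"
  then have "fst p \<in> S" by auto
  then show "\<exists>j. j \<in> S \<times> UNIV \<and> p \<in> (case j of (x, K) \<Rightarrow> lev F K x \<times> {-K<..<K}) \<and>
      F (fst p) (snd p) = (case j of (x, K) \<Rightarrow> \<lambda>p. F x (snd p)) p"
    using lev(2)[OF assms, of "fst p" "\<bar>snd p\<bar> + 1"]
    by (intro exI[of _ "(fst p, \<bar>snd p\<bar> + 1)"]) (auto simp: mem_Times_iff)
qed

text \<open>A point of the suspension is a set of pairs, so the lift is applied to every member of
  the class; equivariance makes the result a class. The restriction selects the extensional
  representative.\<close>

definition flow_map :: "('a \<Rightarrow> real \<Rightarrow> real) \<Rightarrow> ('a \<times> real) set \<Rightarrow> ('a \<times> real) set" where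
  "flow_map F = (\<lambda>y\<in>topspace Y. (\<lambda>p. (fst p, F (fst p) (snd p))) ` y)"

lemma flow_map_q: assumes "flow_lift F" "x \<in> S" shows "flow_map F (q (x, t)) = q (x, F x t)"
proof -
  have "(\<lambda>p. (fst p, F (fst p) (snd p))) ` q (x, t) = range (\<lambda>n. (it n x, F (it n x) (t - of_int n)))"
    unfolding q_def by (simp add: image_image)
  also have "\<dots> = q (x, F x t)" unfolding q_def by (simp add: flow_lift_it[OF assms])
  finally show ?thesis unfolding flow_map_def using q_in[OF assms(2)] by simp
qed

lemma flow_map_cong: assumes "\<And>x. x \<in> S \<Longrightarrow> F x = H x" shows "flow_map F = flow_map H"
  unfolding flow_map_def
proof (rule restrict_ext)
  fix y assume "y \<in> topspace Y"
  then obtain x t where "x \<in> S" "y = q (x, t)" by (rule Y_cases)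
  then have "fst p \<in> S" if "p \<in> y" for p using that unfolding q_def by auto
  then show "(\<lambda>p. (fst p, F (fst p) (snd p))) ` y = (\<lambda>p. (fst p, H (fst p) (snd p))) ` y"
    using assms by (intro image_cong) auto
qed

lemma flow_map_in: assumes "flow_lift F" "y \<in> topspace Y" shows "flow_map F y \<in> topspace Y"
proof -
  obtain x t where "x \<in> S" "y = q (x, t)" using assms(2) by (rule Y_cases)
  then show ?thesis using flow_map_q[OF assms(1)] q_in by simp
qed

lemma flow_map_comp:
  assumes "flow_lift F" "flow_lift H" shows "compose (topspace Y) (flow_map F) (flow_map H) = flow_map (\<lambda>x t. F x (H x t))"
proof
  fix y
  show "compose (topspace Y) (flow_map F) (flow_map H) y = flow_map (\<lambda>x t. F x (H x t)) y"
  proof (cases "y \<in> topspace Y")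
    case True
    then obtain x t where y: "x \<in> S" "y = q (x, t)" by (rule Y_cases)
    have "flow_map F (flow_map H y) = flow_map (\<lambda>x t. F x (H x t)) y"
      unfolding y(2) flow_map_q[OF assms(2) y(1)] flow_map_q[OF assms(1) y(1)] flow_map_q[OF flow_lift_comp[OF assms] y(1)] ..
    then show ?thesis using True by (simp add: compose_def)
  qed (simp add: compose_def flow_map_def)
qed

lemma flow_map_id: "flow_map (\<lambda>x t. t) = (\<lambda>y\<in>topspace Y. y)"
  unfolding flow_map_def by (rule restrict_ext) simp

lemma flow_lift_id: "flow_lift (\<lambda>x t. t)"
  by (rule flow_liftI) (auto simp: strict_mono_def)

lemma flow_map_inverse:
  assumes "flow_lift F" "y \<in> topspace Y" shows "flow_map F (flow_map (\<lambda>x. rinv (F x)) y) = y" "flow_map (\<lambda>x. rinv (F x)) (flow_map F y) = y"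
proof -
  obtain x t where y: "x \<in> S" "y = q (x, t)" using assms(2) by (rule Y_cases)
  show "flow_map F (flow_map (\<lambda>x. rinv (F x)) y) = y"
    unfolding y(2) flow_map_q[OF flow_lift_inv[OF assms(1)] y(1)] flow_map_q[OF assms(1) y(1)] flow_lift_rinv(2)[OF assms(1) y(1)] ..
  show "flow_map (\<lambda>x. rinv (F x)) (flow_map F y) = y"
    unfolding y(2) flow_map_q[OF flow_lift_inv[OF assms(1)] y(1)] flow_map_q[OF assms(1) y(1)] flow_lift_rinv(1)[OF assms(1) y(1)] ..
qed

lemma flow_map_cont: assumes "flow_lift F" shows "continuous_map Y Y (flow_map F)"
proof (rule continuous_compose_quotient_map[OF quotient_map_susp_class])
  have "continuous_map PX PX (\<lambda>p. (fst p, F (fst p) (snd p)))"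
    by (rule continuous_map_pairedI[OF continuous_map_fst flow_lift_cont[OF assms]])
  then have "continuous_map PX Y (q \<circ> (\<lambda>p. (fst p, F (fst p) (snd p))))"
    by (rule continuous_map_compose[OF _ q_cont])
  then show "continuous_map PX Y (flow_map F \<circ> q)"
    by (rule continuous_map_eq) (auto simp: flow_map_q[OF assms])
qed

lemma flow_map_homeo: assumes "flow_lift F" shows "homeomorphic_map Y Y (flow_map F)"
  unfolding homeomorphic_map_maps homeomorphic_maps_def
  using flow_map_cont[OF assms] flow_map_cont[OF flow_lift_inv[OF assms]] flow_map_inverse[OF assms] by blast

section \<open>Straight-line isotopy to the identity\<close>

lemma convex_between:
  assumes "0 \<le> s" "s \<le> (1::real)" shows "min a b \<le> (1 - s) * a + s * b" "(1 - s) * a + s * b \<le> max a b"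
proof -
  have "(1 - s) * min a b + s * min a b \<le> (1 - s) * a + s * b"
    using assms by (intro add_mono mult_left_mono) auto
  moreover have "(1 - s) * a + s * b \<le> (1 - s) * max a b + s * max a b"
    using assms by (intro add_mono mult_left_mono) auto
  ultimately show "min a b \<le> (1 - s) * a + s * b" "(1 - s) * a + s * b \<le> max a b"
    by (simp_all only: distrib_right[symmetric]) simp_all
qed

text \<open>Monotonicity and equivariance survive convex combination with the identity. The dyadic
  condition in general does not, which is why \<open>flow_lift\<close> is separated from
  \<open>PL_lift\<close>.\<close>

lemma flow_lift_convex:
  assumes F: "flow_lift F" and s: "0 \<le> s" "s \<le> 1" shows "flow_lift (\<lambda>x t. (1 - s) * t + s * F x t)"
proof (rule flow_liftI)
  fix x assume x: "x \<in> S"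
  note m = flow_lift_mono[OF F x]
  show "strict_mono (\<lambda>t. (1 - s) * t + s * F x t)"
  proof (rule strict_monoI)
    fix a b :: real assume ab: "a < b"
    have Fab: "F x a < F x b" using m(1) ab by (simp add: strict_mono_less)
    show "(1 - s) * a + s * F x a < (1 - s) * b + s * F x b"
    proof (cases "s = 1")
      case True
      then show ?thesis using Fab by simp
    next
      case False
      then have "(1 - s) * a < (1 - s) * b" using s ab by simp
      moreover have "s * F x a \<le> s * F x b" using s Fab by (simp add: mult_left_mono)
      ultimately show ?thesis by (rule add_less_le_mono)
    qed
  qed
  have "\<exists>t. v = (1 - s) * t + s * F x t" for v
  proof -
    let ?g = "\<lambda>t. (1 - s) * t + s * F x t"
    \<comment> \<open>Between \<open>v\<close> and its preimage \<open>w\<close> the combination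
      passes from at most \<open>v\<close> to at least \<open>v\<close>, since the identity and
      \<open>F x\<close> both do.\<close>
    define w where "w = rinv (F x) v"
    have w: "F x w = v" unfolding w_def by (rule flow_lift_rinv(2)[OF F x])
    have "?g (min v w) \<le> max (min v w) (F x (min v w))" by (rule convex_between(2)[OF s])
    also have "\<dots> \<le> v"
    proof -
      have "F x (min v w) \<le> F x w" using m(1) by (simp add: strict_mono_less_eq)
      then show ?thesis using w by simp
    qed
    finally have 1: "?g (min v w) \<le> v" .
    have "v \<le> min (max v w) (F x (max v w))"
    proof -
      have "F x w \<le> F x (max v w)" using m(1) by (simp add: strict_mono_less_eq)
      then show ?thesis using w by simp
    qed
    also have "\<dots> \<le> ?g (max v w)" by (rule convex_between(1)[OF s])
    finally have 2: "v \<le> ?g (max v w)" .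
    have "continuous_on {min v w..max v w} ?g"
      using continuous_on_subset[OF strict_mono_surj_continuous[OF m]] by (intro continuous_intros) auto
    moreover have "min v w \<le> max v w" by simp
    ultimately obtain t where "?g t = v" using IVT'[of ?g "min v w" v "max v w"] 1 2 by blast
    then show ?thesis by auto
  qed
  then show "surj (\<lambda>t. (1 - s) * t + s * F x t)" by blast
  show "(1 - s) * t + s * F (\<phi> x) t = (1 - s) * (t + 1) + s * F x (t + 1) - 1" for t
    by (simp add: flow_lift_phi[OF F x] algebra_simps)
  show "\<exists>U. openin X U \<and> x \<in> U \<and> (\<forall>y\<in>U. \<forall>t. \<bar>t\<bar> \<le> K \<longrightarrow>
      (1 - s) * t + s * F y t = (1 - s) * t + s * F x t)" for K
  proof (intro exI[of _ "lev F K x"] conjI ballI allI impI)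
    show "openin X (lev F K x)" using lev(1)[OF F] by (simp add: clop_def)
    show "x \<in> lev F K x" by (rule lev(2)[OF F x])
    fix y t assume "y \<in> lev F K x" "\<bar>t\<bar> \<le> K"
    then show "(1 - s) * t + s * F y t = (1 - s) * t + s * F x t" by (simp only: lev(3)[OF F])
  qed
qed

text \<open>The homotopy is continuous before passing to the quotient. It descends because the
  product of a quotient map with the identity of a locally compact Hausdorff space is a quotient
  map.\<close>

lemma flow_map_isotopic: assumes F: "flow_lift F" shows "isotopic_to_identity Y (flow_map F)"
proof -
  let ?I = "top_of_set {0..1::real}"
  define h where "h = (\<lambda>p. flow_map (\<lambda>x t. (1 - fst p) * t + fst p * F x t) (snd p))"
  have "quotient_map (prod_topology ?I PX) (prod_topology ?I Y) (\<lambda>(s, p). (s, q p))"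
  proof (rule quotient_map_prod_right)
    have "compact_space ?I" by (simp add: compact_space_subtopology)
    then show "locally_compact_space ?I" by (rule compact_imp_locally_compact_space)
    show "Hausdorff_space ?I \<or> regular_space ?I" by (simp add: Hausdorff_space_subtopology)
  qed (rule quotient_map_susp_class)
  then have hc: "continuous_map (prod_topology ?I Y) Y h"
  proof (rule continuous_compose_quotient_map)
    have sc: "continuous_map (prod_topology ?I PX) euclideanreal (\<lambda>p. snd (snd p))"
      using continuous_map_compose[OF continuous_map_snd continuous_map_snd, of ?I X euclideanreal] by (simp add: o_def)
    have fc: "continuous_map (prod_topology ?I PX) euclideanreal fst"
      using continuous_map_fst[of ?I PX] continuous_map_in_subtopology by blast
    have Fc: "continuous_map (prod_topology ?I PX) euclideanreal (\<lambda>p. F (fst (snd p)) (snd (snd p)))"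
      using continuous_map_compose[OF continuous_map_snd flow_lift_cont[OF F], of ?I] by (simp add: o_def)
    have "continuous_map (prod_topology ?I PX) X (\<lambda>p. fst (snd p))"
      using continuous_map_compose[OF continuous_map_snd continuous_map_fst, of ?I X euclideanreal] by (simp add: o_def)
    moreover have "continuous_map (prod_topology ?I PX) euclideanreal
        (\<lambda>p. (1 - fst p) * snd (snd p) + fst p * F (fst (snd p)) (snd (snd p)))"
      by (intro continuous_map_add continuous_map_real_mult continuous_map_diff sc fc Fc continuous_map_const[THEN iffD2]) auto
    ultimately have "continuous_map (prod_topology ?I PX) PX
        (\<lambda>p. (fst (snd p), (1 - fst p) * snd (snd p) + fst p * F (fst (snd p)) (snd (snd p))))"
      by (rule continuous_map_pairedI)
    from continuous_map_compose[OF this q_cont]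
    show "continuous_map (prod_topology ?I PX) Y (h \<circ> (\<lambda>(s, p). (s, q p)))"
    proof (rule continuous_map_eq)
      fix p assume "p \<in> topspace (prod_topology ?I PX)"
      then obtain s x t where p: "p = (s, x, t)" "0 \<le> s" "s \<le> 1" "x \<in> S" by auto
      show "(q \<circ> (\<lambda>p. (fst (snd p), (1 - fst p) * snd (snd p) + fst p * F (fst (snd p)) (snd (snd p))))) p =
          (h \<circ> (\<lambda>(s, p). (s, q p))) p"
        using flow_map_q[OF flow_lift_convex[OF F p(2,3)] p(4), of t] unfolding p(1) h_def by simp
    qed
  qed
  have h0: "h (0, y) = y" if "y \<in> topspace Y" for y
    using that unfolding h_def by (simp add: flow_map_id)
  have h1: "h (1, y) = flow_map F y" for y unfolding h_def by simp
  have "homeomorphic_map Y Y (\<lambda>y. h (s, y))" if "s \<in> {0..1}" for s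
    using flow_map_homeo[OF flow_lift_convex[OF F, of s]] that unfolding h_def by simp
  then show ?thesis
    unfolding isotopic_to_identity_def
    by (subst homotopic_with) (use hc h0 h1 in \<open>auto intro: homeomorphic_map_eq intro!: exI[of _ h]\<close>)
qed

lemma flow_map_H0: "flow_lift F \<Longrightarrow> flow_map F \<in> H0 X \<phi>"
  unfolding H0_def using flow_map_homeo flow_map_isotopic by (simp add: flow_map_def)

section \<open>Charts of a lifted homeomorphism\<close>

text \<open>Return times are at least 1, so the length condition holds over every clopen set once
  the interval is shorter than 1.\<close>

lemma chartI:
  assumes "clop C" "a < b" "b - a < 1" shows "chart X \<phi> C {a<..<b}"
proof -
  have "enat 1 \<le> return_time X \<phi> C"
    unfolding return_time_def by (intro Inf_greatest) auto
  then have "ereal_of_enat (enat 1) \<le> ereal_of_enat (return_time X \<phi> C)" by (simp only: ereal_of_enat_le_iff)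
  moreover have "ereal (b - a) < ereal_of_enat (enat 1)" using assms(3) by simp
  ultimately have "ereal (b - a) < ereal_of_enat (return_time X \<phi> C)" by (rule less_le_trans[rotated])
  then show ?thesis unfolding chart_def using assms(1,2) by (auto simp: clop_def)
qed

lemma dyadic_intervalI: "a < b \<Longrightarrow> a \<in> dyad \<Longrightarrow> b \<in> dyad \<Longrightarrow> dyadic_interval {a<..<b}"
  unfolding dyadic_interval_def by (auto simp: is_interval_oo)

lemma dpl_image:
  assumes "dpl f" shows "f ` {a<..<b} = {f a<..<f b}"
proof -
  have m: "strict_mono f" "surj f" using assms by (auto simp: dpl_def)
  have "v \<in> f ` {a<..<b}" if "f a < v" "v < f b" for v
  proof -
    obtain t where "v = f t" using m(2) by blast
    then show ?thesis using that m(1) by (auto simp: strict_mono_less)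
  qed
  then show ?thesis using m(1) by (auto simp: strict_mono_less)
qed

lemma dpl_homeo: assumes "dpl f" shows "homeomorphic_map (top_of_set J) (top_of_set (f ` J)) f"
proof -
  have c: "continuous_on UNIV g" if "dpl g" for g
    using that strict_mono_surj_continuous by (simp add: dpl_def)
  have "homeomorphic_maps (top_of_set J) (top_of_set (f ` J)) f (rinv f)"
    unfolding homeomorphic_maps_def
    using continuous_on_subset[OF c[OF assms]] continuous_on_subset[OF c[OF dpl_inv[OF assms]]]
      rinv_cancel(1,2)[OF assms]
    by (auto simp: continuous_map_in_subtopology)
  then show ?thesis unfolding homeomorphic_map_maps by blast
qed

text \<open>The chart lies over the clopen set where the lift agrees with \<open>F x\<close> on a
  window around \<open>t\<close>. Its interval \<open>J\<close> is so short that only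
  \<open>t\<close> can be a breakpoint and that both \<open>J\<close> and its image are shorter than
  1.\<close>

lemma flow_map_T_set: assumes "PL_lift F" shows "flow_map F \<in> T_set X \<phi>"
proof -
  have sl: "flow_lift F" using assms by (simp add: PL_lift_def)
  have "\<exists>C J f. chart X \<phi> C J \<and> dyadic_interval J \<and> y \<in> chart_domain X \<phi> C J \<and>
     dyadic_PL_homeo J (f ` J) f \<and> chart X \<phi> C (f ` J) \<and>
     flow_map F ` chart_domain X \<phi> C J = chart_domain X \<phi> C (f ` J) \<and>
     (\<forall>x\<in>C. \<forall>t\<in>J. inv_into (C \<times> f ` J) q (flow_map F (q (x, t))) = (x, f t))"
    if y: "y \<in> topspace Y" for y
  proof -
    obtain x t where x: "x \<in> S" "y = q (x, t)" using y by (rule Y_cases)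
    define f where "f = F x"
    have f: "dpl f" using assms x(1) unfolding PL_lift_def f_def by blast
    have m: "strict_mono f" using f by (simp add: dpl_def)
    obtain e m m' c c' where e: "e > 0" "c \<in> dyad" "c' \<in> dyad"
      "\<And>s. t \<le> s \<Longrightarrow> s < t + e \<Longrightarrow> f s = 2 powi m * s + c"
      "\<And>s. t - e < s \<Longrightarrow> s \<le> t \<Longrightarrow> f s = 2 powi m' * s + c'"
      "t \<in> dyad \<or> (m = m' \<and> c = c')"
      by (rule dpl_local[OF f, of t]) blast
    \<comment> \<open>\<open>e\<close> keeps \<open>J\<close> within the range of the two germs; the
      terms with the slopes make the image of each side of \<open>J\<close> shorter than
      1/4.\<close>
    define \<eta> where "\<eta> = Min {e, 1/4, 1 / (4 * 2 powi m), 1 / (4 * 2 powi m')}"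
    have \<eta>: "\<eta> > 0" "\<eta> \<le> e" "\<eta> \<le> 1/4" "\<eta> \<le> 1 / (4 * 2 powi m)" "\<eta> \<le> 1 / (4 * 2 powi m')"
      unfolding \<eta>_def using e(1) by (auto simp: Min_gr_iff)
    obtain a where a: "a \<in> dyad" "t - \<eta> < a" "a < t" using dyad_dense[of "t - \<eta>" t] \<eta>(1) by auto
    obtain b where b: "b \<in> dyad" "t < b" "b < t + \<eta>" using dyad_dense[of t "t + \<eta>"] \<eta>(1) by auto
    define J where "J = {a<..<b}"
    have ab: "a < b" "b - a < 1" "t \<in> J" using a b \<eta>(3) unfolding J_def by auto
    have fJ: "f ` J = {f a<..<f b}" unfolding J_def by (rule dpl_image[OF f])
    have "f b - f t = 2 powi m * (b - t)" using e(4)[of t] e(4)[of b] b \<eta>(2) e(1) by (simp add: algebra_simps)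
    moreover have "2 powi m * (b - t) < 2 powi m * \<eta>" using b by simp
    moreover have "2 powi m * \<eta> \<le> 2 powi m * (1 / (4 * 2 powi m))" using \<eta>(4) by (intro mult_left_mono) auto
    moreover have "2 powi m * (1 / (4 * 2 powi m)) = 1 / (4::real)" by simp
    ultimately have fb: "f b - f t < 1/4" by linarith
    have "f t - f a = 2 powi m' * (t - a)" using e(5)[of t] e(5)[of a] a \<eta>(2) e(1) by (simp add: algebra_simps)
    moreover have "2 powi m' * (t - a) < 2 powi m' * \<eta>" using a by simp
    moreover have "2 powi m' * \<eta> \<le> 2 powi m' * (1 / (4 * 2 powi m'))" using \<eta>(5) by (intro mult_left_mono) auto
    moreover have "2 powi m' * (1 / (4 * 2 powi m')) = 1 / (4::real)" by simp
    ultimately have fa: "f t - f a < 1/4" by linarith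
    have fab: "f a < f b" "f b - f a < 1" using strict_monoD[OF m ab(1)] fa fb by auto
    define C where "C = lev F (\<bar>t\<bar> + 1) x"
    have C: "clop C" "x \<in> C" unfolding C_def using lev(1,2)[OF sl] x(1) by auto
    have CS: "z \<in> S" if "z \<in> C" for z using clop_sub[OF C(1)] that by blast
    have Ff: "F z s = f s" if "z \<in> C" "s \<in> J" for z s
      unfolding f_def by (rule lev(3)[OF sl, of z "\<bar>t\<bar> + 1" x]) (use that a b \<eta>(3) in \<open>auto simp: C_def J_def\<close>)
    have pq: "flow_map F (q (z, s)) = q (z, f s)" if "z \<in> C" "s \<in> J" for z s
      using flow_map_q[OF sl CS[OF that(1)], of s] Ff[OF that] by simp
    have im: "flow_map F ` chart_domain X \<phi> C J = chart_domain X \<phi> C (f ` J)"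
      unfolding chart_domain_def using pq by (force simp: image_iff)
    have "inj_on q (C \<times> f ` J)"
    proof (rule inj_onI, clarify)
      fix z s w r assume H: "z \<in> C" "s \<in> J" "w \<in> C" "r \<in> J" "q (z, f s) = q (w, f r)"
      have "f s \<in> f ` J" "f r \<in> f ` J" using H by auto
      then have "\<bar>f s - f r\<bar> < 1" unfolding fJ using fab by auto
      from q_close_inj[OF CS[OF H(1)] CS[OF H(3)] H(5) this] show "z = w \<and> f s = f r" .
    qed
    then have ii: "inv_into (C \<times> f ` J) q (flow_map F (q (z, s))) = (z, f s)" if "z \<in> C" "s \<in> J" for z s
      unfolding pq[OF that] by (rule inv_into_f_f) (use that in auto)
    have pl: "dyadic_PL_homeo J (f ` J) f"
    proof -
      \<comment> \<open>A breakpoint is recorded only at a dyadic \<open>t\<close>; at any other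
        \<open>t\<close> the two germs are one affine map.\<close>
      define B where "B = (if t \<in> dyad then {t} else {})"
      have "\<exists>m::int. \<exists>b\<in>dyad. \<forall>s\<in>I. f s = 2 powi m * s + b" if I: "I \<in> components (J - B)" for I
      proof -
        have Ic: "connected I" "I \<subseteq> J - B" using in_components_connected[OF I] in_components_subset[OF I] .
        have J: "t - e < s" "s < t + e" if "s \<in> I" for s using that Ic(2) a b \<eta>(2) unfolding J_def by auto
        consider "I \<subseteq> {t..}" | "I \<subseteq> {..t}" | "m = m'" "c = c'"
        proof (cases "t \<in> dyad")
          case True
          then have "t \<notin> I" using Ic(2) unfolding B_def by auto
          then have "\<not> (\<exists>u\<in>I. \<exists>v\<in>I. u < t \<and> t < v)"
            using connected_contains_Icc[OF Ic(1)] by (meson atLeastAtMost_iff less_imp_le subsetD)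
          then have "I \<subseteq> {t..} \<or> I \<subseteq> {..t}" by (meson atLeast_iff atMost_iff not_le subsetI less_le_not_le linear)
          then show thesis using that by blast
        next
          case False
          then show thesis using e(6) that by blast
        qed
        then show ?thesis
        proof cases
          case 1
          then show ?thesis using e(2,4) J by (intro exI[of _ m] bexI[of _ c]) auto
        next
          case 2
          then show ?thesis using e(3,5) J by (intro exI[of _ m'] bexI[of _ c']) auto
        next
          case 3
          have "f s = 2 powi m * s + c" if "s \<in> I" for s
            using e(4)[of s] e(5)[of s] J[OF that] 3 by (cases "t \<le> s") auto
          then show ?thesis using e(2) by blast
        qed
      qed
      moreover have "finite B" "B \<subseteq> dyad" unfolding B_def by auto
      moreover have "dyadic_interval J" unfolding J_def by (rule dyadic_intervalI[OF ab(1) a(1) b(1)])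
      moreover have "dyadic_interval (f ` J)" unfolding fJ
        by (rule dyadic_intervalI[OF fab(1)]) (use a(1) b(1) dpl_dyad_iff[OF f] in auto)
      ultimately show ?thesis unfolding dyadic_PL_homeo_def using dpl_homeo[OF f] by blast
    qed
    have "chart X \<phi> C J" unfolding J_def by (rule chartI[OF C(1) ab(1,2)])
    moreover have "chart X \<phi> C (f ` J)" unfolding fJ by (rule chartI[OF C(1) fab])
    moreover have "dyadic_interval J" unfolding J_def by (rule dyadic_intervalI[OF ab(1) a(1) b(1)])
    moreover have "y \<in> chart_domain X \<phi> C J" unfolding chart_domain_def x(2) using C(2) ab(3) by blast
    ultimately show ?thesis using pl im ii by blast
  qed
  then show ?thesis unfolding T_set_def using flow_map_H0[OF sl] by blast
qed

end

section \<open>Flow boxes in the suspension\<close>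

locale td_system = z_system +
  assumes td: "totally_disconnected_space X"
begin

text \<open>The saturation of \<open>W\<close> is the union of its translates under the integer
  action, each of which is open.\<close>

lemma q_open: assumes "openin PX W" shows "openin Y (q ` W)"
proof -
  have WS: "W \<subseteq> S \<times> UNIV" using openin_subset[OF assms] by simp
  have sh: "openin PX {p \<in> topspace PX. (it n (fst p), snd p - of_int n) \<in> W}" for n
  proof (rule openin_continuous_map_preimage[OF _ assms])
    have "continuous_map PX X (it n \<circ> fst)" by (rule continuous_map_compose[OF continuous_map_fst it_cont])
    moreover have "continuous_map PX euclideanreal (\<lambda>p. snd p - of_int n)"
      by (intro continuous_map_diff continuous_map_snd) simp
    ultimately show "continuous_map PX PX (\<lambda>p. (it n (fst p), snd p - of_int n))"
      by (intro continuous_map_pairedI) (simp_all add: o_def)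
  qed
  have "{p \<in> S \<times> UNIV. q p \<in> q ` W} = (\<Union>n. {p \<in> topspace PX. (it n (fst p), snd p - of_int n) \<in> W})"
  proof (intro equalityI subsetI)
    fix p assume "p \<in> {p \<in> S \<times> UNIV. q p \<in> q ` W}"
    then obtain x t y s where p: "p = (x, t)" "x \<in> S" "(y, s) \<in> W" "q (x, t) = q (y, s)" by auto
    then obtain n where "y = it n x" "s = t - of_int n" using q_eq[of x y t s] WS by auto
    then show "p \<in> (\<Union>n. {p \<in> topspace PX. (it n (fst p), snd p - of_int n) \<in> W})" using p by auto
  next
    fix p assume "p \<in> (\<Union>n. {p \<in> topspace PX. (it n (fst p), snd p - of_int n) \<in> W})"
    then obtain x t n where p: "p = (x, t)" "x \<in> S" "(it n x, t - of_int n) \<in> W" by auto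
    have "q (x, t) \<in> q ` W" unfolding q_shift[OF p(2), of n t, symmetric] using p(3) by (rule imageI)
    then show "p \<in> {p \<in> S \<times> UNIV. q p \<in> q ` W}" using p(1,2) by simp
  qed
  moreover have "openin PX \<dots>" using sh by blast
  ultimately show ?thesis unfolding openin_suspension using WS by auto
qed

text \<open>Length 1/4 is below 1, so the quotient map is injective on a box; it also keeps
  displacements inside a box small enough for \<open>flow_unique\<close>.\<close>

abbreviation box :: "real \<Rightarrow> ('a \<times> real) set" where "box r \<equiv> S \<times> {r - 1/8<..<r + 1/8}"

lemma box_open: "openin PX (box r)" "openin Y (q ` box r)"
proof -
  show "openin PX (box r)" by (simp add: openin_prod_Times_iff)
  then show "openin Y (q ` box r)" by (rule q_open)
qed

text \<open>On a box the quotient map is continuous, open and injective. Its inverse supplies a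
  coordinate in \<open>X\<close> and a coordinate along the flow.\<close>

lemma box_section:
  obtains k where "continuous_map (subtopology Y (q ` box r)) (subtopology PX (box r)) k"
    "\<And>y. y \<in> q ` box r \<Longrightarrow> k y \<in> box r \<and> q (k y) = y"
proof -
  have "homeomorphic_map (subtopology PX (box r)) (subtopology Y (q ` box r)) q"
  proof (rule bijective_open_imp_homeomorphic_map)
    show "continuous_map (subtopology PX (box r)) (subtopology Y (q ` box r)) q"
      using continuous_map_from_subtopology[OF q_cont] by (auto simp: continuous_map_in_subtopology)
    show "open_map (subtopology PX (box r)) (subtopology Y (q ` box r)) q"
      unfolding open_map_def
    proof (intro allI impI)
      fix W assume "openin (subtopology PX (box r)) W"
      then have "openin PX W" "W \<subseteq> box r" using openin_open_subtopology[OF box_open(1)] by auto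
      then show "openin (subtopology Y (q ` box r)) (q ` W)"
        using openin_open_subtopology[OF box_open(2)] q_open by blast
    qed
    show "q ` topspace (subtopology PX (box r)) = topspace (subtopology Y (q ` box r))"
      using openin_subset[OF box_open(2)] by auto
    show "inj_on q (topspace (subtopology PX (box r)))"
    proof (rule inj_onI)
      fix p p' assume H: "p \<in> topspace (subtopology PX (box r))" "p' \<in> topspace (subtopology PX (box r))" "q p = q p'"
      then have "\<bar>snd p - snd p'\<bar> < 1" by auto
      then show "p = p'" using q_close_inj[of "fst p" "fst p'" "snd p" "snd p'"] H by (auto simp: prod_eq_iff)
    qed
  qed
  then obtain k where k: "homeomorphic_maps (subtopology PX (box r)) (subtopology Y (q ` box r)) q k"
    unfolding homeomorphic_map_maps by blast
  have top: "topspace (subtopology Y (q ` box r)) = q ` box r" using openin_subset[OF box_open(2)] by auto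
  have c: "continuous_map (subtopology Y (q ` box r)) (subtopology PX (box r)) k"
    and s: "\<And>y. y \<in> q ` box r \<Longrightarrow> q (k y) = y" using k unfolding homeomorphic_maps_def top by blast+
  have kb: "k y \<in> box r" if "y \<in> q ` box r" for y
  proof -
    have "k \<in> topspace (subtopology Y (q ` box r)) \<rightarrow> topspace (subtopology PX (box r))"
      using c by (rule continuous_map_funspace)
    then have "k y \<in> topspace (subtopology PX (box r))" using that unfolding top by blast
    then show ?thesis by simp
  qed
  show thesis by (rule that[OF c]) (rule conjI[OF kb s])
qed

lemma compact_Y: "compact_space Y"
proof -
  have "compactin PX (S \<times> {0..1})"
    using compact by (simp add: compactin_Times compact_space_def)
  then have "compactin Y (q ` (S \<times> {0..1}))" by (rule image_compactin[OF _ q_cont])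
  moreover have "q ` (S \<times> {0..1}) = topspace Y"
  proof -
    have "q (x, t) \<in> q ` (S \<times> {0..1})" if x: "x \<in> S" for x t
    proof -
      have "q (x, t) = q (it \<lfloor>t\<rfloor> x, t - of_int \<lfloor>t\<rfloor>)" by (rule q_shift[OF x, symmetric])
      moreover have "0 \<le> t - of_int \<lfloor>t\<rfloor>" "t - of_int \<lfloor>t\<rfloor> \<le> 1" by linarith+
      ultimately show ?thesis using x by auto
    qed
    then show ?thesis by (auto simp: topY)
  qed
  ultimately show ?thesis by (simp add: compact_space_def)
qed

section \<open>Following an isotopy along the flow\<close>

text \<open>Quantifying over all representatives of \<open>g y\<close> avoids the choice of one and
  lets flow times add under composition.\<close>

definition flows_by :: "(('a \<times> real) set \<Rightarrow> ('a \<times> real) set) \<Rightarrow> (('a \<times> real) set \<Rightarrow> ('a \<times> real) set) \<Rightarrow>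
    (('a \<times> real) set \<Rightarrow> real) \<Rightarrow> bool" where
  "flows_by g h \<sigma> \<longleftrightarrow> (\<forall>y\<in>topspace Y. \<forall>x\<in>S. \<forall>t. g y = q (x, t) \<longrightarrow> h y = q (x, t + \<sigma> y))"

text \<open>A point returns to itself under the flow only after an integer time.\<close>

lemma flow_unique:
  assumes "x \<in> S" "q (x, t + u) = q (x, t + v)" "\<bar>u - v\<bar> < 1" shows "u = v"
  using q_close_inj[OF assms(1,1,2)] assms(3) by simp

text \<open>For a short time each track stays in one flow box. Its coordinate in \<open>X\<close>
  runs through a connected set and is constant by total disconnectedness, so the displacement is a
  difference of flow coordinates. Compactness of the suspension makes the time bound
  uniform.\<close>

lemma local_flow:
  fixes H :: "real \<times> ('a \<times> real) set \<Rightarrow> ('a \<times> real) set"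
  assumes H: "continuous_map (prod_topology euclideanreal Y) Y H"
  shows "\<exists>d>0. \<forall>a b. a \<le> s \<and> s \<le> b \<and> b - a < d \<longrightarrow>
     (\<exists>\<sigma>. continuous_map Y euclideanreal \<sigma> \<and> (\<forall>y\<in>topspace Y. \<bar>\<sigma> y\<bar> \<le> 1/4) \<and>
        flows_by (\<lambda>y. H (a, y)) (\<lambda>y. H (b, y)) \<sigma>)"
proof -
  have "\<exists>r e V. e > 0 \<and> openin Y V \<and> y \<in> V \<and> (\<forall>s' y'. \<bar>s' - s\<bar> < e \<and> y' \<in> V \<longrightarrow> H (s', y') \<in> q ` box r)"
    if y: "y \<in> topspace Y" for y
  proof -
    have "H (s, y) \<in> topspace Y" using continuous_map_funspace[OF H] y by auto
    then obtain x r where xr: "x \<in> S" "H (s, y) = q (x, r)" by (rule Y_cases)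
    have "H (s, y) \<in> q ` box r" unfolding xr(2) using xr(1) by (intro imageI) simp
    then have "(s, y) \<in> {p \<in> topspace (prod_topology euclideanreal Y). H p \<in> q ` box r}" using y by simp
    moreover have "openin (prod_topology euclideanreal Y) {p \<in> topspace (prod_topology euclideanreal Y). H p \<in> q ` box r}"
      by (rule openin_continuous_map_preimage[OF H box_open(2)])
    ultimately obtain U V where UV: "openin euclideanreal U" "openin Y V" "s \<in> U" "y \<in> V"
      "U \<times> V \<subseteq> {p \<in> topspace (prod_topology euclideanreal Y). H p \<in> q ` box r}"
      unfolding openin_prod_topology_alt by meson
    obtain e where e: "e > 0" "ball s e \<subseteq> U" using UV(1,3) by (auto simp: open_contains_ball)
    have "H (s', y') \<in> q ` box r" if "\<bar>s' - s\<bar> < e" "y' \<in> V" for s' y'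
    proof -
      have "s' \<in> U" using e(2) that(1) by (auto simp: dist_real_def abs_minus_commute)
      then show ?thesis using UV(5) that(2) by blast
    qed
    then show ?thesis using e(1) UV(2,4) by blast
  qed
  then obtain r e V where reV: "\<And>y. y \<in> topspace Y \<Longrightarrow> e y > 0 \<and> openin Y (V y) \<and> y \<in> V y \<and>
     (\<forall>s' y'. \<bar>s' - s\<bar> < e y \<and> y' \<in> V y \<longrightarrow> H (s', y') \<in> q ` box (r y))"
    by metis
  have "\<exists>\<F>. finite \<F> \<and> \<F> \<subseteq> V ` topspace Y \<and> topspace Y \<subseteq> \<Union>\<F>"
    using compact_Y reV unfolding compact_space_def compactin_def by (auto dest!: spec[of _ "V ` topspace Y"])
  then obtain P where P: "finite P" "P \<subseteq> topspace Y" "topspace Y \<subseteq> (\<Union>y\<in>P. V y)"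
    by (metis (no_types, lifting) finite_subset_image)
  define d where "d = Min (insert 1 (e ` P))"
  have d: "d > 0" "\<And>y. y \<in> P \<Longrightarrow> d \<le> e y"
    unfolding d_def using P(1,2) reV by (auto simp: Min_gr_iff)
  have "\<exists>\<sigma>. continuous_map Y euclideanreal \<sigma> \<and> (\<forall>y\<in>topspace Y. \<bar>\<sigma> y\<bar> \<le> 1/4) \<and>
        flows_by (\<lambda>y. H (a, y)) (\<lambda>y. H (b, y)) \<sigma>" if ab: "a \<le> s" "s \<le> b" "b - a < d" for a b
  proof -
    have inbox: "H (s', y') \<in> q ` box (r i)" if "a \<le> s'" "s' \<le> b" "i \<in> P" "y' \<in> V i" for s' y' i
    proof -
      have "\<bar>s' - s\<bar> < e i" using that ab d(2)[OF that(3)] by linarith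
      then show ?thesis using reV[of i] that P(2) by blast
    qed
    have "\<forall>i. \<exists>k. continuous_map (subtopology Y (q ` box (r i))) (subtopology PX (box (r i))) k \<and>
        (\<forall>y \<in> q ` box (r i). k y \<in> box (r i) \<and> q (k y) = y)"
    proof
      fix i
      obtain k where "continuous_map (subtopology Y (q ` box (r i))) (subtopology PX (box (r i))) k"
        "\<And>y. y \<in> q ` box (r i) \<Longrightarrow> k y \<in> box (r i) \<and> q (k y) = y" by (rule box_section) blast
      then show "\<exists>k. continuous_map (subtopology Y (q ` box (r i))) (subtopology PX (box (r i))) k \<and>
        (\<forall>y \<in> q ` box (r i). k y \<in> box (r i) \<and> q (k y) = y)" by blast
    qed
    then obtain k where k: "\<And>i. continuous_map (subtopology Y (q ` box (r i))) (subtopology PX (box (r i))) (k i)"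
        "\<And>i y. y \<in> q ` box (r i) \<Longrightarrow> k i y \<in> box (r i)" "\<And>i y. y \<in> q ` box (r i) \<Longrightarrow> q (k i y) = y"
      by metis
    define f where "f i y = snd (k i (H (b, y))) - snd (k i (H (a, y)))" for i y
    have VY: "V i \<subseteq> topspace Y" if "i \<in> P" for i using reV[of i] P(2) that openin_subset by blast
    have Hc: "continuous_map (subtopology Y (V i)) (subtopology Y (q ` box (r i))) (\<lambda>y. H (c, y))"
      if "i \<in> P" "a \<le> c" "c \<le> b" for i c
    proof (rule continuous_map_into_subtopology)
      have "continuous_map Y Y (\<lambda>y. H (c, y))"
        using continuous_map_o_Pair[OF H, of c] by (simp add: o_def)
      then show "continuous_map (subtopology Y (V i)) Y (\<lambda>y. H (c, y))"
        by (rule continuous_map_from_subtopology)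
      show "(\<lambda>y. H (c, y)) \<in> topspace (subtopology Y (V i)) \<rightarrow> q ` box (r i)"
        using inbox[OF that(2,3,1)] by auto
    qed
    have fc: "continuous_map (subtopology Y (V i)) euclideanreal (f i)" if i: "i \<in> P" for i
    proof -
      have s1: "continuous_map (subtopology PX (box (r i))) euclideanreal snd"
        by (rule continuous_map_from_subtopology[OF continuous_map_snd])
      have "continuous_map (subtopology Y (V i)) euclideanreal (snd \<circ> (k i \<circ> (\<lambda>y. H (c, y))))"
        if "a \<le> c" "c \<le> b" for c
        by (rule continuous_map_compose[OF continuous_map_compose[OF Hc[OF i that] k(1)] s1])
      from continuous_map_diff[OF this[of b] this[of a]] show ?thesis
        unfolding f_def using ab by (simp add: o_def)
    qed
    have flow: "\<bar>f i y\<bar> < 1/4 \<and> (\<forall>x\<in>S. \<forall>t. H (a, y) = q (x, t) \<longrightarrow> H (b, y) = q (x, t + f i y))"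
      if i: "i \<in> P" and y: "y \<in> V i" for i y
    proof -
      have yY: "y \<in> topspace Y" using y VY[OF i] by blast
      let ?c = "\<lambda>s. fst (k i (H (s, y)))"
      have "continuous_map (top_of_set {a..b}) (subtopology Y (q ` box (r i))) (\<lambda>s. H (s, y))"
      proof (rule continuous_map_into_subtopology)
        have "continuous_map euclideanreal (prod_topology euclideanreal Y) (\<lambda>s. (s, y))"
          by (intro continuous_map_pairedI) (use yY in auto)
        from continuous_map_compose[OF this H] show "continuous_map (top_of_set {a..b}) Y (\<lambda>s. H (s, y))"
          by (simp add: o_def continuous_map_from_subtopology)
        show "(\<lambda>s. H (s, y)) \<in> topspace (top_of_set {a..b}) \<rightarrow> q ` box (r i)"
          using inbox[OF _ _ i y] by auto
      qed
      from continuous_map_compose[OF continuous_map_compose[OF this k(1)[of i]]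
          continuous_map_from_subtopology[OF continuous_map_fst]]
      have "continuous_map (top_of_set {a..b}) X ?c" by (simp add: o_def)
      moreover have "connectedin (top_of_set {a..b}) {a..b}" by (simp add: connectedin_subtopology)
      ultimately have "connectedin X (?c ` {a..b})" by (rule connectedin_continuous_map_image)
      then obtain z where "?c ` {a..b} \<subseteq> {z}" using td unfolding totally_disconnected_space_def by blast
      then have "?c s' = z" if "s' \<in> {a..b}" for s' using that by blast
      then have z: "?c a = z" "?c b = z" using ab by simp_all
      note ia = inbox[OF order_refl _ i y] and ib = inbox[OF _ order_refl i y]
      have ab': "a \<le> b" using ab by simp
      define \<alpha> \<beta> where "\<alpha> = snd (k i (H (a, y)))" and "\<beta> = snd (k i (H (b, y)))"
      have kab: "k i (H (a, y)) = (z, \<alpha>)" "k i (H (b, y)) = (z, \<beta>)"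
        using z unfolding \<alpha>_def \<beta>_def by (auto simp: prod_eq_iff)
      have mem: "(z, \<alpha>) \<in> box (r i)" "(z, \<beta>) \<in> box (r i)"
        using k(2)[OF ia[OF ab']] k(2)[OF ib[OF ab']] unfolding kab by auto
      have eq: "H (a, y) = q (z, \<alpha>)" "H (b, y) = q (z, \<beta>)"
        using k(3)[OF ia[OF ab']] k(3)[OF ib[OF ab']] unfolding kab by auto
      have fi: "f i y = \<beta> - \<alpha>" unfolding f_def \<alpha>_def \<beta>_def ..
      have "H (b, y) = q (x, t + f i y)" if xt: "x \<in> S" "H (a, y) = q (x, t)" for x t
      proof -
        obtain n where n: "x = it n z" "t = \<alpha> - of_int n"
          using q_eq[of z x \<alpha> t] mem(1) xt eq(1) by auto
        have "t + f i y = \<beta> - of_int n" using n(2) fi by simp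
        then show ?thesis unfolding n(1) eq(2) using q_shift[of z n \<beta>] mem by simp
      qed
      moreover have "\<bar>f i y\<bar> < 1/4"
      proof -
        have "r i - 1/8 < \<alpha>" "\<alpha> < r i + 1/8" "r i - 1/8 < \<beta>" "\<beta> < r i + 1/8" using mem by simp_all
        then show ?thesis unfolding fi by linarith
      qed
      ultimately show ?thesis by blast
    qed
    obtain \<sigma> where \<sigma>: "continuous_map Y euclideanreal \<sigma>"
      "\<And>y i. i \<in> P \<Longrightarrow> y \<in> topspace Y \<inter> V i \<Longrightarrow> \<sigma> y = f i y"
    proof (rule pasting_lemma_exists[where X = Y and I = P and T = V and Y = euclideanreal and f = f])
      show "openin Y (V i)" if "i \<in> P" for i using reV[of i] P(2) that by blast
      \<comment> \<open>On an overlap both displacements are below 1/4 and join the same two points,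
        so they coincide.\<close>
      show "f i y = f j y" if "i \<in> P" "j \<in> P" "y \<in> topspace Y \<inter> V i \<inter> V j" for i j y
      proof -
        have "H (a, y) \<in> topspace Y" using continuous_map_funspace[OF H] that(3) by auto
        then obtain x t where x: "x \<in> S" "H (a, y) = q (x, t)" by (rule Y_cases)
        have "\<bar>f i y\<bar> < 1/4" "\<bar>f j y\<bar> < 1/4" "H (b, y) = q (x, t + f i y)" "H (b, y) = q (x, t + f j y)"
          using flow[of i y] flow[of j y] that x by auto
        then show ?thesis by (intro flow_unique[OF x(1), of t]) auto
      qed
    qed (use P(3) fc in auto)
    have cov: "\<exists>i\<in>P. y \<in> V i" if "y \<in> topspace Y" for y using P(3) that by blast
    have "\<bar>\<sigma> y\<bar> \<le> 1/4" if yY: "y \<in> topspace Y" for y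
    proof -
      obtain i where i: "i \<in> P" "y \<in> V i" using cov[OF yY] by blast
      then show ?thesis using \<sigma>(2)[OF i(1), of y] flow[OF i] yY by simp
    qed
    moreover have "flows_by (\<lambda>y. H (a, y)) (\<lambda>y. H (b, y)) \<sigma>"
      unfolding flows_by_def
    proof (intro ballI allI impI)
      fix y x t assume H: "y \<in> topspace Y" "x \<in> S" "H (a, y) = q (x, t)"
      obtain i where i: "i \<in> P" "y \<in> V i" using cov[OF H(1)] by blast
      then show "H (b, y) = q (x, t + \<sigma> y)" using \<sigma>(2)[OF i(1), of y] flow[OF i] H by simp
    qed
    ultimately show ?thesis using \<sigma>(1) by blast
  qed
  then show ?thesis using d(1) by blast
qed

text \<open>Displacements over adjacent time intervals add, so bisection extends the short-time
  statement to the whole isotopy. The bound \<open>B\<close> is carried along because it later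
  forces the lift to be increasing and onto.\<close>

lemma isotopy_flow:
  assumes "isotopic_to_identity Y g"
  obtains \<sigma> B where "continuous_map Y euclideanreal \<sigma>" "\<And>y. y \<in> topspace Y \<Longrightarrow> \<bar>\<sigma> y\<bar> \<le> B"
    "\<And>x t. x \<in> S \<Longrightarrow> g (q (x, t)) = q (x, t + \<sigma> (q (x, t)))"
proof -
  obtain h where h: "continuous_map (prod_topology (top_of_set {0..1::real}) Y) Y h"
    "\<And>y. h (0, y) = y" "\<And>y. h (1, y) = g y"
    using assms unfolding isotopic_to_identity_def homotopic_with_def by auto
  \<comment> \<open>Clamping extends the isotopy to all real times, so that bisection can use
    intervals around the ends 0 and 1 as well.\<close>
  define H where "H = (\<lambda>p. h (max 0 (min 1 (fst p)), snd p))"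
  have H: "continuous_map (prod_topology euclideanreal Y) Y H"
  proof -
    have "continuous_map (prod_topology euclideanreal Y) euclideanreal (\<lambda>p. max 0 (min 1 (fst p)))"
      by (intro continuous_map_real_max continuous_map_real_min continuous_map_fst) auto
    then have "continuous_map (prod_topology euclideanreal Y) (top_of_set {0..1}) (\<lambda>p. max 0 (min 1 (fst p)))"
      by (auto simp: continuous_map_in_subtopology)
    from continuous_map_compose[OF continuous_map_pairedI[OF this continuous_map_snd] h(1)]
    show ?thesis unfolding H_def by (simp add: o_def)
  qed
  define P where "P a b \<longleftrightarrow> (\<exists>\<sigma> B. continuous_map Y euclideanreal \<sigma> \<and> (\<forall>y\<in>topspace Y. \<bar>\<sigma> y\<bar> \<le> B) \<and>
        flows_by (\<lambda>y. H (a, y)) (\<lambda>y. H (b, y)) \<sigma>)" for a b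
  have "P 0 1"
  proof (rule Bolzano[of 0 1 P])
    fix a b c assume "P a b" "P b c"
    then obtain \<sigma> B \<tau> C where st: "continuous_map Y euclideanreal \<sigma>" "\<forall>y\<in>topspace Y. \<bar>\<sigma> y\<bar> \<le> B"
      "flows_by (\<lambda>y. H (a, y)) (\<lambda>y. H (b, y)) \<sigma>"
      "continuous_map Y euclideanreal \<tau>" "\<forall>y\<in>topspace Y. \<bar>\<tau> y\<bar> \<le> C"
      "flows_by (\<lambda>y. H (b, y)) (\<lambda>y. H (c, y)) \<tau>" unfolding P_def by blast
    have "flows_by (\<lambda>y. H (a, y)) (\<lambda>y. H (c, y)) (\<lambda>y. \<sigma> y + \<tau> y)"
      unfolding flows_by_def
    proof (intro ballI allI impI)
      fix y x t assume y: "y \<in> topspace Y" "x \<in> S" "H (a, y) = q (x, t)"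
      then have "H (b, y) = q (x, t + \<sigma> y)" using st(3) unfolding flows_by_def by blast
      then have "H (c, y) = q (x, t + \<sigma> y + \<tau> y)" using st(6) y unfolding flows_by_def by blast
      then show "H (c, y) = q (x, t + (\<sigma> y + \<tau> y))" by (simp only: add.assoc)
    qed
    moreover have "continuous_map Y euclideanreal (\<lambda>y. \<sigma> y + \<tau> y)" by (rule continuous_map_add[OF st(1,4)])
    moreover have "\<forall>y\<in>topspace Y. \<bar>\<sigma> y + \<tau> y\<bar> \<le> B + C"
    proof
      fix y assume "y \<in> topspace Y"
      then have "\<bar>\<sigma> y\<bar> \<le> B" "\<bar>\<tau> y\<bar> \<le> C" using st(2,5) by blast+
      then show "\<bar>\<sigma> y + \<tau> y\<bar> \<le> B + C" by linarith
    qed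
    ultimately show "P a c" unfolding P_def by (intro exI[of _ "\<lambda>y. \<sigma> y + \<tau> y"] exI[of _ "B + C"] conjI)
  next
    fix s :: real
    show "\<exists>d>0. \<forall>a b. a \<le> s \<and> s \<le> b \<and> b - a < d \<longrightarrow> P a b"
    proof -
      obtain d where d: "d > 0" "\<And>a b. a \<le> s \<and> s \<le> b \<and> b - a < d \<Longrightarrow>
        (\<exists>\<sigma>. continuous_map Y euclideanreal \<sigma> \<and> (\<forall>y\<in>topspace Y. \<bar>\<sigma> y\<bar> \<le> 1/4) \<and>
        flows_by (\<lambda>y. H (a, y)) (\<lambda>y. H (b, y)) \<sigma>)"
        using local_flow[OF H, of s] by (elim exE conjE) blast
      have "P a b" if "a \<le> s \<and> s \<le> b \<and> b - a < d" for a b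
        using d(2)[OF that] unfolding P_def by (elim exE) (rule exI, rule exI)
      then show ?thesis using d(1) by blast
    qed
  qed simp
  then obtain \<sigma> B where s: "continuous_map Y euclideanreal \<sigma>" "\<forall>y\<in>topspace Y. \<bar>\<sigma> y\<bar> \<le> B"
      "flows_by (\<lambda>y. H (0, y)) (\<lambda>y. H (1, y)) \<sigma>" unfolding P_def by blast
  have "g (q (x, t)) = q (x, t + \<sigma> (q (x, t)))" if "x \<in> S" for x t
  proof -
    have H01: "H (0, y) = y" "H (1, y) = g y" for y unfolding H_def using h(2,3) by simp_all
    have "q (x, t) \<in> topspace Y" by (rule q_in[OF that])
    then have "H (1, q (x, t)) = q (x, t + \<sigma> (q (x, t)))"
      using s(3) that H01(1) unfolding flows_by_def by blast
    then show ?thesis unfolding H01 .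
  qed
  then show thesis using that s(1,2) by blast
qed

text \<open>A continuous injection of the line is monotone. Bounded distance from the identity rules
  out the decreasing case and, with the intermediate value theorem, gives surjectivity.\<close>

lemma injective_bounded_strict_mono:
  fixes f :: "real \<Rightarrow> real"
  assumes c: "continuous_on UNIV f" and inj: "inj f" and B: "\<And>t. \<bar>f t - t\<bar> \<le> B"
  shows "strict_mono f" "surj f"
proof -
  show "strict_mono f"
  proof (rule strict_monoI)
    fix t u :: real assume tu: "t < u"
    define a b where "a = t - 2 * B - 1" and "b = u + 2 * B + 1"
    have "0 \<le> B" using B[of 0] by linarith
    then have ab: "a < t" "u < b" unfolding a_def b_def by simp_all
    have "f a < f b" using B[of a] B[of b] tu \<open>0 \<le> B\<close> unfolding a_def b_def by linarith
    moreover have "(f a < f t \<and> f t < f b) \<or> (f b < f t \<and> f t < f a)"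
      by (rule continuous_inj_imp_mono) (use ab tu inj c in \<open>auto intro: continuous_on_subset inj_on_subset\<close>)
    ultimately have "f t < f b" by linarith
    moreover have "(f t < f u \<and> f u < f b) \<or> (f b < f u \<and> f u < f t)"
      by (rule continuous_inj_imp_mono) (use ab tu inj c in \<open>auto intro: continuous_on_subset inj_on_subset\<close>)
    ultimately show "f t < f u" by linarith
  qed
  have "\<exists>t. f t = v" for v
  proof -
    have "f (v - B) \<le> v" "v \<le> f (v + B)" "v - B \<le> v + B" using B[of "v - B"] B[of "v + B"] by linarith+
    then show ?thesis using IVT'[of f "v - B" v "v + B"] continuous_on_subset[OF c] by blast
  qed
  then show "surj f" by (metis surjI)
qed

section \<open>Lifting an arbitrary element\<close>

text \<open>If \<open>r\<close> is no listed breakpoint, a neighbourhood lies in one affine piece,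
  which determines both germs. Otherwise \<open>r\<close> is dyadic, a piece ends there on either
  side, and continuity fits the value.\<close>

lemma PL_germ:
  assumes PL: "dyadic_PL_homeo {a<..<b} K f" and r: "a < r" "r < b" shows "dgerm f r" "isCont f r"
proof -
  note PL' = PL[unfolded dyadic_PL_homeo_def]
  have J: "homeomorphic_map (top_of_set {a<..<b}) (top_of_set K) f"
    by (rule conjunct1[OF conjunct2[OF conjunct2[OF PL']]])
  obtain B where BB: "finite B \<and> B \<subseteq> dyad \<and>
      (\<forall>I\<in>components ({a<..<b} - B). \<exists>m::int. \<exists>c\<in>dyad. \<forall>t\<in>I. f t = 2 powi m * t + c)"
    using conjunct2[OF conjunct2[OF conjunct2[OF PL']]] by (elim exE)
  note B = conjunct1[OF BB] conjunct1[OF conjunct2[OF BB]] bspec[OF conjunct2[OF conjunct2[OF BB]]]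
  have "continuous_on {a<..<b} f"
    using homeomorphic_imp_continuous_map[OF J] by (simp add: continuous_map_in_subtopology)
  then show fc: "isCont f r" using r by (simp add: continuous_on_eq_continuous_at)
  obtain d where d: "d > 0" "\<And>x. x \<in> B \<Longrightarrow> x \<noteq> r \<Longrightarrow> d \<le> dist r x"
    using finite_set_avoid[OF B(1), of r] by blast
  define e where "e = min d (min (r - a) (b - r))"
  have e: "e > 0" "e \<le> d" "r - e \<ge> a" "r + e \<le> b" unfolding e_def using d(1) r by auto
  have noB: "x \<notin> B" if "\<bar>x - r\<bar> < e" "x \<noteq> r" for x
    using d(2)[of x] that e(2) by (auto simp: dist_real_def)
  have piece: "\<exists>m::int. \<exists>c\<in>dyad. \<forall>t\<in>I. f t = 2 powi m * t + c"
    if I: "connected I" "I \<subseteq> {a<..<b} - B" "I \<noteq> {}" for I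
  proof -
    have "{a<..<b} - B \<noteq> {}" using I(2,3) by blast
    then obtain C where "C \<in> components ({a<..<b} - B)" "I \<subseteq> C"
      using exists_component_superset[OF I(2) _ I(1)] by blast
    then show ?thesis using B(3)[of C] by blast
  qed
  have lin: "isCont (\<lambda>t. 2 powi m * t + c) r" for m :: int and c :: real by (intro continuous_intros)
  have open_piece: "\<exists>m::int. \<exists>c\<in>dyad. \<forall>t\<in>{u<..<v}. f t = 2 powi m * t + c"
    if uv: "u < v" "r - e \<le> u" "v \<le> r + e" "r \<notin> B \<or> r \<notin> {u<..<v}" for u v
  proof (rule piece)
    show "{u<..<v} \<subseteq> {a<..<b} - B"
    proof
      fix t assume t: "t \<in> {u<..<v}"
      then have "r - e < t" "t < r + e" using uv by auto
      then have "\<bar>t - r\<bar> < e" "a < t" "t < b" using e(3,4) by linarith+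
      then show "t \<in> {a<..<b} - B" using noB[of t] uv(4) t by (cases "t = r") auto
    qed
  qed (use uv(1) in auto)
  obtain m c where "c \<in> dyad" "\<forall>t\<in>{r<..<r + e}. f t = 2 powi m * t + c"
  proof -
    have "\<exists>m::int. \<exists>c\<in>dyad. \<forall>t\<in>{r<..<r + e}. f t = 2 powi m * t + c"
      by (rule open_piece) (use e(1) in simp_all)
    then show thesis using that by blast
  qed
  then have R: "c \<in> dyad" "\<And>t. r < t \<Longrightarrow> t < r + e \<Longrightarrow> f t = 2 powi m * t + c" by auto
  obtain m' c' where "c' \<in> dyad" "\<forall>t\<in>{r - e<..<r}. f t = 2 powi m' * t + c'"
  proof -
    have "\<exists>m::int. \<exists>c\<in>dyad. \<forall>t\<in>{r - e<..<r}. f t = 2 powi m * t + c"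
      by (rule open_piece) (use e(1) in simp_all)
    then show thesis using that by blast
  qed
  then have L: "c' \<in> dyad" "\<And>t. r - e < t \<Longrightarrow> t < r \<Longrightarrow> f t = 2 powi m' * t + c'" by auto
  \<comment> \<open>The pieces do not contain \<open>r\<close> when it is a breakpoint, so its value
    is obtained as a one-sided limit.\<close>
  have Rr: "f r = 2 powi m * r + c"
  proof (rule tendsto_unique[of "at_right r"])
    show "(f \<longlongrightarrow> f r) (at_right r)" by (rule tendsto_mono[OF at_le[OF subset_UNIV] fc[unfolded isCont_def]])
    have "((\<lambda>t. 2 powi m * t + c) \<longlongrightarrow> 2 powi m * r + c) (at_right r)" by (intro tendsto_intros)
    moreover have "\<forall>\<^sub>F t in at_right r. 2 powi m * t + c = f t"
      unfolding eventually_at_right_field using R(2) e(1) by (intro exI[of _ "r + e"]) auto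
    ultimately show "(f \<longlongrightarrow> 2 powi m * r + c) (at_right r)" by (rule Lim_transform_eventually)
  qed simp
  have Lr: "f r = 2 powi m' * r + c'"
  proof (rule tendsto_unique[of "at_left r"])
    show "(f \<longlongrightarrow> f r) (at_left r)" by (rule tendsto_mono[OF at_le[OF subset_UNIV] fc[unfolded isCont_def]])
    have "((\<lambda>t. 2 powi m' * t + c') \<longlongrightarrow> 2 powi m' * r + c') (at_left r)" by (intro tendsto_intros)
    moreover have "\<forall>\<^sub>F t in at_left r. 2 powi m' * t + c' = f t"
      unfolding eventually_at_left_field using L(2) e(1) by (intro exI[of _ "r - e"]) auto
    ultimately show "(f \<longlongrightarrow> 2 powi m' * r + c') (at_left r)" by (rule Lim_transform_eventually)
  qed simp
  have rg: "rgerm f r n" if "\<And>t. r < t \<Longrightarrow> t < r + e \<Longrightarrow> f t = 2 powi n * t + k" "f r = 2 powi n * r + k" for n k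
    unfolding rgerm_def
  proof (intro exI[of _ e] conjI allI impI)
    fix s assume "r \<le> s \<and> s < r + e"
    then have "f s = 2 powi n * s + k" using that by (cases "s = r") auto
    then show "f s = f r + 2 powi n * (s - r)" unfolding that(2) by (simp add: right_diff_distrib)
  qed (rule e(1))
  have lg: "lgerm f r n" if "\<And>t. r - e < t \<Longrightarrow> t < r \<Longrightarrow> f t = 2 powi n * t + k" "f r = 2 powi n * r + k" for n k
    unfolding lgerm_def
  proof (intro exI[of _ e] conjI allI impI)
    fix s assume "r - e < s \<and> s \<le> r"
    then have "f s = 2 powi n * s + k" using that by (cases "s = r") auto
    then show "f s = f r + 2 powi n * (s - r)" unfolding that(2) by (simp add: right_diff_distrib)
  qed (rule e(1))
  show "dgerm f r"
  proof (cases "r \<in> B")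
    case True
    then have "r \<in> dyad" using B(2) by blast
    moreover have "f r \<in> dyad" unfolding Rr using R(1) \<open>r \<in> dyad\<close> by blast
    ultimately show ?thesis unfolding dgerm_def using rg[OF R(2) Rr] lg[OF L(2) Lr] by auto
  next
    case False
    obtain n k where "k \<in> dyad" "\<forall>t\<in>{r - e<..<r + e}. f t = 2 powi n * t + k"
    proof -
      have "\<exists>m::int. \<exists>c\<in>dyad. \<forall>t\<in>{r - e<..<r + e}. f t = 2 powi m * t + c"
        by (rule open_piece) (use e(1) False in simp_all)
      then show thesis using that by blast
    qed
    then have k: "k \<in> dyad" "\<And>t. r - e < t \<Longrightarrow> t < r + e \<Longrightarrow> f t = 2 powi n * t + k" by auto
    have fr: "f r = 2 powi n * r + k" using k(2) e(1) by simp
    have "rgerm f r n" "lgerm f r n" using rg[OF _ fr] lg[OF _ fr] k(2) e(1) by auto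
    moreover have "f r - 2 powi n * r \<in> dyad" unfolding fr using k(1) by simp
    moreover have "f r \<in> dyad" if "r \<in> dyad" unfolding fr using k(1) that by blast
    ultimately show ?thesis unfolding dgerm_def by (intro exI[of _ n]) auto
  qed
qed

text \<open>In a chart, \<open>F z s\<close> and \<open>f s\<close> name the same point over
  \<open>z\<close>, so they differ by an integer. By continuity of \<open>F\<close> this integer is
  constant nearby, and then germs and local constancy pass from \<open>f\<close> to
  \<open>F\<close>.\<close>

lemma T_set_local:
  assumes T: "g \<in> T_set X \<phi>"
    and sc: "continuous_map PX euclideanreal (\<lambda>p. F (fst p) (snd p))"
    and eq: "\<And>x t. x \<in> S \<Longrightarrow> F (\<phi> x) t = F x (t + 1) - 1"
    and g: "\<And>x t. x \<in> S \<Longrightarrow> g (q (x, t)) = q (x, F x t)"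
    and x: "x \<in> S"
  shows "dgerm (F x) t"
    "\<exists>U e. openin X U \<and> x \<in> U \<and> e > 0 \<and> (\<forall>y\<in>U. \<forall>s. \<bar>s - t\<bar> < e \<longrightarrow> F y s = F x s)"
proof -
  have eqn: "F (it n y) s = F y (s + of_int n) - of_int n" if "y \<in> S" for n y s
  proof (induction n arbitrary: s rule: int_induct[where k = 0])
    case base
    then show ?case by simp
  next
    case (step1 i)
    have "F (it (i + 1) y) s = F (it i y) (s + 1) - 1" using eq[of "it i y"] that it_step by simp
    then show ?case unfolding step1(2) by (simp add: algebra_simps)
  next
    case (step2 i)
    have "F (it i y) (s - 1) = F (it (i - 1) y) s - 1"
      using eq[of "it (i - 1) y" "s - 1"] that it_step[OF that, of "i - 1"] by simp
    then show ?case unfolding step2(2) by (simp add: algebra_simps)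
  qed
  have "\<forall>y\<in>topspace Y. \<exists>C J f.
     chart X \<phi> C J \<and> dyadic_interval J \<and> y \<in> chart_domain X \<phi> C J \<and>
     dyadic_PL_homeo J (f ` J) f \<and> chart X \<phi> C (f ` J) \<and>
     g ` chart_domain X \<phi> C J = chart_domain X \<phi> C (f ` J) \<and>
     (\<forall>x\<in>C. \<forall>t\<in>J. inv_into (C \<times> f ` J) q (g (q (x, t))) = (x, f t))"
    using T unfolding T_set_def mem_Collect_eq by (rule conjunct2)
  from bspec[OF this q_in[OF x, of t]] obtain C J f where chA:
     "chart X \<phi> C J \<and> dyadic_interval J \<and> q (x, t) \<in> chart_domain X \<phi> C J \<and>
     dyadic_PL_homeo J (f ` J) f \<and> chart X \<phi> C (f ` J) \<and>
     g ` chart_domain X \<phi> C J = chart_domain X \<phi> C (f ` J) \<and>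
     (\<forall>x\<in>C. \<forall>t\<in>J. inv_into (C \<times> f ` J) q (g (q (x, t))) = (x, f t))"
    by (elim exE)
  note c3 = conjunct2[OF conjunct2[OF chA]] and c5 = conjunct2[OF conjunct2[OF conjunct2[OF conjunct2[OF chA]]]]
  note ch = conjunct1[OF chA] conjunct1[OF conjunct2[OF chA]] conjunct1[OF c3] conjunct1[OF conjunct2[OF c3]]
    conjunct1[OF c5] conjunct1[OF conjunct2[OF c5]] bspec[OF bspec[OF conjunct2[OF conjunct2[OF c5]]]]
  obtain a b where ab: "a < b" "J = {a<..<b}" using ch(1) unfolding chart_def by blast
  have C: "openin X C" "C \<subseteq> S" using ch(1) unfolding chart_def by (auto dest: openin_subset)
  obtain c r where cr: "c \<in> C" "r \<in> J" "q (x, t) = q (c, r)" using ch(3) unfolding chart_domain_def by auto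
  then obtain n where n: "c = it n x" "r = t - of_int n" using q_eq[OF x, of c t r] C(2) by auto
  have fint: "\<exists>m::int. F z s = f s + of_int m" if z: "z \<in> C" and s: "s \<in> J" for z s
  proof -
    \<comment> \<open>The image equation for chart domains enters here: \<open>inv_into\<close> is a
      right inverse only on the image.\<close>
    have "q (z, s) \<in> chart_domain X \<phi> C J" unfolding chart_domain_def using z s by blast
    then have "g (q (z, s)) \<in> g ` chart_domain X \<phi> C J" by (rule imageI)
    then have "g (q (z, s)) \<in> chart_domain X \<phi> C (f ` J)" unfolding ch(6) .
    then have "g (q (z, s)) \<in> q ` (C \<times> f ` J)" unfolding chart_domain_def .
    from f_inv_into_f[OF this] have "q (z, f s) = q (z, F z s)"
      unfolding ch(7)[OF z s] using g[of z s] C(2) z by auto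
    then obtain m where "F z s = f s - of_int m" using q_eq[of z z "f s" "F z s"] C(2) z by auto
    then have "F z s = f s + of_int (- m)" by simp
    then show ?thesis ..
  qed
  obtain k :: int where k: "F c r = f r + of_int k" using fint[OF cr(1,2)] by blast
  have fcont: "isCont f s" if "s \<in> J" for s
    using PL_germ(2)[OF ch(4)[unfolded ab(2)], of s] that unfolding ab(2) by simp
  have fJ: "continuous_map (subtopology PX (C \<times> J)) euclideanreal (\<lambda>p. f (snd p))"
  proof -
    have "continuous_on J f" using fcont by (simp add: continuous_at_imp_continuous_on)
    then have fc: "continuous_map (top_of_set J) euclideanreal f" by simp
    have "continuous_map (subtopology PX (C \<times> J)) (top_of_set J) snd"
      by (rule continuous_map_into_subtopology[OF continuous_map_from_subtopology[OF continuous_map_snd]]) auto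
    from continuous_map_compose[OF this fc] show ?thesis by (simp add: o_def)
  qed
  have CJ: "openin PX (C \<times> J)" using C(1) unfolding ab(2) by (simp add: openin_prod_Times_iff)
  \<comment> \<open>This difference takes integer values on the chart, so being within distance 1 of
    \<open>k\<close> means being equal to \<open>k\<close>.\<close>
  let ?D = "\<lambda>p. F (fst p) (snd p) - f (snd p)"
  have "continuous_map (subtopology PX (C \<times> J)) euclideanreal ?D"
    by (rule continuous_map_diff[OF continuous_map_from_subtopology[OF sc] fJ])
  then have "openin (subtopology PX (C \<times> J)) {p \<in> topspace (subtopology PX (C \<times> J)). ?D p \<in> ball (of_int k) 1}"
    by (rule openin_continuous_map_preimage) simp
  then have W: "openin PX {p \<in> topspace (subtopology PX (C \<times> J)). ?D p \<in> ball (of_int k) 1}" (is "openin PX ?W")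
    using openin_trans_full[OF _ CJ] by blast
  have "(c, r) \<in> ?W" using cr(1,2) C(2) k by auto
  then obtain U V where UV: "openin X U" "openin euclideanreal V" "c \<in> U" "r \<in> V" "U \<times> V \<subseteq> ?W"
    using W unfolding openin_prod_topology_alt by meson
  obtain e where e: "e > 0" "ball r e \<subseteq> V" using UV(2,4) by (auto simp: open_contains_ball)
  have loc: "F z s = f s + of_int k \<and> s \<in> J" if "z \<in> U" "\<bar>s - r\<bar> < e" for z s
  proof -
    have "s \<in> V" using e(2) that(2) by (auto simp: dist_real_def abs_minus_commute)
    then have zs: "(z, s) \<in> ?W" using UV(5) that(1) by blast
    then have m: "z \<in> C" "s \<in> J" "\<bar>F z s - f s - of_int k\<bar> < 1" by (auto simp: dist_real_def abs_minus_commute)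
    obtain m :: int where "F z s = f s + of_int m" using fint[OF m(1,2)] by blast
    then have "\<bar>real_of_int (m - k)\<bar> < 1" using m(3) by simp
    then have "m = k" by linarith
    then show ?thesis using \<open>F z s = f s + of_int m\<close> m(2) by simp
  qed
  \<comment> \<open>The chart contains the representative \<open>(c, r)\<close>, which is
    \<open>(x, t)\<close> moved by \<open>n\<close>; neighbourhoods are therefore pulled back along
    \<open>it n\<close>.\<close>
  define O' where "O' = {y \<in> S. it n y \<in> U}"
  have O': "openin X O'" "x \<in> O'" unfolding O'_def
    using openin_continuous_map_preimage[OF it_cont UV(1)] x UV(3) n(1) by auto
  have Fy: "F y s = f (s - of_int n) + of_int (k + n)" if "y \<in> O'" "\<bar>s - t\<bar> < e" for y s
  proof -
    have y: "y \<in> S" "it n y \<in> U" using that(1) unfolding O'_def by auto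
    have "F (it n y) (s - of_int n) = F y s - of_int n" using eqn[OF y(1), of n "s - of_int n"] by simp
    moreover have "F (it n y) (s - of_int n) = f (s - of_int n) + of_int k"
      using loc[OF y(2), of "s - of_int n"] that(2) n(2) by simp
    ultimately show ?thesis by simp
  qed
  show "\<exists>U e. openin X U \<and> x \<in> U \<and> e > 0 \<and> (\<forall>y\<in>U. \<forall>s. \<bar>s - t\<bar> < e \<longrightarrow> F y s = F x s)"
    using O' e(1) Fy by (intro exI[of _ O'] exI[of _ e]) simp
  have "dgerm f r" by (rule PL_germ(1)[OF ch(4)[unfolded ab(2)]]) (use cr(2) ab(2) in auto)
  then show "dgerm (F x) t"
  proof (rule dgerm_cong[OF _ e(1), where c = n and d = "k + n"])
    fix s assume "\<bar>s - r\<bar> < e"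
    then show "F x (s + of_int n) = f s + of_int (k + n)" using Fy[OF O'(2), of "s + of_int n"] n(2) by simp
  qed (use n(2) in simp)
qed

text \<open>The displacement \<open>\<sigma>\<close> is a function on the suspension itself, so
  \<open>t + \<sigma> (q (x, t))\<close> is equivariant without further choices. If two times have
  the same image under \<open>F x\<close>, injectivity of \<open>g\<close> identifies their classes,
  hence their displacements, hence the times.\<close>

theorem T_set_lift:
  assumes T: "g \<in> T_set X \<phi>" obtains F where "PL_lift F" "g = flow_map F"
proof -
  have H0: "g \<in> extensional (topspace Y)" "homeomorphic_map Y Y g" "isotopic_to_identity Y g"
    using T unfolding T_set_def H0_def by blast+
  obtain \<sigma> B where s: "continuous_map Y euclideanreal \<sigma>" "\<And>y. y \<in> topspace Y \<Longrightarrow> \<bar>\<sigma> y\<bar> \<le> B"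
    "\<And>x t. x \<in> S \<Longrightarrow> g (q (x, t)) = q (x, t + \<sigma> (q (x, t)))"
    by (rule isotopy_flow[OF H0(3)]) blast
  define F where "F x t = t + \<sigma> (q (x, t))" for x t
  have gF: "g (q (x, t)) = q (x, F x t)" if "x \<in> S" for x t using s(3)[OF that] unfolding F_def .
  have sc: "continuous_map PX euclideanreal (\<lambda>p. F (fst p) (snd p))"
    using continuous_map_add[OF continuous_map_snd continuous_map_compose[OF q_cont s(1)]]
    unfolding F_def by (simp add: o_def)
  have eq: "F (\<phi> x) t = F x (t + 1) - 1" if "x \<in> S" for x t
    using q_shift[OF that, of 1 "t + 1"] it_step[OF that, of 0] unfolding F_def by simp
  have F: "strict_mono (F x) \<and> surj (F x)" if x: "x \<in> S" for x
  proof -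
    have "continuous_map euclideanreal PX (\<lambda>t. (x, t))" by (intro continuous_map_pairedI) (use x in auto)
    from continuous_map_compose[OF this sc] have c: "continuous_on UNIV (F x)" by (simp add: o_def)
    have "inj (F x)"
    proof (rule injI)
      fix t u assume tu: "F x t = F x u"
      then have "g (q (x, t)) = g (q (x, u))" using gF[OF x] by simp
      then have "q (x, t) = q (x, u)"
        using homeomorphic_imp_injective_map[OF H0(2)] q_in[OF x] by (meson inj_onD)
      then show "t = u" using tu unfolding F_def by simp
    qed
    moreover have "\<bar>F x t - t\<bar> \<le> B" for t unfolding F_def using s(2)[OF q_in[OF x]] by simp
    ultimately show ?thesis using injective_bounded_strict_mono[OF c] by blast
  qed
  have loc1: "dgerm (F x) t" if "x \<in> S" for x t
    by (rule T_set_local(1)[OF T sc]) (erule eq, erule gF, rule that)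
  have loc2: "\<exists>U e. openin X U \<and> x \<in> U \<and> e > 0 \<and> (\<forall>y\<in>U. \<forall>s. \<bar>s - t\<bar> < e \<longrightarrow> F y s = F x s)"
    if "x \<in> S" for x t
    by (rule T_set_local(2)[OF T sc]) (erule eq, erule gF, rule that)
  have "flow_lift F"
  proof (rule flow_liftI)
    fix x assume x: "x \<in> S"
    show "strict_mono (F x)" "surj (F x)" "\<And>t. F (\<phi> x) t = F x (t + 1) - 1" using F[OF x] eq[OF x] by auto
    fix K :: real
    \<comment> \<open>Local constancy near each single time extends to the window by
      bisection.\<close>
    define P where "P a b \<longleftrightarrow> (\<exists>U. openin X U \<and> x \<in> U \<and> (\<forall>y\<in>U. \<forall>t. a \<le> t \<and> t \<le> b \<longrightarrow> F y t = F x t))" for a b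
    have "P (- \<bar>K\<bar>) \<bar>K\<bar>"
    proof (rule Bolzano[of "- \<bar>K\<bar>" "\<bar>K\<bar>" P])
      fix a b c assume "P a b" "P b c"
      then obtain U V where U: "openin X U" "x \<in> U" "\<forall>y\<in>U. \<forall>t. a \<le> t \<and> t \<le> b \<longrightarrow> F y t = F x t"
        and V: "openin X V" "x \<in> V" "\<forall>y\<in>V. \<forall>t. b \<le> t \<and> t \<le> c \<longrightarrow> F y t = F x t" unfolding P_def by blast
      have "\<forall>y\<in>U \<inter> V. \<forall>t. a \<le> t \<and> t \<le> c \<longrightarrow> F y t = F x t" using U(3) V(3) by (meson IntD1 IntD2 linear)
      then show "P a c" unfolding P_def using openin_Int[OF U(1) V(1)] U(2) V(2) by blast
    next
      fix t
      obtain U e where U: "openin X U" "x \<in> U" "e > 0" "\<forall>y\<in>U. \<forall>s. \<bar>s - t\<bar> < e \<longrightarrow> F y s = F x s"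
        using loc2[OF x, of t] by blast
      have "P a b" if "a \<le> t" "t \<le> b" "b - a < e" for a b
      proof -
        have "\<bar>s - t\<bar> < e" if "a \<le> s" "s \<le> b" for s using that \<open>a \<le> t\<close> \<open>t \<le> b\<close> \<open>b - a < e\<close> by linarith
        then show ?thesis unfolding P_def using U by blast
      qed
      then show "\<exists>d>0. \<forall>a b. a \<le> t \<and> t \<le> b \<and> b - a < d \<longrightarrow> P a b" using U(3) by blast
    qed simp
    then obtain U where U: "openin X U" "x \<in> U" "\<forall>y\<in>U. \<forall>t. - \<bar>K\<bar> \<le> t \<and> t \<le> \<bar>K\<bar> \<longrightarrow> F y t = F x t"
      unfolding P_def by blast
    have "- \<bar>K\<bar> \<le> t \<and> t \<le> \<bar>K\<bar>" if "\<bar>t\<bar> \<le> K" for t using that by linarith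
    then show "\<exists>U. openin X U \<and> x \<in> U \<and> (\<forall>y\<in>U. \<forall>t. \<bar>t\<bar> \<le> K \<longrightarrow> F y t = F x t)" using U by blast
  qed
  moreover from this have "PL_lift F" unfolding PL_lift_def dpl_def using F loc1 by blast
  moreover have "g = flow_map F"
  proof
    fix y show "g y = flow_map F y"
    proof (cases "y \<in> topspace Y")
      case True
      then obtain x t where "x \<in> S" "y = q (x, t)" by (rule Y_cases)
      then show ?thesis using gF flow_map_q[OF \<open>flow_lift F\<close>] by simp
    next
      case False
      then show ?thesis using H0(1) by (simp add: flow_map_def extensional_def)
    qed
  qed
  ultimately show thesis using that by blast
qed

end

section \<open>Finite generation\<close>

context td_system
begin

definition T :: "(('a \<times> real) set \<Rightarrow> ('a \<times> real) set) monoid" where "T = T_group X \<phi>"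

lemma T_set_eq: "T_set X \<phi> = flow_map ` {F. PL_lift F}"
proof
  show "T_set X \<phi> \<subseteq> flow_map ` {F. PL_lift F}"
  proof
    fix g assume "g \<in> T_set X \<phi>"
    then obtain F where "PL_lift F" "g = flow_map F" by (rule T_set_lift)
    then show "g \<in> flow_map ` {F. PL_lift F}" by blast
  qed
  show "flow_map ` {F. PL_lift F} \<subseteq> T_set X \<phi>" using flow_map_T_set by blast
qed

lemma PL_lift_flow_lift: "PL_lift F \<Longrightarrow> flow_lift F" by (simp add: PL_lift_def)

lemma flow_map_Bij: assumes "flow_lift F" shows "flow_map F \<in> Bij (topspace Y)"
proof -
  have "bij_betw (flow_map F) (topspace Y) (topspace Y)"
    by (rule bij_betw_byWitness[where f' = "flow_map (\<lambda>x. rinv (F x))"])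
      (use flow_map_inverse[OF assms] flow_map_in[OF assms] flow_map_in[OF flow_lift_inv[OF assms]] in auto)
  then show ?thesis unfolding Bij_def by (simp add: flow_map_def)
qed

lemma T_simps: "carrier T = flow_map ` {F. PL_lift F}" "\<one>\<^bsub>T\<^esub> = flow_map (\<lambda>x t. t)"
  "flow_lift F \<Longrightarrow> flow_lift H \<Longrightarrow> flow_map F \<otimes>\<^bsub>T\<^esub> flow_map H = flow_map (\<lambda>x t. F x (H x t))"
  unfolding T_def T_group_def BijGroup_def by (simp_all add: T_set_eq flow_map_id flow_map_Bij flow_map_comp)

lemma PL_lift_id: "PL_lift (\<lambda>x t. t)"
  using PL_lift_translate[of 0] by simp

lemma rinv_pi: assumes "PL_lift F" shows "flow_map (\<lambda>x. rinv (F x)) \<otimes>\<^bsub>T\<^esub> flow_map F = \<one>\<^bsub>T\<^esub>"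
proof -
  note sl = PL_lift_flow_lift[OF assms]
  have "flow_map (\<lambda>x t. rinv (F x) (F x t)) = flow_map (\<lambda>x t. t)"
    by (rule flow_map_cong) (simp add: flow_lift_rinv(1)[OF sl])
  then show ?thesis unfolding T_simps(2) T_simps(3)[OF flow_lift_inv[OF sl] sl] .
qed

lemma group_T: "group T"
proof (rule groupI)
  fix a assume "a \<in> carrier T"
  then obtain F where F: "a = flow_map F" "PL_lift F" unfolding T_simps(1) by blast
  show "\<one>\<^bsub>T\<^esub> \<otimes>\<^bsub>T\<^esub> a = a"
    unfolding F(1) T_simps(2) T_simps(3)[OF flow_lift_id PL_lift_flow_lift[OF F(2)]] ..
  show "\<exists>y\<in>carrier T. y \<otimes>\<^bsub>T\<^esub> a = \<one>\<^bsub>T\<^esub>"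
    unfolding F(1) using rinv_pi[OF F(2)] PL_lift_inv[OF F(2)] unfolding T_simps(1) by blast
  fix b assume "b \<in> carrier T"
  then obtain H where H: "b = flow_map H" "PL_lift H" unfolding T_simps(1) by blast
  note FH = PL_lift_flow_lift[OF F(2)] PL_lift_flow_lift[OF H(2)]
  show "a \<otimes>\<^bsub>T\<^esub> b \<in> carrier T"
    unfolding F(1) H(1) T_simps(3)[OF FH] T_simps(1) using PL_lift_comp[OF F(2) H(2)] by blast
  fix c assume "c \<in> carrier T"
  then obtain K where K: "c = flow_map K" "PL_lift K" unfolding T_simps(1) by blast
  note k = PL_lift_flow_lift[OF K(2)]
  show "a \<otimes>\<^bsub>T\<^esub> b \<otimes>\<^bsub>T\<^esub> c = a \<otimes>\<^bsub>T\<^esub> (b \<otimes>\<^bsub>T\<^esub> c)"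
    unfolding F(1) H(1) K(1) T_simps(3)[OF FH] T_simps(3)[OF FH(2) k]
      T_simps(3)[OF flow_lift_comp[OF FH] k] T_simps(3)[OF FH(1) flow_lift_comp[OF FH(2) k]] ..
next
  show "\<one>\<^bsub>T\<^esub> \<in> carrier T" unfolding T_simps(1,2) using PL_lift_id by blast
qed

theorem T_finitely_generated:
  assumes A: "finite \<A>" "\<And>C. C \<in> \<A> \<Longrightarrow> clop C" "\<And>C. clop C \<Longrightarrow> C \<in> balg \<A>"
  shows "finitely_generated_group T"
proof -
  define gens where "gens = insert (\<lambda>x t. t + 1/4)
    ((\<lambda>C. fragment (over C (xm 0 1))) ` insert S \<A> \<union> (\<lambda>C. fragment (over C (xm (1/2) 1))) ` insert S \<A>)"
  define R where "R = flow_map ` gens"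
  have cl: "clop C" if "C \<in> insert S \<A>" for C using that A(2) clop_ops(4) by blast
  have x: "xm 0 1 \<in> F1" "xm (1/2) 1 \<in> F1" by (auto intro!: F1_xm)
  have gl: "PL_lift F" if "F \<in> gens" for F
    using that PL_lift_translate[of "1/4"] fragment_lift[OF fam_over[OF cl x(1)]] fragment_lift[OF fam_over[OF cl x(2)]]
    unfolding gens_def by auto
  have R: "finite R" "R \<subseteq> carrier T" unfolding R_def T_simps(1) using A(1) gl by (auto simp: gens_def)
  interpret T: group T by (rule group_T)
  \<comment> \<open>With the lifts of the generated subgroup as \<open>G\<close>, the conclusion
    \<open>G_all\<close> of the locale says that the subgroup is everything.\<close>
  define G where "G = {F. PL_lift F \<and> flow_map F \<in> generate T R}"
  have gen: "F \<in> G" if "F \<in> gens" for F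
    unfolding G_def using gl[OF that] generate.incl[of "flow_map F" R T] that unfolding R_def by blast
  interpret generated_lifts X \<phi> G \<A>
  proof unfold_locales
    fix F H assume FH: "F \<in> G" "H \<in> G"
    then have l: "PL_lift F" "PL_lift H" "flow_map F \<in> generate T R" "flow_map H \<in> generate T R" unfolding G_def by auto
    have "flow_map F \<otimes>\<^bsub>T\<^esub> flow_map H \<in> generate T R" by (rule generate.eng[OF l(3,4)])
    then show "(\<lambda>x t. F x (H x t)) \<in> G"
      unfolding G_def T_simps(3)[OF PL_lift_flow_lift[OF l(1)] PL_lift_flow_lift[OF l(2)]] using PL_lift_comp[OF l(1,2)] by blast
  next
    fix F assume "F \<in> G"
    then have l: "PL_lift F" "flow_map F \<in> generate T R" unfolding G_def by auto
    have "inv\<^bsub>T\<^esub> (flow_map F) = flow_map (\<lambda>x. rinv (F x))"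
      by (rule T.inv_equality[OF rinv_pi[OF l(1)]]) (use l(1) PL_lift_inv[OF l(1)] in \<open>auto simp: T_simps(1)\<close>)
    then show "(\<lambda>x. rinv (F x)) \<in> G"
      unfolding G_def using T.generate_m_inv_closed[OF R(2) l(2)] PL_lift_inv[OF l(1)] by simp
  next
    fix F assume "F \<in> G" then show "PL_lift F" unfolding G_def by blast
  next
    fix F H assume FG: "F \<in> G" and eq: "\<And>x. x \<in> S \<Longrightarrow> F x = H x"
    have "PL_lift H" using FG flow_lift_cong[of F H] eq unfolding G_def PL_lift_def by auto
    moreover have "flow_map H = flow_map F" by (rule flow_map_cong) (simp add: eq)
    ultimately show "H \<in> G" using FG unfolding G_def by simp
  next
    show "(\<lambda>x t. t + 1/4) \<in> G" by (rule gen) (simp add: gens_def)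
  next
    fix C assume "C = S \<or> C \<in> \<A>"
    then have C: "C \<in> insert S \<A>" by blast
    show "fragment (over C (xm 0 1)) \<in> G" by (rule gen) (use C in \<open>auto simp: gens_def\<close>)
    show "fragment (over C (xm (1/2) 1)) \<in> G" by (rule gen) (use C in \<open>auto simp: gens_def\<close>)
  qed (use A(2,3) in auto)
  have "carrier T \<subseteq> generate T R"
    unfolding T_simps(1) using G_all unfolding G_def by blast
  then have "generate T R = carrier T" using T.generate_incl[OF R(2)] by blast
  then show ?thesis unfolding finitely_generated_group_def using group_T R by blast
qed

section \<open>Clopen sets in a generated algebra\<close>

text \<open>Intersecting with the whole space gives the right value for an empty index set.\<close>

lemma balg_finite_Inter:
  assumes "S \<in> balg \<A>" "finite I" "\<And>i. i \<in> I \<Longrightarrow> K i \<in> balg \<A>"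
  shows "S \<inter> (\<Inter>i\<in>I. K i) \<in> balg \<A>"
  using assms(2,3)
proof (induction I rule: finite_induct)
  case empty
  then show ?case using assms(1) by simp
next
  case (insert i I)
  have "K i \<in> balg \<A>" "S \<inter> (\<Inter>i\<in>I. K i) \<in> balg \<A>"
    using insert.IH insert.prems by simp_all
  then have "K i \<inter> (S \<inter> (\<Inter>i\<in>I. K i)) \<in> balg \<A>" by (rule balg.inter)
  moreover have "K i \<inter> (S \<inter> (\<Inter>i\<in>I. K i)) = S \<inter> (\<Inter>j\<in>insert i I. K j)" by auto
  ultimately show ?case by simp
qed

text \<open>By compactness finitely many of the given neighbourhoods cover \<open>C\<close>. Their
  union is written as the complement of a finite intersection, since \<open>balg\<close> has no rule
  for unions.\<close>

lemma balg_of_base: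
  assumes ne: "S \<in> balg \<A>" and C: "clop C"
    and base: "\<And>x. x \<in> C \<Longrightarrow> \<exists>W\<in>balg \<A>. openin X W \<and> x \<in> W \<and> W \<subseteq> C"
  shows "C \<in> balg \<A>"
proof -
  obtain W where W: "\<And>x. x \<in> C \<Longrightarrow> W x \<in> balg \<A> \<and> openin X (W x) \<and> x \<in> W x \<and> W x \<subseteq> C"
    using base by metis
  \<comment> \<open>Assigning the complement of \<open>C\<close> to points outside \<open>C\<close>
    gives an open cover of the whole space, to which \<open>compact_points\<close> applies.\<close>
  define U where "U x = (if x \<in> C then W x else S - C)" for x
  obtain P where P: "finite P" "P \<subseteq> S" "S \<subseteq> (\<Union>x\<in>P. U x)"
  proof (rule compact_points[of U])
    fix x assume "x \<in> S"
    then show "openin X (U x) \<and> x \<in> U x"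
      using W[of x] clop_ops(3)[OF clop_ops(4) C] unfolding U_def clop_def by auto
  qed blast
  have "C = S - (S \<inter> (\<Inter>x\<in>P \<inter> C. S - W x))"
  proof (intro equalityI subsetI)
    fix x assume x: "x \<in> C"
    then have "x \<in> S" using clop_sub[OF C] by blast
    then obtain z where z: "z \<in> P" "x \<in> U z" using P(3) by blast
    then have "z \<in> C" "x \<in> W z" using x unfolding U_def by (auto split: if_splits)
    then show "x \<in> S - (S \<inter> (\<Inter>x\<in>P \<inter> C. S - W x))" using z(1) \<open>x \<in> S\<close> by blast
  next
    fix x assume "x \<in> S - (S \<inter> (\<Inter>x\<in>P \<inter> C. S - W x))"
    then obtain z where "z \<in> C" "x \<in> W z" by blast
    then show "x \<in> C" using W[of z] by blast
  qed
  moreover have "S - (S \<inter> (\<Inter>x\<in>P \<inter> C. S - W x)) \<in> balg \<A>"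
    by (intro balg.compl balg_finite_Inter[OF ne]) (use P(1) W in \<open>auto intro: balg.compl\<close>)
  ultimately show ?thesis by simp
qed

end

text \<open>Cylinders are finite intersections of shifted letter sets and form a base of the
  subshift. Finiteness of the alphabet makes the letter sets a finite generating family.\<close>

theorem theorem1:
  fixes X :: "'a topology" and \<phi> :: "'a \<Rightarrow> 'a"
    and A :: "'b set" and S :: "(int \<Rightarrow> 'b) set"
  assumes "stone_system X \<phi>"
    and "finite A" and "subshift A S"
    and "topologically_conjugate X \<phi> (subtopology (full_shift A) S) shift"
  shows "finitely_generated_group (T_group X \<phi>)"
proof -
  interpret td_system X \<phi>
    by unfold_locales (use assms(1) in \<open>auto simp: stone_system_def\<close>)
  have ne: "topspace X \<noteq> {}" using assms(1) by (simp add: stone_system_def)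
  obtain h where h: "homeomorphic_map X (subtopology (full_shift A) S) h"
    "\<And>x. x \<in> topspace X \<Longrightarrow> h (\<phi> x) = shift (h x)"
    using assms(4) unfolding topologically_conjugate_def by blast
  have SA: "S \<subseteq> topspace (full_shift A)" using assms(3) unfolding subshift_def by (auto dest: closedin_subset)
  have hS: "h x \<in> S" and hA: "h x i \<in> A" if "x \<in> topspace X" for x i
  proof -
    have "h x \<in> topspace (subtopology (full_shift A) S)"
      using homeomorphic_imp_surjective_map[OF h(1)] that by blast
    then show "h x \<in> S" by simp
    then have "h x \<in> topspace (full_shift A)" using SA by blast
    then show "h x i \<in> A" by (auto simp: full_shift_def PiE_iff)
  qed
  have hit: "h (it n x) i = h x (i + n)" if x: "x \<in> topspace X" for x n i
  proof (induction n arbitrary: i rule: int_induct[where k = 0])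
    case base
    then show ?case by simp
  next
    case (step1 m)
    have "h (it (m + 1) x) i = h (it m x) (i + 1)" using h(2)[of "it m x"] it_step[OF x, of m] x by (simp add: shift_def)
    then show ?case unfolding step1(2) by (simp add: algebra_simps)
  next
    case (step2 m)
    have "h (it m x) (i - 1) = h (it (m - 1) x) i"
      using h(2)[of "it (m - 1) x"] it_step[OF x, of "m - 1"] x by (simp add: shift_def)
    then show ?case unfolding step2(2) by (simp add: algebra_simps)
  qed
  have hc: "continuous_map X (full_shift A) h"
    using homeomorphic_imp_continuous_map[OF h(1)] by (simp add: continuous_map_in_subtopology)
  define letter where "letter a = {x \<in> topspace X. h x 0 = a}" for a
  have letter_clop: "clop (letter a)" if "a \<in> A" for a
  proof -
    have "continuous_map (full_shift A) (discrete_topology A) (\<lambda>w. w 0)"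
      unfolding full_shift_def by (rule continuous_map_product_projection) simp
    from continuous_map_compose[OF hc this] have c: "continuous_map X (discrete_topology A) (\<lambda>x. h x 0)"
      by (simp add: o_def)
    have "openin X {x \<in> topspace X. h x 0 \<in> {a}}" "closedin X {x \<in> topspace X. h x 0 \<in> {a}}"
      by (rule openin_continuous_map_preimage[OF c], use that in simp)
        (rule closedin_continuous_map_preimage[OF c], use that in simp)
    then show ?thesis unfolding clop_def letter_def by simp
  qed
  \<comment> \<open>The whole space comes from a letter that occurs in the image of
    \<open>h\<close>, which exists because \<open>X\<close> is nonempty.\<close>
  have top_balg: "topspace X \<in> balg (letter ` A)"
  proof -
    obtain x where "x \<in> topspace X" using ne by blast
    then have "letter (h x 0) \<in> balg (letter ` A)" using hA by (blast intro: balg.base)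
    then have "topspace X - (letter (h x 0) \<inter> (topspace X - letter (h x 0))) \<in> balg (letter ` A)"
      by (intro balg.compl balg.inter)
    moreover have "topspace X - (letter (h x 0) \<inter> (topspace X - letter (h x 0))) = topspace X" by blast
    ultimately show ?thesis by simp
  qed
  have "C \<in> balg (letter ` A)" if C: "clop C" for C
  proof (rule balg_of_base[OF top_balg C])
    fix x assume x: "x \<in> C"
    then have xX: "x \<in> topspace X" using clop_sub[OF C] by blast
    have "openin (subtopology (full_shift A) S) (h ` C)"
      using homeomorphic_imp_open_map[OF h(1)] C unfolding open_map_def clop_def by blast
    then obtain V where V: "openin (full_shift A) V" "h ` C = V \<inter> S" unfolding openin_subtopology by blast
    have "h x \<in> V" using V(2) x by blast
    from product_topology_open_contains_basis[OF V(1)[unfolded full_shift_def] this]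
    obtain Z where Z: "h x \<in> (\<Pi>\<^sub>E i\<in>UNIV. Z i)" "finite {i. Z i \<noteq> topspace (discrete_topology A)}"
      "(\<Pi>\<^sub>E i\<in>UNIV. Z i) \<subseteq> V" by blast
    let ?I = "{i. Z i \<noteq> topspace (discrete_topology A)}"
    let ?K = "\<lambda>i. {y \<in> topspace X. it i y \<in> letter (h x i)}"
    \<comment> \<open>A basic open set constrains finitely many coordinates; \<open>W\<close>
      consists of the points that share these coordinates with \<open>x\<close>.\<close>
    define W where "W = topspace X \<inter> (\<Inter>i\<in>?I. ?K i)"
    have K: "?K i \<in> balg (letter ` A)" "openin X (?K i)" for i
      using balg.shift[OF balg.base, of "letter (h x i)" "letter ` A" i] hA[OF xX]
        clop_it[OF letter_clop[OF hA[OF xX]], of i i] by (auto simp: clop_def)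
    have Kh: "y \<in> ?K i \<longleftrightarrow> y \<in> topspace X \<and> h y i = h x i" for y i
      using hit[of y i 0] by (auto simp: letter_def)
    have "W \<in> balg (letter ` A)" unfolding W_def by (rule balg_finite_Inter[OF top_balg Z(2) K(1)])
    moreover have "openin X W"
      unfolding W_def using Z(2) K(2) by (cases "?I = {}") (auto intro!: openin_Int openin_INT)
    moreover have "x \<in> W" unfolding W_def using xX Kh by blast
    moreover have "W \<subseteq> C"
    proof
      fix y assume y: "y \<in> W"
      then have yX: "y \<in> topspace X" unfolding W_def by blast
      have "h y i \<in> Z i" for i
      proof (cases "i \<in> ?I")
        case True
        then have "y \<in> ?K i" using y unfolding W_def by blast
        then have "h y i = h x i" using Kh by blast
        then show ?thesis using Z(1) by (auto simp: PiE_iff)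
      next
        case False
        then show ?thesis using hA[OF yX] by auto
      qed
      then have "h y \<in> V \<inter> S" using Z(3) hS[OF yX] by (auto simp: PiE_iff)
      then obtain z where z: "z \<in> C" "h z = h y" unfolding V(2)[symmetric] by force
      then have "z = y"
        using homeomorphic_imp_injective_map[OF h(1)] yX clop_sub[OF C] by (auto dest: inj_onD)
      then show "y \<in> C" using z(1) by simp
    qed
    ultimately show "\<exists>W\<in>balg (letter ` A). openin X W \<and> x \<in> W \<and> W \<subseteq> C" by blast
  qed
  then have "finitely_generated_group T"
    by (intro T_finitely_generated[of "letter ` A"]) (use assms(2) letter_clop in auto)
  then show ?thesis unfolding T_def .
qed

end
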